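(* Let $\Omega\subset\mathbb{R}^N$ be a bounded open connected set, $p\in(1,\infty)$, $r,s\in(0,1)$, and $\alpha,\beta\ge 1$ with $\alpha+\beta=p$. Let $$\lambda_p=\min\left\{\mathcal{J}_p(w,z): (w,z)\in W^{1,p}_0(\Omega)\times W^{1,p}_0(\Omega),\ wz\neq 0\right\}$$ and let $(u_p,v_p)$ be a pair at which this minimum is attained, so that $(u_p,v_p)$ is an eigenpair associated to $\lambda_p$ for the system $$ \left\{ \begin{array}{rclcl} -\Delta_p u + (-\Delta)_p^r u & = & \frac{2\alpha}{\alpha+\beta}\lambda |u|^{\alpha-2}|v|^{\beta}u & \mbox{in} & \Omega \\ -\Delta_p v + (-\Delta)_p^s v& = & \frac{2\beta}{\alpha+\beta}\lambda |u|^{\alpha}|v|^{\beta-2}v & \mbox{in} & \Omega \\ u=v& =& 0&\mbox{on} & \mathbb{R}^N \setminus \Omega. \end{array} \right. $$ Then $\lambda_p$ is simple, i.e. if $(\tilde u_p,\tilde v_p)$ is another eigenpair associated to $\lambda_p$, then there exists a constant $k\neq 0$ such that either $(\tilde u_p,\tilde v_p)=k(u_p,v_p)$ or $(\tilde u_p,\tilde v_p)=k(u_p,-v_p)$.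
   Context: Functions in $W^{1,p}_0(\Omega)$ are extended by $0$ to all of $\mathbb{R}^N$. For $t\in(0,1)$ the Gagliardo seminorm is given by $$[w]_{p,t}^p=\iint_{\mathbb{R}^{2N}}\frac{|w(x)-w(y)|^p}{|x-y|^{N+tp}}\,dx\,dy,$$ which is finite for $w\in W_0^{1,p}(\Omega)$. The energy functional is $$\mathcal{J}_p(w,z)=\frac12\,\frac{\|\nabla w\|_{L^p(\Omega)}^p+[w]_{p,r}^p+\|\nabla z\|_{L^p(\Omega)}^p+[z]_{p,s}^p}{\int_\Omega |w|^\alpha|z|^\beta\,dx}.$$ The condition $wz\ne0$ means that the product $wz$ is not a.e. zero in $\Omega$. The minimum $\lambda_p$ is attained. Operators: $\Delta_p u=\mathrm{div}(|\nabla u|^{p-2}\nabla u)$ and $(-\Delta)_p^t u(x)=2\,\mathrm{P.V.}\int_{\mathbb{R}^N}\frac{|u(x)-u(y)|^{p-2}(u(x)-u(y))}{|x-y|^{N+tp}}\,dy$. Weak solution: set $\mathcal{E}_p(w,\psi)=\int_\Omega|\nabla w|^{p-2}\nabla w\cdot\nabla\psi\,dx$ and $\mathcal{E}_{t,p}(w,\psi)=\iint_{\mathbb{R}^{2N}}\frac{|w(x)-w(y)|^{p-2}(w(x)-w(y))(\psi(x)-\psi(y))}{|x-y|^{N+tp}}\,dx\,dy$. A pair $(u,v)\in W^{1,p}_0(\Omega)\times W^{1,p}_0(\Omega)$ is a weak solution of the system if for all $\psi,\varphi\in W^{1,p}_0(\Omega)$ $$\mathcal{E}_p(u,\psi)+\mathcal{E}_{r,p}(u,\psi)=\lambda\tfrac{2\alpha}{\alpha+\beta}\int_\Omega|u|^{\alpha-2}u|v|^\beta\psi\,dx,\qquad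 \mathcal{E}_p(v,\varphi)+\mathcal{E}_{s,p}(v,\varphi)=\lambda\tfrac{2\beta}{\alpha+\beta}\int_\Omega|u|^{\alpha}|v|^{\beta-2}v\,\varphi\,dx.$$ An eigenpair associated to $\lambda$ is a nontrivial weak solution $(u,v)$ of the system with that value of $\lambda$. *)

theory Defs
  imports "HOL-Analysis.Analysis"
begin

text \<open>
  Euclidean space of dimension \<open>N\<close> is a type of class \<^class>\<open>euclidean_space\<close>, \<open>N = DIM('a)\<close>.
  Elements of the function spaces are Borel representatives: every Lebesgue measurable function
  agrees almost everywhere with a Borel one, and all notions below are invariant under changes
  on null sets.
\<close>

subsection \<open>Sobolev spaces\<close>

primrec C_k :: "nat \<Rightarrow> ('a::euclidean_space \<Rightarrow> real) \<Rightarrow> bool" where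
  "C_k 0 f \<longleftrightarrow> continuous_on UNIV f"
| "C_k (Suc k) f \<longleftrightarrow> (\<forall>x. f differentiable (at x)) \<and>
     (\<forall>b\<in>Basis. C_k k (\<lambda>x. frechet_derivative f (at x) b))"

definition smooth :: "('a::euclidean_space \<Rightarrow> real) \<Rightarrow> bool" where
  "smooth f \<longleftrightarrow> (\<forall>k. C_k k f)"

definition test_function :: "'a::euclidean_space set \<Rightarrow> ('a \<Rightarrow> real) \<Rightarrow> bool" where
  "test_function \<Omega> \<phi> \<longleftrightarrow> smooth \<phi> \<and>
     compact (closure {x. \<phi> x \<noteq> 0}) \<and> closure {x. \<phi> x \<noteq> 0} \<subseteq> \<Omega>"

definition locally_integrable ::
    "'a::euclidean_space set \<Rightarrow> ('a \<Rightarrow> 'b::euclidean_space) \<Rightarrow> bool" where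
  "locally_integrable \<Omega> f \<longleftrightarrow>
     (\<forall>K. compact K \<and> K \<subseteq> \<Omega> \<longrightarrow> set_integrable lborel K f)"

definition weak_gradient ::
    "'a::euclidean_space set \<Rightarrow> ('a \<Rightarrow> real) \<Rightarrow> ('a \<Rightarrow> 'a) \<Rightarrow> bool" where
  "weak_gradient \<Omega> u g \<longleftrightarrow>
     u \<in> borel_measurable borel \<and> g \<in> borel_measurable borel \<and>
     locally_integrable \<Omega> u \<and> locally_integrable \<Omega> g \<and>
     (\<forall>\<phi>. test_function \<Omega> \<phi> \<longrightarrow> (\<forall>b\<in>Basis.
        (LINT x:\<Omega>|lborel. u x * frechet_derivative \<phi> (at x) b) =
        - (LINT x:\<Omega>|lborel. (g x \<bullet> b) * \<phi> x)))"

text \<open>The weak gradient is determined almost everywhere in \<open>\<Omega>\<close>; its values elsewhere are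
  immaterial, and \<open>wgrad\<close> picks one representative.\<close>

definition wgrad :: "'a::euclidean_space set \<Rightarrow> ('a \<Rightarrow> real) \<Rightarrow> 'a \<Rightarrow> 'a" where
  "wgrad \<Omega> u = (SOME g. weak_gradient \<Omega> u g)"

definition W1p :: "'a::euclidean_space set \<Rightarrow> real \<Rightarrow> ('a \<Rightarrow> real) set" where
  "W1p \<Omega> p = {u. u \<in> borel_measurable borel \<and>
     set_integrable lborel \<Omega> (\<lambda>x. \<bar>u x\<bar> powr p) \<and>
     (\<exists>g. weak_gradient \<Omega> u g \<and> set_integrable lborel \<Omega> (\<lambda>x. norm (g x) powr p))}"

definition W1p_norm :: "'a::euclidean_space set \<Rightarrow> real \<Rightarrow> ('a \<Rightarrow> real) \<Rightarrow> real" where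
  "W1p_norm \<Omega> p u =
     ((LINT x:\<Omega>|lborel. \<bar>u x\<bar> powr p) + (LINT x:\<Omega>|lborel. norm (wgrad \<Omega> u x) powr p)) powr (1 / p)"

text \<open>Closure of the test functions in the Sobolev norm. Membership includes the extension
  by zero to the whole space.\<close>

definition W01p :: "'a::euclidean_space set \<Rightarrow> real \<Rightarrow> ('a \<Rightarrow> real) set" where
  "W01p \<Omega> p = {u \<in> W1p \<Omega> p. (\<forall>x. x \<notin> \<Omega> \<longrightarrow> u x = 0) \<and>
     (\<exists>\<phi>. (\<forall>n. test_function \<Omega> (\<phi> n)) \<and>
          (\<lambda>n. W1p_norm \<Omega> p (\<lambda>x. \<phi> n x - u x)) \<longlonglongrightarrow> 0)}"

subsection \<open>Energy functional and its infimum\<close>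

text \<open>The \<open>p\<close>-th power of the Gagliardo seminorm. The diagonal is a null set.\<close>

definition gagliardo_pow :: "real \<Rightarrow> real \<Rightarrow> ('a::euclidean_space \<Rightarrow> real) \<Rightarrow> real" where
  "gagliardo_pow p t w =
     (LINT z|(lborel \<Otimes>\<^sub>M lborel).
        \<bar>w (fst z) - w (snd z)\<bar> powr p / norm (fst z - snd z) powr (real DIM('a) + t * p))"

definition energy_J :: "'a::euclidean_space set \<Rightarrow> real \<Rightarrow> real \<Rightarrow> real \<Rightarrow> real \<Rightarrow> real \<Rightarrow>
    ('a \<Rightarrow> real) \<Rightarrow> ('a \<Rightarrow> real) \<Rightarrow> real" where
  "energy_J \<Omega> p r s \<alpha> \<beta> w z = 1 / 2 *
     (((LINT x:\<Omega>|lborel. norm (wgrad \<Omega> w x) powr p) + gagliardo_pow p r w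
       + (LINT x:\<Omega>|lborel. norm (wgrad \<Omega> z x) powr p) + gagliardo_pow p s z)
      / (LINT x:\<Omega>|lborel. \<bar>w x\<bar> powr \<alpha> * \<bar>z x\<bar> powr \<beta>))"

definition admissible :: "'a::euclidean_space set \<Rightarrow> real \<Rightarrow> (('a \<Rightarrow> real) \<times> ('a \<Rightarrow> real)) set" where
  "admissible \<Omega> p = {(w, z). w \<in> W01p \<Omega> p \<and> z \<in> W01p \<Omega> p \<and>
     \<not> (AE x in lborel. x \<in> \<Omega> \<longrightarrow> w x * z x = 0)}"

definition lambda_p :: "'a::euclidean_space set \<Rightarrow> real \<Rightarrow> real \<Rightarrow> real \<Rightarrow> real \<Rightarrow> real \<Rightarrow> real" where
  "lambda_p \<Omega> p r s \<alpha> \<beta> = (INF (w, z) \<in> admissible \<Omega> p. energy_J \<Omega> p r s \<alpha> \<beta> w z)"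

definition min_attained_at :: "'a::euclidean_space set \<Rightarrow> real \<Rightarrow> real \<Rightarrow> real \<Rightarrow> real \<Rightarrow> real \<Rightarrow>
    ('a \<Rightarrow> real) \<Rightarrow> ('a \<Rightarrow> real) \<Rightarrow> bool" where
  "min_attained_at \<Omega> p r s \<alpha> \<beta> u v \<longleftrightarrow>
     (u, v) \<in> admissible \<Omega> p \<and> energy_J \<Omega> p r s \<alpha> \<beta> u v = lambda_p \<Omega> p r s \<alpha> \<beta>"

subsection \<open>Weak solutions and eigenpairs\<close>

definition form_local :: "'a::euclidean_space set \<Rightarrow> real \<Rightarrow> ('a \<Rightarrow> real) \<Rightarrow> ('a \<Rightarrow> real) \<Rightarrow> real" where
  "form_local \<Omega> p w \<psi> =
     (LINT x:\<Omega>|lborel. norm (wgrad \<Omega> w x) powr (p - 2) * (wgrad \<Omega> w x \<bullet> wgrad \<Omega> \<psi> x))"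

definition form_nonlocal :: "real \<Rightarrow> real \<Rightarrow> ('a::euclidean_space \<Rightarrow> real) \<Rightarrow> ('a \<Rightarrow> real) \<Rightarrow> real" where
  "form_nonlocal t p w \<psi> =
     (LINT z|(lborel \<Otimes>\<^sub>M lborel).
        \<bar>w (fst z) - w (snd z)\<bar> powr (p - 2) * (w (fst z) - w (snd z)) * (\<psi> (fst z) - \<psi> (snd z))
        / norm (fst z - snd z) powr (real DIM('a) + t * p))"

text \<open>Where \<open>u x = 0\<close> the factor \<open>\<bar>u x\<bar> powr (\<alpha> - 2) * u x\<close> is \<open>0\<close>, also for \<open>\<alpha> < 2\<close>;
  likewise for \<open>v\<close>. The condition outside \<open>\<Omega>\<close> is part of \<^const>\<open>W01p\<close>.\<close>

definition weak_solution :: "'a::euclidean_space set \<Rightarrow> real \<Rightarrow> real \<Rightarrow> real \<Rightarrow> real \<Rightarrow> real \<Rightarrow> real \<Rightarrow>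
    ('a \<Rightarrow> real) \<Rightarrow> ('a \<Rightarrow> real) \<Rightarrow> bool" where
  "weak_solution \<Omega> p r s \<alpha> \<beta> lam u v \<longleftrightarrow> u \<in> W01p \<Omega> p \<and> v \<in> W01p \<Omega> p \<and>
     (\<forall>\<psi>\<in>W01p \<Omega> p. form_local \<Omega> p u \<psi> + form_nonlocal r p u \<psi> =
        lam * (2 * \<alpha> / (\<alpha> + \<beta>)) *
        (LINT x:\<Omega>|lborel. \<bar>u x\<bar> powr (\<alpha> - 2) * u x * \<bar>v x\<bar> powr \<beta> * \<psi> x)) \<and>
     (\<forall>\<phi>\<in>W01p \<Omega> p. form_local \<Omega> p v \<phi> + form_nonlocal s p v \<phi> =
        lam * (2 * \<beta> / (\<alpha> + \<beta>)) *
        (LINT x:\<Omega>|lborel. \<bar>u x\<bar> powr \<alpha> * \<bar>v x\<bar> powr (\<beta> - 2) * v x * \<phi> x))"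

definition eigenpair :: "'a::euclidean_space set \<Rightarrow> real \<Rightarrow> real \<Rightarrow> real \<Rightarrow> real \<Rightarrow> real \<Rightarrow> real \<Rightarrow>
    ('a \<Rightarrow> real) \<Rightarrow> ('a \<Rightarrow> real) \<Rightarrow> bool" where
  "eigenpair \<Omega> p r s \<alpha> \<beta> lam u v \<longleftrightarrow> weak_solution \<Omega> p r s \<alpha> \<beta> lam u v \<and>
     \<not> (AE x in lborel. x \<in> \<Omega> \<longrightarrow> u x = 0 \<and> v x = 0)"

end

theory Submission
  imports Defs
begin

text \<open>
  Write \<open>F\<close> for the numerator of the quotient and \<open>G\<close> for its denominator; then \<open>F \<ge> 2 \<lambda> G\<close>, and
  both minimizers and eigenpairs attain equality (test the system with the pair itself). Given two
  pairs \<open>(u, v)\<close> and \<open>(a, b)\<close> attaining it, consider the curve of hidden convexity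
  \<open>\<sigma> = ((\<bar>u\<bar>\<^sup>p + \<bar>a\<bar>\<^sup>p) / 2)\<close> to the power \<open>1 / p\<close> and the analogous \<open>\<tau>\<close> for \<open>v\<close>, \<open>b\<close>. Minkowski's inequality in the
  plane bounds \<open>F(\<sigma>, \<tau>)\<close> by the average of the two values of \<open>F\<close>, and Young's inequality bounds
  \<open>G(\<sigma>, \<tau>)\<close> below by the average of the values of \<open>G\<close>. Hence equality holds throughout; in the Gagliardo
  terms it says that \<open>(u(x), a(x))\<close> and \<open>(u(y), a(y))\<close> are parallel for almost all \<open>x\<close>, \<open>y\<close>, so \<open>a = k u\<close>
  and likewise \<open>b = m v\<close>, and the system itself forces \<open>\<bar>k\<bar> = \<bar>m\<bar>\<close>. No maximum principle is needed.
  Instead of placing \<open>\<sigma>\<close> in the Sobolev space, the argument runs along smoothed curves of test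
  functions and passes to the limit with Fatou's lemma.
\<close>

subsection \<open>Smooth functions\<close>

text \<open>The gradient term compares \<open>u\<close> and \<open>a\<close> only infinitesimally,
  so equality there would still have to be integrated over the set where \<open>u\<close> does not
  vanish. The Gagliardo term compares all pairs of points at once and yields a single constant;
  hence only its deficit is recorded, while the slack in the gradient term is dropped as a
  nonnegative quantity. Both \<open>F\<close> and \<open>G\<close> are homogeneous of degree
  \<open>p = \<alpha> + \<beta>\<close>, so the two pairs can be averaged without a common
  normalization. Along the approximating curve only one-sided information enters: energies of test
  functions are eventually at most the limit energy plus an error, and the coupling is bounded below
  by Fatou. The inequality \<open>F \<ge> 2 \<lambda> G\<close> with
  \<open>\<lambda> \<ge> 0\<close> then squeezes the deficit to zero. The analytic basis consists of
  a.e. uniqueness of weak gradients, since \<open>wgrad\<close> is an arbitrary choice, and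
  finiteness of the seminorm on \<open>W01p\<close>.\<close>

lemma C_k_Suc_imp: "C_k (Suc k) f \<Longrightarrow> C_k k f"
proof (induction k arbitrary: f)
  case 0
  then show ?case
    by (auto intro!: continuous_at_imp_continuous_on differentiable_imp_continuous_within)
next
  case (Suc k)
  then show ?case by (metis C_k.simps(2))
qed

lemma smooth_iff:
  "smooth f \<longleftrightarrow> (\<forall>x. f differentiable (at x)) \<and>
     (\<forall>b\<in>Basis. smooth (\<lambda>x. frechet_derivative f (at x) b))"
proof
  assume "smooth f"
  then have "C_k (Suc k) f" for k unfolding smooth_def by blast
  then show "(\<forall>x. f differentiable (at x)) \<and>
     (\<forall>b\<in>Basis. smooth (\<lambda>x. frechet_derivative f (at x) b))"
    unfolding smooth_def by simp
next
  assume a: "(\<forall>x. f differentiable (at x)) \<and>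
     (\<forall>b\<in>Basis. smooth (\<lambda>x. frechet_derivative f (at x) b))"
  have "C_k (Suc k) f" for k using a unfolding smooth_def by simp
  then show "smooth f" unfolding smooth_def using C_k_Suc_imp by blast
qed

text \<open>Intended for families closed under differentiation, whose members are best shown smooth
  all at once; \<open>smooth_flat_exp\<close> uses it with the functions polynomial in
  \<open>1 / t\<close> times \<open>exp (- 1 / t)\<close>.\<close>

lemma smooth_coinduct:
  assumes "f \<in> S"
    and S: "\<And>f x. f \<in> S \<Longrightarrow> f differentiable (at x)"
      "\<And>f b. f \<in> S \<Longrightarrow> b \<in> Basis \<Longrightarrow> (\<lambda>x. frechet_derivative f (at x) b) \<in> S"
  shows "smooth f"
proof -
  have "C_k k f" if "f \<in> S" for k f using that
  proof (induction k arbitrary: f)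
    case 0
    then show ?case using S
      by (auto intro!: continuous_at_imp_continuous_on differentiable_imp_continuous_within)
  next
    case (Suc k)
    then show ?case using S by simp
  qed
  then show ?thesis using assms(1) unfolding smooth_def by blast
qed

lemma smooth_differentiable: "smooth f \<Longrightarrow> f differentiable (at x)"
  using smooth_iff by blast

lemma smooth_has_derivative: "smooth f \<Longrightarrow> (f has_derivative frechet_derivative f (at x)) (at x)"
  using smooth_differentiable frechet_derivative_works by blast

lemma smooth_partial: "smooth f \<Longrightarrow> b \<in> Basis \<Longrightarrow> smooth (\<lambda>x. frechet_derivative f (at x) b)"
  using smooth_iff by blast

lemma smooth_continuous_on: "smooth f \<Longrightarrow> continuous_on S f"
  by (meson C_k.simps(1) continuous_on_subset smooth_def subset_UNIV)

lemma smooth_borel_measurable: "smooth f \<Longrightarrow> f \<in> borel_measurable borel"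
  using borel_measurable_continuous_onI smooth_continuous_on by blast

lemma frechet_derivativeI: "(f has_derivative f') (at x) \<Longrightarrow> frechet_derivative f (at x) = f'"
  by (metis frechet_derivative_at)

lemma C_k_const: "C_k k (\<lambda>x. c)"
  by (induction k arbitrary: c) (auto)

lemma C_k_add: "C_k k f \<Longrightarrow> C_k k g \<Longrightarrow> C_k k (\<lambda>x. f x + g x)"
proof (induction k arbitrary: f g)
  case 0
  then show ?case by (auto intro: continuous_intros)
next
  case (Suc k)
  then have d: "(f has_derivative frechet_derivative f (at x)) (at x)"
    "(g has_derivative frechet_derivative g (at x)) (at x)" for x
    by (auto simp: frechet_derivative_works[symmetric])
  have "frechet_derivative (\<lambda>x. f x + g x) (at x) =
      (\<lambda>h. frechet_derivative f (at x) h + frechet_derivative g (at x) h)" for x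
    by (intro frechet_derivativeI has_derivative_add d)
  then show ?case using Suc by auto
qed

lemma C_k_mult: "C_k k f \<Longrightarrow> C_k k g \<Longrightarrow> C_k k (\<lambda>x. f x * g x)"
proof (induction k arbitrary: f g)
  case 0
  then show ?case by (auto intro: continuous_intros)
next
  case (Suc k)
  then have d: "(f has_derivative frechet_derivative f (at x)) (at x)"
    "(g has_derivative frechet_derivative g (at x)) (at x)" for x
    by (auto simp: frechet_derivative_works[symmetric])
  have "frechet_derivative (\<lambda>x. f x * g x) (at x) =
      (\<lambda>h. f x * frechet_derivative g (at x) h + frechet_derivative f (at x) h * g x)" for x
    by (intro frechet_derivativeI has_derivative_mult d)
  then show ?case using Suc C_k_Suc_imp[of k f] C_k_Suc_imp[of k g] by (auto intro!: C_k_add)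
qed

lemma C_k_powr: "C_k k f \<Longrightarrow> (\<And>x. 0 < f x) \<Longrightarrow> C_k k (\<lambda>x. f x powr q)"
proof (induction k arbitrary: q)
  case 0
  then show ?case by (auto intro!: continuous_intros simp: less_le)
next
  case (Suc k)
  then have d: "(f has_derivative frechet_derivative f (at x)) (at x)" for x
    by (auto simp: frechet_derivative_works[symmetric])
  have d2: "((\<lambda>x. f x powr q) has_derivative
      (\<lambda>h. (q * f x powr (q - 1)) * frechet_derivative f (at x) h)) (at x)" for x
    using has_derivative_powr[OF d has_derivative_const[of q] Suc.prems(2), of x] Suc.prems(2)[of x]
    by (simp add: powr_diff field_simps)
  have "C_k k (\<lambda>x. (q * f x powr (q - 1)) * frechet_derivative f (at x) b)" if "b \<in> Basis" for b
    using Suc C_k_Suc_imp[of k f] that by (intro C_k_mult C_k_const) auto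
  then show ?case using frechet_derivativeI[OF d2] d2 by (auto simp: differentiable_def)
qed

lemma C_k_compose: "C_k k h \<Longrightarrow> C_k k f \<Longrightarrow> C_k k (\<lambda>x. h (f x :: real))"
proof (induction k arbitrary: h)
  case 0
  then show ?case by (auto intro: continuous_on_compose2)
next
  case (Suc k)
  then have d: "(f has_derivative frechet_derivative f (at x)) (at x)"
     "(h has_derivative frechet_derivative h (at y)) (at y)" for x y
    by (auto simp: frechet_derivative_works[symmetric])
  \<comment> \<open>A linear map on the reals is multiplication by its value at 1, and 1 is the only
    basis element. So the outer derivative becomes a scalar function of class \<open>C_k k\<close>,
    to which the induction hypothesis applies.\<close>
  have lin: "linear (frechet_derivative h (at y))" for y
    using d(2) has_derivative_linear by blast
  have e: "frechet_derivative h (at y) t = t * frechet_derivative h (at y) 1" for y t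
    using linear_scale[OF lin, of y t 1] by simp
  have d2: "((\<lambda>x. h (f x)) has_derivative
      (\<lambda>v. frechet_derivative f (at x) v * frechet_derivative h (at (f x)) 1)) (at x)" for x
    using has_derivative_compose[OF d(1) d(2)[of "f x"]] by (subst (asm) e)
  have "C_k k (\<lambda>x. frechet_derivative f (at x) b * frechet_derivative h (at (f x)) 1)"
    if "b \<in> Basis" for b
    using Suc.prems that by (intro C_k_mult Suc.IH[OF _ C_k_Suc_imp]) auto
  then show ?case using frechet_derivativeI[OF d2] d2 by (auto simp: differentiable_def)
qed

lemma smooth_const: "smooth (\<lambda>x. c)"
  by (simp add: smooth_def C_k_const)
lemma smooth_add: "smooth f \<Longrightarrow> smooth g \<Longrightarrow> smooth (\<lambda>x. f x + g x)"
  by (simp add: smooth_def C_k_add)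
lemma smooth_mult: "smooth f \<Longrightarrow> smooth g \<Longrightarrow> smooth (\<lambda>x. f x * g x)"
  by (simp add: smooth_def C_k_mult)
lemma smooth_powr: "smooth f \<Longrightarrow> (\<And>x. 0 < f x) \<Longrightarrow> smooth (\<lambda>x. f x powr q)"
  by (simp add: smooth_def C_k_powr)
lemma smooth_compose: "smooth h \<Longrightarrow> smooth f \<Longrightarrow> smooth (\<lambda>x. h (f x :: real))"
  by (simp add: smooth_def C_k_compose)

lemma smooth_inner_right: "smooth (\<lambda>x. x \<bullet> c)"
proof -
  have "((\<lambda>x. x \<bullet> c) has_derivative (\<lambda>h. h \<bullet> c)) (at x)" for x
    by (intro derivative_eq_intros) auto
  then show ?thesis
    by (subst smooth_iff) (auto simp: frechet_derivativeI[of _ "\<lambda>h. h \<bullet> c"] smooth_const differentiable_def)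
qed

lemma smooth_prod:
  assumes "finite I" "\<And>i. i \<in> I \<Longrightarrow> smooth (f i)"
  shows "smooth (\<lambda>x. \<Prod>i\<in>I. f i x)"
  using assms by (induction I rule: finite_induct) (auto intro: smooth_const smooth_mult)

text \<open>The classical smooth function that is flat at 0, from which the box bumps below are
  built.\<close>

definition flat_exp :: "real \<Rightarrow> real" where
  "flat_exp t = (if t > 0 then exp (- 1 / t) else 0)"

text \<open>For \<open>t > 0\<close> the derivative of \<open>P(1/t) exp(-1/t)\<close> has the same
  shape with \<open>P\<close> replaced by \<open>X^2 (P - P')\<close>, and at 0 the exponential
  beats every polynomial in \<open>1/t\<close>.\<close>

lemma smooth_flat_exp: "smooth flat_exp"
proof -
  define E :: "real poly \<Rightarrow> real \<Rightarrow> real" where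
    "E P t = (if t > 0 then poly P (1/t) * exp (- (1/t)) else 0)" for P t
  have lim: "((\<lambda>s. poly P s * exp (- s)) \<longlongrightarrow> 0) at_top" for P :: "real poly"
  proof -
    have "((\<lambda>s. \<Sum>i\<le>degree P. coeff P i * (s ^ i / exp s)) \<longlongrightarrow> (\<Sum>i\<le>degree P. coeff P i * 0)) at_top"
      by (intro tendsto_intros tendsto_power_div_exp_0)
    then show ?thesis
      unfolding poly_altdef exp_minus sum_distrib_right divide_inverse mult.assoc by simp
  qed
  have der: "(E P has_real_derivative E (monom 1 2 * (P - pderiv P)) t) (at t)" for P t
  proof -
    consider "t > 0" | "t < 0" | "t = 0" by linarith
    then show ?thesis
    proof cases
      case 1
      have "((\<lambda>t. poly P (1/t) * exp (- (1/t))) has_real_derivative E (monom 1 2 * (P - pderiv P)) t) (at t)"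
        using 1 unfolding E_def
        by (auto intro!: derivative_eq_intros simp: poly_monom field_simps power2_eq_square)
      moreover have "\<forall>\<^sub>F s in nhds t. E P s = poly P (1/s) * exp (- (1/s))"
        using 1 by (auto simp: E_def eventually_nhds intro!: exI[of _ "{0<..}"])
      ultimately show ?thesis by (rule DERIV_cong_ev[OF refl _ refl, THEN iffD2, rotated])
    next
      case 2
      have "((\<lambda>t. 0) has_real_derivative E (monom 1 2 * (P - pderiv P)) t) (at t)"
        using 2 unfolding E_def by auto
      moreover have "\<forall>\<^sub>F s in nhds t. E P s = 0"
        using 2 by (auto simp: E_def eventually_nhds intro!: exI[of _ "{..<0}"])
      ultimately show ?thesis by (rule DERIV_cong_ev[OF refl _ refl, THEN iffD2, rotated])
    next
      case 3
      have "((\<lambda>h. E P h / h) \<longlongrightarrow> 0) (at_right 0)"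
      proof -
        \<comment> \<open>\<open>pCons 0 P\<close> is \<open>P\<close> times its variable; it
          absorbs the factor \<open>1 / h\<close> of the difference quotient at 0, so that
          \<open>lim\<close> applies again.\<close>
        have "((\<lambda>h. poly (pCons 0 P) (inverse h) * exp (- (inverse h))) \<longlongrightarrow> 0) (at_right (0::real))"
          by (rule filterlim_compose[OF lim filterlim_inverse_at_top_right])
        moreover have "\<forall>\<^sub>F h in at_right 0. poly (pCons 0 P) (inverse h) * exp (- (inverse h)) = E P h / h"
          by (auto simp: eventually_at_right_field E_def field_simps intro!: exI[of _ 1])
        ultimately show ?thesis by (rule Lim_transform_eventually)
      qed
      moreover have "((\<lambda>h. E P h / h) \<longlongrightarrow> 0) (at_left 0)"
        by (rule tendsto_eventually) (auto simp: eventually_at_left_field E_def intro!: exI[of _ "-1"])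
      ultimately have "((\<lambda>h. E P h / h) \<longlongrightarrow> 0) (at 0)"
        by (simp add: filterlim_split_at)
      then show ?thesis using 3 by (simp add: DERIV_def E_def)
    qed
  qed
  have "smooth (E 1)"
  proof (rule smooth_coinduct[where S = "range E"])
    fix f b x assume f: "f \<in> range E"
    then obtain P where P: "f = E P" by blast
    show "f differentiable (at x)"
      using der P real_differentiable_def by blast
    assume "b \<in> (Basis :: real set)"
    then have "(\<lambda>x. frechet_derivative f (at x) b) = E (monom 1 2 * (P - pderiv P))"
      using frechet_derivativeI[OF der[of P, THEN has_field_derivative_imp_has_derivative]] P by auto
    then show "(\<lambda>x. frechet_derivative f (at x) b) \<in> range E" by blast
  qed auto
  moreover have "E 1 = flat_exp" by (auto simp: E_def flat_exp_def)
  ultimately show ?thesis by simp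
qed

subsection \<open>Test functions and integration by parts\<close>

lemma closed_subset_compact: "closed S \<Longrightarrow> S \<subseteq> T \<Longrightarrow> compact T \<Longrightarrow> compact S"
  by (metis compact_Int_closed inf.absorb2 inf_commute inf.absorb1)

lemma frechet_derivative_zero_outside_support:
  assumes "x \<notin> closure {x. f x \<noteq> 0}"
  shows "frechet_derivative f (at x) = (\<lambda>h. 0 :: real)"
proof (rule frechet_derivativeI)
  have "((\<lambda>x. 0 :: real) has_derivative (\<lambda>h. 0)) (at x)" by simp
  moreover have "open (- closure {x. f x \<noteq> 0})" by auto
  ultimately show "(f has_derivative (\<lambda>h. 0)) (at x)"
    by (rule has_derivative_transform_within_open)
      (use assms closure_subset[of "{x. f x \<noteq> 0}"] in auto)
qed

text \<open>Two supports are allowed because the smoothed midpoint of two test functions is only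
  known to vanish where both of them do; the union of the supports is still compact in
  \<Omega>.\<close>

lemma test_functionI:
  assumes "smooth \<psi>" "test_function \<Omega> \<phi>" "test_function \<Omega> \<eta>"
    and z: "\<And>x. \<phi> x = 0 \<Longrightarrow> \<eta> x = 0 \<Longrightarrow> \<psi> x = 0"
  shows "test_function \<Omega> \<psi>"
proof -
  have "closure {x. \<psi> x \<noteq> 0} \<subseteq> closure ({x. \<phi> x \<noteq> 0} \<union> {x. \<eta> x \<noteq> 0})"
    by (rule closure_mono) (use z in auto)
  then have "closure {x. \<psi> x \<noteq> 0} \<subseteq> closure {x. \<phi> x \<noteq> 0} \<union> closure {x. \<eta> x \<noteq> 0}"
    by simp
  moreover have "compact (closure {x. \<phi> x \<noteq> 0} \<union> closure {x. \<eta> x \<noteq> 0})"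
    "closure {x. \<phi> x \<noteq> 0} \<union> closure {x. \<eta> x \<noteq> 0} \<subseteq> \<Omega>"
    using assms(2,3) unfolding test_function_def by (auto intro: compact_Un)
  ultimately show ?thesis using assms(1) closed_subset_compact[OF closed_closure]
    unfolding test_function_def by (meson order_trans)
qed

lemma test_function_smooth: "test_function \<Omega> \<phi> \<Longrightarrow> smooth \<phi>"
  by (simp add: test_function_def)

lemma test_function_add:
  "test_function \<Omega> \<phi> \<Longrightarrow> test_function \<Omega> \<eta> \<Longrightarrow> test_function \<Omega> (\<lambda>x. \<phi> x + \<eta> x)"
  by (rule test_functionI[of _ \<Omega> \<phi> \<eta>]) (auto intro: smooth_add test_function_smooth)

lemma test_function_cmult:
  "test_function \<Omega> \<phi> \<Longrightarrow> test_function \<Omega> (\<lambda>x. c * \<phi> x)"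
  by (rule test_functionI[of _ \<Omega> \<phi> \<phi>]) (auto intro: smooth_mult smooth_const test_function_smooth)

lemma test_function_smooth_mult:
  "smooth f \<Longrightarrow> test_function \<Omega> \<phi> \<Longrightarrow> test_function \<Omega> (\<lambda>x. f x * \<phi> x)"
  by (rule test_functionI[of _ \<Omega> \<phi> \<phi>]) (auto intro: smooth_mult test_function_smooth)

lemma test_function_partial:
  assumes "test_function \<Omega> \<phi>" "b \<in> Basis"
  shows "test_function \<Omega> (\<lambda>x. frechet_derivative \<phi> (at x) b)"
proof -
  let ?K = "closure {x. \<phi> x \<noteq> 0}"
  have K: "compact ?K" "?K \<subseteq> \<Omega>" using assms(1) unfolding test_function_def by auto
  have "{x. frechet_derivative \<phi> (at x) b \<noteq> 0} \<subseteq> ?K"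
    using frechet_derivative_zero_outside_support[of _ \<phi>] by fastforce
  then have sub: "closure {x. frechet_derivative \<phi> (at x) b \<noteq> 0} \<subseteq> ?K"
    by (simp add: closure_minimal)
  then have "compact (closure {x. frechet_derivative \<phi> (at x) b \<noteq> 0})"
    using K(1) closed_subset_compact closed_closure by blast
  then show ?thesis using assms sub K unfolding test_function_def
    by (auto intro: smooth_partial)
qed

lemma test_function_zero_outside: "test_function \<Omega> \<phi> \<Longrightarrow> x \<notin> \<Omega> \<Longrightarrow> \<phi> x = 0"
  using closure_subset[of "{x. \<phi> x \<noteq> 0}"] unfolding test_function_def by auto

lemma integrable_compact_support:
  fixes f :: "'a::euclidean_space \<Rightarrow> 'b::{banach, second_countable_topology}"
  assumes "continuous_on UNIV f" "compact K" "\<And>x. x \<notin> K \<Longrightarrow> f x = 0"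
  shows "integrable lborel f"
proof -
  have "integrable lborel (\<lambda>x. indicator K x *\<^sub>R f x)"
    using assms borel_integrable_compact continuous_on_subset by blast
  also have "(\<lambda>x. indicator K x *\<^sub>R f x) = f"
    using assms(3) by (auto simp: fun_eq_iff indicator_def)
  finally show ?thesis .
qed

lemma test_function_integrable:
  assumes "test_function \<Omega> \<phi>" shows "integrable lborel \<phi>"
  by (rule integrable_compact_support[where K = "closure {x. \<phi> x \<noteq> 0}"])
    (use assms closure_subset[of "{x. \<phi> x \<noteq> 0}"] in \<open>auto simp: test_function_def smooth_continuous_on\<close>)

lemma test_function_bounded:
  assumes "test_function \<Omega> \<phi>" obtains C where "\<And>x. \<bar>\<phi> x\<bar> \<le> C"
proof -
  let ?K = "closure {x. \<phi> x \<noteq> 0}"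
  have "compact (\<phi> ` ?K)"
    using assms by (auto simp: test_function_def smooth_continuous_on intro!: compact_continuous_image)
  then obtain C where C: "\<And>x. x \<in> ?K \<Longrightarrow> \<bar>\<phi> x\<bar> \<le> C"
    by (meson bounded_real compact_imp_bounded imageI)
  have "\<bar>\<phi> x\<bar> \<le> max C 0" for x
    using C[of x] closure_subset[of "{x. \<phi> x \<noteq> 0}"] by (cases "\<phi> x = 0") (auto simp: subset_eq le_max_iff_disj)
  then show ?thesis using that by blast
qed

section \<open>Translation invariance and integration by parts\<close>

lemma nn_integral_lborel_translate:
  fixes c :: "'a::euclidean_space"
  assumes "f \<in> borel_measurable borel"
  shows "(\<integral>\<^sup>+x. f (x + c) \<partial>lborel) = (\<integral>\<^sup>+x. f x \<partial>lborel)"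
proof -
  have "(\<integral>\<^sup>+x. f x \<partial>lborel) = (\<integral>\<^sup>+x. f x \<partial>distr lborel borel ((+) c))"
    by (simp add: lborel_distr_plus)
  also have "\<dots> = (\<integral>\<^sup>+x. f (c + x) \<partial>lborel)"
    using assms by (subst nn_integral_distr) auto
  finally show ?thesis by (simp add: add.commute)
qed

lemma integral_lborel_translate:
  fixes c :: "'a::euclidean_space" and f :: "'a \<Rightarrow> real"
  assumes "f \<in> borel_measurable borel"
  shows "(LINT x|lborel. f (x + c)) = (LINT x|lborel. f x)"
proof -
  have "(LINT x|lborel. f x) = (LINT x|distr lborel borel ((+) c). f x)"
    by (simp add: lborel_distr_plus)
  also have "\<dots> = (LINT x|lborel. f (c + x))"
    using assms by (subst integral_distr) auto
  finally show ?thesis by (simp add: add.commute)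
qed

lemma integrable_lborel_translate:
  fixes c :: "'a::euclidean_space" and f :: "'a \<Rightarrow> real"
  assumes "integrable lborel f"
  shows "integrable lborel (\<lambda>x. f (x + c))"
proof -
  have "integrable (distr lborel borel ((+) c)) f"
    using assms by (simp add: lborel_distr_plus)
  then have "integrable lborel (\<lambda>x. f (c + x))"
    using assms by (subst (asm) integrable_distr_eq) auto
  then show ?thesis by (simp add: add.commute)
qed

lemma smooth_has_real_derivative_line:
  assumes "smooth f"
  shows "((\<lambda>s. f (x + s *\<^sub>R h)) has_real_derivative frechet_derivative f (at (x + s *\<^sub>R h)) h) (at s)"
proof -
  have lin: "linear (frechet_derivative f (at y))" for y
    using smooth_has_derivative[OF assms] has_derivative_linear by blast
  have "((\<lambda>s. x + s *\<^sub>R h) has_derivative (\<lambda>t. t *\<^sub>R h)) (at s)"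
    by (auto intro!: derivative_eq_intros)
  from has_derivative_compose[OF this smooth_has_derivative[OF assms]]
  show ?thesis
    by (simp add: has_field_derivative_def linear_scale[OF lin] mult.commute[of _ "frechet_derivative f (at (x + s *\<^sub>R h)) h"])
qed

text \<open>Every difference quotient in direction \<open>b\<close> has integral zero by translation
  invariance; dominated convergence carries this over to the derivative.\<close>

lemma integral_partial_test_function:
  fixes \<phi> :: "'a::euclidean_space \<Rightarrow> real"
  assumes t: "test_function \<Omega> \<phi>" and b: "b \<in> Basis"
  shows "(LINT x|lborel. frechet_derivative \<phi> (at x) b) = 0"
proof -
  let ?D = "\<lambda>x. frechet_derivative \<phi> (at x) b"
  note sm = test_function_smooth[OF t]
  note td = test_function_partial[OF t b]
  have [measurable]: "\<phi> \<in> borel_measurable borel" "?D \<in> borel_measurable borel"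
    using sm smooth_borel_measurable smooth_partial[OF sm b] by auto
  obtain C where C: "\<And>x. \<bar>?D x\<bar> \<le> C" using test_function_bounded[OF td] by blast
  have "bounded {x. \<phi> x \<noteq> 0}"
    using t compact_imp_bounded[of "closure {x. \<phi> x \<noteq> 0}"] bounded_subset[OF _ closure_subset]
    unfolding test_function_def by blast
  then obtain R where R: "\<And>x. \<phi> x \<noteq> 0 \<Longrightarrow> norm x \<le> R" unfolding bounded_iff by blast
  define h where "h n = inverse (real (Suc n))" for n
  have h: "0 < h n" "h n \<le> 1" for n by (auto simp: h_def inverse_le_1_iff)
  define g where "g n x = (\<phi> (x + h n *\<^sub>R b) - \<phi> x) / h n" for n x
  \<comment> \<open>The steps \<open>h n\<close> are at most 1 and the support lies in the ball of
    radius \<open>R\<close>, so all quotients vanish outside radius \<open>R + 1\<close>; inside,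
    the mean value theorem bounds them by \<open>C\<close>.\<close>
  have "(\<lambda>n. LINT x|lborel. g n x) \<longlonglongrightarrow> (LINT x|lborel. ?D x)"
  proof (rule integral_dominated_convergence[where w = "\<lambda>x. C * indicator (cball 0 (R + 1)) x"])
    show "?D \<in> borel_measurable lborel" by simp
    show "g n \<in> borel_measurable lborel" for n unfolding g_def by measurable
    show "integrable lborel (\<lambda>x. C * indicator (cball 0 (R + 1)) x)"
      by (intro integrable_mult_right integrable_real_indicator) (auto intro: emeasure_bounded_finite[simplified])
    show "AE x in lborel. (\<lambda>n. g n x) \<longlonglongrightarrow> ?D x"
    proof (rule AE_I2)
      fix x
      have "((\<lambda>s. (\<phi> (x + s *\<^sub>R b) - \<phi> x) / s) \<longlongrightarrow> ?D x) (at 0)"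
        using smooth_has_real_derivative_line[OF sm, of x b 0] by (simp add: DERIV_def)
      moreover have "filterlim h (at 0) sequentially"
        unfolding h_def filterlim_at
        using LIMSEQ_inverse_real_of_nat by (auto intro!: always_eventually)
      ultimately show "(\<lambda>n. g n x) \<longlonglongrightarrow> ?D x" unfolding g_def by (rule filterlim_compose)
    qed
    show "AE x in lborel. norm (g n x) \<le> C * indicator (cball 0 (R + 1)) x" for n
    proof (rule AE_I2)
      fix x
      obtain z where z: "\<phi> (x + h n *\<^sub>R b) - \<phi> x = h n * frechet_derivative \<phi> (at (x + z *\<^sub>R b)) b"
        using MVT2[OF h(1)[of n], of "\<lambda>s. \<phi> (x + s *\<^sub>R b)"]
          smooth_has_real_derivative_line[OF sm, of x b] by force
      then have 1: "norm (g n x) \<le> C" using C h(1)[of n] by (simp add: g_def)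
      have "g n x = 0" if "R + 1 < norm x"
      proof -
        have "norm x \<le> norm (x + h n *\<^sub>R b) + norm (h n *\<^sub>R b)"
          using norm_triangle_ineq4[of "x + h n *\<^sub>R b" "h n *\<^sub>R b"] by simp
        also have "norm (h n *\<^sub>R b) \<le> 1" using h[of n] b by simp
        finally have "R < norm (x + h n *\<^sub>R b)" using that by simp
        then have "\<phi> (x + h n *\<^sub>R b) = 0" "\<phi> x = 0" using R[of x] R[of "x + h n *\<^sub>R b"] that by force+
        then show ?thesis by (simp add: g_def)
      qed
      then show "norm (g n x) \<le> C * indicator (cball 0 (R + 1)) x"
        using 1 by (cases "R + 1 < norm x") auto
    qed
  qed
  moreover have "(LINT x|lborel. g n x) = 0" for n
    unfolding g_def using integrable_lborel_translate[OF test_function_integrable[OF t]]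
      test_function_integrable[OF t] by (simp add: integral_lborel_translate)
  ultimately show ?thesis by (simp add: LIMSEQ_const_iff)
qed

definition grad :: "('a::euclidean_space \<Rightarrow> real) \<Rightarrow> 'a \<Rightarrow> 'a" where
  "grad f x = (\<Sum>b\<in>Basis. frechet_derivative f (at x) b *\<^sub>R b)"

lemma frechet_derivative_grad:
  assumes "smooth f" shows "frechet_derivative f (at x) h = grad f x \<bullet> h"
proof -
  have lin: "linear (frechet_derivative f (at x))"
    using smooth_has_derivative[OF assms] has_derivative_linear by blast
  have "frechet_derivative f (at x) h = frechet_derivative f (at x) (\<Sum>b\<in>Basis. (h \<bullet> b) *\<^sub>R b)"
    by (simp add: euclidean_representation)
  also have "\<dots> = (\<Sum>b\<in>Basis. (h \<bullet> b) * frechet_derivative f (at x) b)"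
    by (simp add: linear_sum[OF lin] linear_scale[OF lin])
  also have "\<dots> = grad f x \<bullet> h"
    unfolding grad_def inner_sum_left by (simp add: inner_commute mult.commute)
  finally show ?thesis .
qed

lemma continuous_on_grad: "smooth f \<Longrightarrow> continuous_on UNIV (grad f)"
proof -
  assume a: "smooth f"
  have "continuous_on UNIV (\<lambda>x. frechet_derivative f (at x) b)" if "b \<in> Basis" for b
    using smooth_continuous_on[OF smooth_partial[OF a that]] .
  then show ?thesis unfolding grad_def
    by (intro continuous_on_sum continuous_on_scaleR continuous_on_const)
qed

lemma borel_measurable_grad: "smooth f \<Longrightarrow> grad f \<in> borel_measurable borel"
  by (rule borel_measurable_continuous_onI[OF continuous_on_grad])

lemma grad_zero_outside: "test_function \<Omega> \<phi> \<Longrightarrow> x \<notin> \<Omega> \<Longrightarrow> grad \<phi> x = 0"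
proof -
  assume a: "test_function \<Omega> \<phi>" "x \<notin> \<Omega>"
  have "frechet_derivative \<phi> (at x) b = 0" if "b \<in> Basis" for b
    using test_function_zero_outside[OF test_function_partial[OF a(1) that] a(2)] .
  then show "grad \<phi> x = 0" by (simp add: grad_def)
qed

text \<open>The product of \<open>f\<close> and \<open>\<phi>\<close> is again a test function, so
  its partial derivatives have integral zero. The support of \<open>f\<close> may be
  arbitrary.\<close>

lemma integration_by_parts:
  fixes f \<phi> :: "'a::euclidean_space \<Rightarrow> real"
  assumes f: "smooth f" and t: "test_function \<Omega> \<phi>" and b: "b \<in> Basis"
  shows "(LINT x|lborel. f x * frechet_derivative \<phi> (at x) b) =
    - (LINT x|lborel. frechet_derivative f (at x) b * \<phi> x)"
proof -
  have "frechet_derivative (\<lambda>x. f x * \<phi> x) (at x) =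
      (\<lambda>h. f x * frechet_derivative \<phi> (at x) h + frechet_derivative f (at x) h * \<phi> x)" for x
    by (rule frechet_derivativeI,
        rule has_derivative_mult[OF smooth_has_derivative[OF f] smooth_has_derivative[OF test_function_smooth[OF t]]])
  then have "(LINT x|lborel. f x * frechet_derivative \<phi> (at x) b + frechet_derivative f (at x) b * \<phi> x) = 0"
    using integral_partial_test_function[OF test_function_smooth_mult[OF f t] b] by simp
  moreover have "integrable lborel (\<lambda>x. f x * frechet_derivative \<phi> (at x) b)"
    "integrable lborel (\<lambda>x. frechet_derivative f (at x) b * \<phi> x)"
    by (rule test_function_integrable[OF test_function_smooth_mult[OF f test_function_partial[OF t b]]])
      (rule test_function_integrable[OF test_function_smooth_mult[OF smooth_partial[OF f b] t]])
  ultimately show ?thesis by simp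
qed

lemma set_integrable_lborel:
  fixes f :: "'a::euclidean_space \<Rightarrow> 'b::{banach, second_countable_topology}"
  shows "integrable lborel f \<Longrightarrow> S \<in> sets borel \<Longrightarrow> set_integrable lborel S f"
  unfolding set_integrable_def by (rule integrable_mult_indicator) auto

lemma grad_integrable:
  assumes "test_function \<Omega> \<phi>" shows "integrable lborel (grad \<phi>)"
  unfolding grad_def
  by (intro Bochner_Integration.integrable_sum integrable_scaleR_left
      test_function_integrable[OF test_function_partial[OF assms]])

lemma weak_gradient_test_function:
  assumes t: "test_function \<Omega> \<phi>"
  shows "weak_gradient \<Omega> \<phi> (grad \<phi>)"
proof -
  note sm = test_function_smooth[OF t]
  have "(LINT x:\<Omega>|lborel. \<phi> x * frechet_derivative \<psi> (at x) b) =
        - (LINT x:\<Omega>|lborel. (grad \<phi> x \<bullet> b) * \<psi> x)"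
    if p: "test_function \<Omega> \<psi>" and b: "b \<in> Basis" for \<psi> b
  proof -
    have z: "\<psi> x = 0" "frechet_derivative \<psi> (at x) b = 0" if "x \<notin> \<Omega>" for x
      using that test_function_zero_outside[OF p] test_function_zero_outside[OF test_function_partial[OF p b]] by auto
    have "(LINT x:\<Omega>|lborel. \<phi> x * frechet_derivative \<psi> (at x) b) = (LINT x|lborel. \<phi> x * frechet_derivative \<psi> (at x) b)"
      unfolding set_lebesgue_integral_def by (rule Bochner_Integration.integral_cong) (auto simp: indicator_def z)
    also have "\<dots> = - (LINT x|lborel. (grad \<phi> x \<bullet> b) * \<psi> x)"
      using integration_by_parts[OF sm p b] by (simp add: frechet_derivative_grad[OF sm])
    also have "(LINT x|lborel. (grad \<phi> x \<bullet> b) * \<psi> x) = (LINT x:\<Omega>|lborel. (grad \<phi> x \<bullet> b) * \<psi> x)"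
      unfolding set_lebesgue_integral_def by (rule Bochner_Integration.integral_cong) (auto simp: indicator_def z)
    finally show ?thesis .
  qed
  then show ?thesis
    using test_function_integrable[OF t] grad_integrable[OF t] sm
    unfolding weak_gradient_def locally_integrable_def
    by (auto intro!: set_integrable_lborel borel_measurable_grad smooth_borel_measurable borel_compact)
qed

subsection \<open>Uniqueness of weak gradients\<close>

text \<open>A smooth approximation of the indicator of an open box: \<open>flat_exp (n * t)\<close>
  tends to 1 for \<open>t > 0\<close> and is 0 otherwise. Differences are written as sums with
  negated terms so that the closure rules for sums and products apply literally.\<close>

definition box_bump :: "'a::euclidean_space \<Rightarrow> 'a \<Rightarrow> nat \<Rightarrow> 'a \<Rightarrow> real" where
  "box_bump a b n x = (\<Prod>i\<in>Basis. flat_exp (real (Suc n) * (x \<bullet> i + - (a \<bullet> i))) *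
     flat_exp (real (Suc n) * (b \<bullet> i + (- 1) * (x \<bullet> i))))"

lemma flat_exp_bounds: "0 \<le> flat_exp t" "flat_exp t \<le> 1"
  by (auto simp: flat_exp_def)

lemma flat_exp_limit: "(\<lambda>n. flat_exp (real (Suc n) * t)) \<longlonglongrightarrow> (if t > 0 then 1 else 0)"
proof (cases "t > 0")
  case True
  have "(\<lambda>n. exp (- (inverse t * inverse (real (Suc n))))) \<longlonglongrightarrow> exp (- (inverse t * 0))"
    by (intro tendsto_intros LIMSEQ_inverse_real_of_nat)
  moreover have "flat_exp (real (Suc n) * t) = exp (- (inverse t * inverse (real (Suc n))))" for n
    using True by (simp add: flat_exp_def zero_less_mult_iff field_simps del: of_nat_Suc)
  ultimately show ?thesis using True by simp
next
  case False
  then have "\<not> 0 < real (Suc n) * t" for n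
    using mult_nonneg_nonpos[of "real (Suc n)" t] by (simp del: of_nat_Suc add: not_less)
  then show ?thesis using False by (simp add: flat_exp_def del: of_nat_Suc)
qed

lemma box_bump_bounds: "0 \<le> box_bump a b n x" "box_bump a b n x \<le> 1"
  unfolding box_bump_def
  by (auto intro!: prod_nonneg prod_le_1 mult_le_one simp: flat_exp_bounds simp del: of_nat_Suc)

lemma box_bump_limit: "(\<lambda>n. box_bump a b n x) \<longlonglongrightarrow> indicator (box a b) x"
proof -
  have "(\<lambda>n. box_bump a b n x) \<longlonglongrightarrow> (\<Prod>i\<in>Basis. (if x \<bullet> i + - (a \<bullet> i) > 0 then 1 else 0) *
     (if b \<bullet> i + (- 1) * (x \<bullet> i) > 0 then 1 else 0))"
    unfolding box_bump_def by (intro tendsto_prod tendsto_mult flat_exp_limit)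
  also have "(\<Prod>i\<in>Basis. (if x \<bullet> i + - (a \<bullet> i) > 0 then 1 else 0) *
     (if b \<bullet> i + (- 1) * (x \<bullet> i) > 0 then 1 else 0)) = (indicator (box a b) x :: real)"
  proof (cases "x \<in> box a b")
    case True
    then show ?thesis by (auto simp: mem_box intro!: prod.neutral)
  next
    case False
    then obtain i where "i \<in> Basis" "\<not> (a \<bullet> i < x \<bullet> i \<and> x \<bullet> i < b \<bullet> i)" by (auto simp: mem_box)
    then show ?thesis using False by (subst prod_zero[OF finite_Basis]) (auto intro!: bexI[of _ i])
  qed
  finally show ?thesis .
qed

lemma box_bump_zero: "x \<notin> box a b \<Longrightarrow> box_bump a b n x = 0"
proof -
  assume "x \<notin> box a b"
  then obtain i where i: "i \<in> Basis" "x \<bullet> i - a \<bullet> i \<le> 0 \<or> b \<bullet> i - x \<bullet> i \<le> 0"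
    by (force simp: mem_box)
  have "flat_exp (real (Suc n) * t) = 0" if "t \<le> 0" for t
    using that mult_nonneg_nonpos[of "real (Suc n)" t] by (simp add: flat_exp_def del: of_nat_Suc)
  then show ?thesis unfolding box_bump_def
    using i by (intro prod_zero[OF finite_Basis]) (auto simp del: of_nat_Suc intro!: bexI[of _ i])
qed

lemma test_function_box_bump:
  assumes "cbox a b \<subseteq> \<Omega>" shows "test_function \<Omega> (box_bump a b n)"
proof -
  have "smooth (\<lambda>x. flat_exp (real (Suc n) * (x \<bullet> i + - (a \<bullet> i))) *
     flat_exp (real (Suc n) * (b \<bullet> i + (- 1) * (x \<bullet> i))))" for i
    by (rule smooth_mult; rule smooth_compose[OF smooth_flat_exp]; rule smooth_mult[OF smooth_const])
      (rule smooth_add[OF smooth_inner_right smooth_const],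
       rule smooth_add[OF smooth_const smooth_mult[OF smooth_const smooth_inner_right]])
  then have "smooth (box_bump a b n)"
    unfolding box_bump_def[abs_def] by (intro smooth_prod) auto
  moreover have "closure {x. box_bump a b n x \<noteq> 0} \<subseteq> cbox a b"
    by (rule closure_minimal) (use box_bump_zero[of _ a b n] box_subset_cbox[of a b] in auto)
  ultimately show ?thesis using assms unfolding test_function_def
    using closed_subset_compact[OF closed_closure _ compact_cbox, of _ a b] by blast
qed

text \<open>The positive and negative parts of \<open>g\<close> are densities of two measures that
  agree on open boxes, an intersection-stable generator of the Borel sets; hence the measures, and
  then the densities, coincide.\<close>

lemma integrable_AE_zero_of_box_integrals:
  fixes g :: "'a::euclidean_space \<Rightarrow> real"
  assumes g: "integrable lborel g"
    and z: "\<And>a b. (LINT x|lborel. g x * indicator (box a b) x) = 0"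
  shows "AE x in lborel. g x = 0"
proof -
  have [measurable]: "g \<in> borel_measurable borel" using g by auto
  define P where "P x = ennreal (max 0 (g x))" for x
  define Q where "Q x = ennreal (max 0 (- g x))" for x
  have [measurable]: "P \<in> borel_measurable lborel" "Q \<in> borel_measurable lborel"
    unfolding P_def Q_def by measurable
  have int: "integrable lborel (\<lambda>x. max 0 (g x) * indicator A x)"
    "integrable lborel (\<lambda>x. max 0 (- g x) * indicator A x)" if [measurable]: "A \<in> sets borel" for A
    by (rule Bochner_Integration.integrable_bound[OF g]; auto simp: indicator_def abs_ge_self abs_ge_minus_self)+
  have PA: "emeasure (density lborel P) A = ennreal (LINT x|lborel. max 0 (g x) * indicator A x)"
    and QA: "emeasure (density lborel Q) A = ennreal (LINT x|lborel. max 0 (- g x) * indicator A x)"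
    if [measurable]: "A \<in> sets borel" for A
    by (auto simp: emeasure_density P_def Q_def ennreal_mult' ennreal_indicator
        nn_integral_eq_integral[OF int(1)[OF that], symmetric] nn_integral_eq_integral[OF int(2)[OF that], symmetric]
        intro!: nn_integral_cong split: split_indicator)
  let ?E = "range (\<lambda>(a, b). box a b :: 'a set)"
  have "density lborel P = density lborel Q"
  proof (rule measure_eqI_generator_eq)
    show "Int_stable ?E"
      by (auto simp: Int_stable_def box_Int_box)
    show "?E \<subseteq> Pow UNIV" "sets (density lborel P) = sigma_sets UNIV ?E"
      "sets (density lborel Q) = sigma_sets UNIV ?E"
      by (simp_all add: borel_eq_box)
    let ?A = "\<lambda>n::nat. box (- (real n *\<^sub>R One)) (real n *\<^sub>R One) :: 'a set"
    show "range ?A \<subseteq> ?E" "(\<Union>i. ?A i) = UNIV"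
      unfolding UN_box_eq_UNIV by auto
    show "emeasure (density lborel P) (?A i) \<noteq> \<infinity>" for i
      by (simp add: PA)
    fix X assume "X \<in> ?E"
    then obtain a b where X: "X = box a b" by auto
    have "(LINT x|lborel. g x * indicator X x) =
      (LINT x|lborel. max 0 (g x) * indicator X x - max 0 (- g x) * indicator X x)"
      by (rule Bochner_Integration.integral_cong) (auto simp: indicator_def)
    also have "\<dots> = (LINT x|lborel. max 0 (g x) * indicator X x) - (LINT x|lborel. max 0 (- g x) * indicator X x)"
      by (rule Bochner_Integration.integral_diff) (auto simp: X int)
    finally show "emeasure (density lborel P) X = emeasure (density lborel Q) X"
      using z[of a b] by (simp add: X PA QA)
  qed
  then have "AE x in lborel. P x = Q x"
    by (intro sigma_finite_measure.density_unique[OF sigma_finite_lborel]) auto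
  then show ?thesis
    by eventually_elim (auto simp: P_def Q_def max_def split: if_splits)
qed

text \<open>An uncountable union of null sets is avoided by Lindelof: countably many boxes with
  closed hull in \<Omega> already cover it.\<close>

lemma AE_lborel_open_coverI:
  fixes \<Omega> :: "'a::euclidean_space set"
  assumes "open \<Omega>" and "\<And>a b. cbox a b \<subseteq> \<Omega> \<Longrightarrow> AE x in lborel. x \<in> box a b \<longrightarrow> P x"
  shows "AE x in lborel. x \<in> \<Omega> \<longrightarrow> P x"
proof -
  let ?F = "{box a b |a b. cbox a b \<subseteq> \<Omega>}"
  obtain F' where F': "F' \<subseteq> ?F" "countable F'" "\<Union>F' = \<Union>?F"
    using Lindelof[of ?F] open_box by blast
  have "AE x in lborel. \<forall>B\<in>F'. x \<in> B \<longrightarrow> P x"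
    using F'(1) assms(2) by (subst AE_ball_countable[OF F'(2)]) blast
  moreover have "x \<in> \<Union>F'" if x: "x \<in> \<Omega>" for x
  proof -
    obtain a b where ab: "cbox a b \<subseteq> \<Omega>" "x \<in> box a b"
      using open_contains_cbox[OF assms(1) x] by metis
    then have "box a b \<in> ?F" by auto
    then show ?thesis using F'(3) ab(2) by (simp only:) (rule UnionI)
  qed
  ultimately show ?thesis by (auto elim!: eventually_mono)
qed

text \<open>Bumps approximate indicators of boxes, so every box integral of \<open>f\<close>
  vanishes. Since \<open>f\<close> is integrable only on compact subsets, the argument runs inside
  one closed box at a time.\<close>

lemma fundamental_lemma_real:
  fixes f :: "'a::euclidean_space \<Rightarrow> real"
  assumes op: "open \<Omega>" and [measurable]: "f \<in> borel_measurable borel"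
    and loc: "locally_integrable \<Omega> f"
    and z: "\<And>\<phi>. test_function \<Omega> \<phi> \<Longrightarrow> (LINT x:\<Omega>|lborel. f x * \<phi> x) = 0"
  shows "AE x in lborel. x \<in> \<Omega> \<longrightarrow> f x = 0"
proof (rule AE_lborel_open_coverI[OF op])
  have int: "integrable lborel (\<lambda>x. f x * indicator (cbox a b) x)" if "cbox a b \<subseteq> \<Omega>" for a b
    using loc that unfolding locally_integrable_def set_integrable_def
    by (simp add: mult.commute)
  have box0: "(LINT x|lborel. f x * indicator (box a b) x) = 0" if sub: "cbox a b \<subseteq> \<Omega>" for a b
  proof -
    have [measurable]: "box_bump a b n \<in> borel_measurable borel" for n
      using test_function_box_bump[OF sub] test_function_smooth smooth_borel_measurable by blast
    have eq: "(LINT x|lborel. f x * box_bump a b n x) = 0" for n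
    proof -
      have "(LINT x|lborel. f x * box_bump a b n x) = (LINT x:\<Omega>|lborel. f x * box_bump a b n x)"
        unfolding set_lebesgue_integral_def
        by (rule Bochner_Integration.integral_cong)
          (use box_bump_zero[of _ a b n] box_subset_cbox[of a b] sub in \<open>auto simp: indicator_def\<close>)
      then show ?thesis using z[OF test_function_box_bump[OF sub]] by simp
    qed
    have "(\<lambda>n. LINT x|lborel. f x * box_bump a b n x) \<longlonglongrightarrow> (LINT x|lborel. f x * indicator (box a b) x)"
    proof (rule integral_dominated_convergence[where w = "\<lambda>x. \<bar>f x * indicator (cbox a b) x\<bar>"])
      show "integrable lborel (\<lambda>x. \<bar>f x * indicator (cbox a b) x\<bar>)"
        using int[OF sub] by (rule integrable_abs)
      show "AE x in lborel. (\<lambda>n. f x * box_bump a b n x) \<longlonglongrightarrow> f x * indicator (box a b) x"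
        by (intro AE_I2 tendsto_intros box_bump_limit)
      show "AE x in lborel. norm (f x * box_bump a b n x) \<le> \<bar>f x * indicator (cbox a b) x\<bar>" for n
      proof (rule AE_I2)
        fix x
        show "norm (f x * box_bump a b n x) \<le> \<bar>f x * indicator (cbox a b) x\<bar>"
          using box_bump_bounds[of a b n x] box_bump_zero[of x a b n] box_subset_cbox[of a b]
          by (cases "x \<in> box a b") (auto simp: abs_mult mult_left_le)
      qed
    qed auto
    then show ?thesis by (simp add: eq LIMSEQ_const_iff)
  qed
  fix a b assume sub: "cbox a b \<subseteq> \<Omega>"
  have "AE x in lborel. f x * indicator (box a b) x = 0"
  proof (rule integrable_AE_zero_of_box_integrals)
    show "integrable lborel (\<lambda>x. f x * indicator (box a b) x)"
      by (rule Bochner_Integration.integrable_bound[OF int[OF sub]])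
        (use box_subset_cbox[of a b] in \<open>auto simp: indicator_def\<close>)
    fix c d
    \<comment> \<open>Boxes are stable under intersection, so testing the truncated function on an
      arbitrary box means testing \<open>f\<close> on a box compactly inside \<Omega>, unless the
      intersection is empty.\<close>
    obtain l u where lu: "box a b \<inter> box c d = box l u" by (rule that[OF box_Int_box])
    have "(LINT x|lborel. f x * indicator (box a b) x * indicator (box c d) x) = (LINT x|lborel. f x * indicator (box l u) x)"
      by (simp add: lu[symmetric] indicator_inter_arith mult.assoc)
    also have "\<dots> = 0"
    proof (cases "box l u = {}")
      case False
      then have "cbox l u \<subseteq> \<Omega>"
        using closure_mono[of "box l u" "cbox a b"] lu box_subset_cbox[of a b] sub closure_box[OF False] by auto
      then show ?thesis by (rule box0)
    qed auto
    finally show "(LINT x|lborel. f x * indicator (box a b) x * indicator (box c d) x) = 0" .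
  qed
  then show "AE x in lborel. x \<in> box a b \<longrightarrow> f x = 0"
    by eventually_elim auto
qed

lemma locally_integrable_times_test_function:
  fixes f :: "'a::euclidean_space \<Rightarrow> real"
  assumes [measurable]: "f \<in> borel_measurable borel" and loc: "locally_integrable \<Omega> f"
    and t: "test_function \<Omega> \<phi>"
  shows "set_integrable lborel \<Omega> (\<lambda>x. f x * \<phi> x)" "integrable lborel (\<lambda>x. f x * \<phi> x)"
proof -
  let ?K = "closure {x. \<phi> x \<noteq> 0}"
  have K: "compact ?K" "?K \<subseteq> \<Omega>" using t unfolding test_function_def by auto
  have [measurable]: "\<phi> \<in> borel_measurable borel"
    using test_function_smooth[OF t] smooth_borel_measurable by blast
  have z: "\<phi> x = 0" if "x \<notin> ?K" for x using that closure_subset[of "{x. \<phi> x \<noteq> 0}"] by auto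
  obtain C where C: "\<And>x. \<bar>\<phi> x\<bar> \<le> C" using test_function_bounded[OF t] by blast
  have int: "integrable lborel (\<lambda>x. C * (indicator ?K x *\<^sub>R f x))"
    using loc K unfolding locally_integrable_def set_integrable_def by (intro integrable_mult_right) auto
  show 1: "integrable lborel (\<lambda>x. f x * \<phi> x)"
  proof (rule Bochner_Integration.integrable_bound[OF int])
    show "AE x in lborel. norm (f x * \<phi> x) \<le> norm (C * (indicator ?K x *\<^sub>R f x))"
    proof (rule AE_I2)
      fix x
      have "\<bar>\<phi> x\<bar> \<le> \<bar>C\<bar>" using C[of x] by auto
      then have "\<bar>\<phi> x\<bar> * \<bar>f x\<bar> \<le> \<bar>C\<bar> * \<bar>f x\<bar>" by (rule mult_right_mono) simp
      moreover have "norm (C * (indicator ?K x *\<^sub>R f x)) = (if x \<in> ?K then \<bar>C\<bar> * \<bar>f x\<bar> else 0)"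
        by (simp add: abs_mult)
      moreover have "norm (f x * \<phi> x) = (if x \<in> ?K then \<bar>\<phi> x\<bar> * \<bar>f x\<bar> else 0)"
        using z[of x] by (simp only: real_norm_def abs_mult mult.commute split: if_split) simp
      ultimately show "norm (f x * \<phi> x) \<le> norm (C * (indicator ?K x *\<^sub>R f x))"
        by (cases "x \<in> ?K") (simp_all only: if_True if_False order_refl)
    qed
  qed auto
  have "(\<lambda>x. indicator \<Omega> x *\<^sub>R (f x * \<phi> x)) = (\<lambda>x. f x * \<phi> x)"
  proof
    fix x
    have "\<phi> x = 0" if "x \<notin> \<Omega>" using test_function_zero_outside[OF t that] .
    then show "indicator \<Omega> x *\<^sub>R (f x * \<phi> x) = f x * \<phi> x" by (cases "x \<in> \<Omega>") simp_all
  qed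
  then show "set_integrable lborel \<Omega> (\<lambda>x. f x * \<phi> x)"
    using 1 by (simp add: set_integrable_def)
qed

lemma locally_integrable_inner:
  "locally_integrable \<Omega> g \<Longrightarrow> locally_integrable \<Omega> (\<lambda>x. g x \<bullet> b)"
  unfolding locally_integrable_def set_integrable_def
proof (intro allI impI)
  fix K assume *: "\<forall>K. compact K \<and> K \<subseteq> \<Omega> \<longrightarrow> integrable lborel (\<lambda>x. indicat_real K x *\<^sub>R g x)"
    and "compact K \<and> K \<subseteq> \<Omega>"
  then have "integrable lborel (\<lambda>x. (indicat_real K x *\<^sub>R g x) \<bullet> b)"
    by (intro integrable_inner_left) auto
  then show "integrable lborel (\<lambda>x. indicat_real K x *\<^sub>R (g x \<bullet> b))" by simp
qed

lemma locally_integrable_lincomb: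
  "locally_integrable \<Omega> f \<Longrightarrow> locally_integrable \<Omega> g \<Longrightarrow> locally_integrable \<Omega> (\<lambda>x. c *\<^sub>R f x + d *\<^sub>R g x)"
  unfolding locally_integrable_def by (auto intro!: set_integral_add)

lemma weak_gradient_lincomb:
  assumes f: "weak_gradient \<Omega> f g" and h: "weak_gradient \<Omega> h k"
  shows "weak_gradient \<Omega> (\<lambda>x. c * f x + d * h x) (\<lambda>x. c *\<^sub>R g x + d *\<^sub>R k x)"
proof -
  have m[measurable]: "f \<in> borel_measurable borel" "g \<in> borel_measurable borel"
      "h \<in> borel_measurable borel" "k \<in> borel_measurable borel"
    and l: "locally_integrable \<Omega> f" "locally_integrable \<Omega> g" "locally_integrable \<Omega> h" "locally_integrable \<Omega> k"
    using f h unfolding weak_gradient_def by auto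
  have "(LINT x:\<Omega>|lborel. (c * f x + d * h x) * frechet_derivative \<phi> (at x) b) =
        - (LINT x:\<Omega>|lborel. ((c *\<^sub>R g x + d *\<^sub>R k x) \<bullet> b) * \<phi> x)"
    if t: "test_function \<Omega> \<phi>" and b: "b \<in> Basis" for \<phi> b
  proof -
    let ?D = "\<lambda>x. frechet_derivative \<phi> (at x) b"
    note i = locally_integrable_times_test_function(1)
    have i1: "set_integrable lborel \<Omega> (\<lambda>x. f x * ?D x)" "set_integrable lborel \<Omega> (\<lambda>x. h x * ?D x)"
      by (rule i[OF m(1) l(1) test_function_partial[OF t b]], rule i[OF m(3) l(3) test_function_partial[OF t b]])
    have i2: "set_integrable lborel \<Omega> (\<lambda>x. (g x \<bullet> b) * \<phi> x)" "set_integrable lborel \<Omega> (\<lambda>x. (k x \<bullet> b) * \<phi> x)"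
      by (rule i[OF _ locally_integrable_inner[OF l(2)] t], measurable)
        (rule i[OF _ locally_integrable_inner[OF l(4)] t], measurable)
    have "(LINT x:\<Omega>|lborel. (c * f x + d * h x) * ?D x) =
        (LINT x:\<Omega>|lborel. c * (f x * ?D x) + d * (h x * ?D x))"
      by (simp add: algebra_simps)
    also have "\<dots> = c * (LINT x:\<Omega>|lborel. f x * ?D x) + d * (LINT x:\<Omega>|lborel. h x * ?D x)"
      using i1 by (subst set_integral_add(2)) auto
    also have "\<dots> = c * (- (LINT x:\<Omega>|lborel. (g x \<bullet> b) * \<phi> x)) + d * (- (LINT x:\<Omega>|lborel. (k x \<bullet> b) * \<phi> x))"
      using f h t b unfolding weak_gradient_def by simp
    also have "\<dots> = - (c * (LINT x:\<Omega>|lborel. (g x \<bullet> b) * \<phi> x) + d * (LINT x:\<Omega>|lborel. (k x \<bullet> b) * \<phi> x))"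
      by simp
    also have "c * (LINT x:\<Omega>|lborel. (g x \<bullet> b) * \<phi> x) + d * (LINT x:\<Omega>|lborel. (k x \<bullet> b) * \<phi> x) =
        (LINT x:\<Omega>|lborel. c * ((g x \<bullet> b) * \<phi> x) + d * ((k x \<bullet> b) * \<phi> x))"
      using i2 by (subst set_integral_add(2)) auto
    also have "\<dots> = (LINT x:\<Omega>|lborel. ((c *\<^sub>R g x + d *\<^sub>R k x) \<bullet> b) * \<phi> x)"
      by (simp add: algebra_simps)
    finally show ?thesis .
  qed
  then show ?thesis
    using locally_integrable_lincomb[OF l(1) l(3), of c d] locally_integrable_lincomb[OF l(2) l(4), of c d]
    unfolding weak_gradient_def by auto
qed

text \<open>Agreement almost everywhere is the right hypothesis because the proportionality found at
  the end, to which this is applied in \<open>energy1_scale\<close>, holds only almost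
  everywhere.\<close>

lemma weak_gradient_unique:
  assumes op: "open \<Omega>" and f: "weak_gradient \<Omega> f g" and h: "weak_gradient \<Omega> h k"
    and eq: "AE x in lborel. x \<in> \<Omega> \<longrightarrow> f x = h x"
  shows "AE x in lborel. x \<in> \<Omega> \<longrightarrow> g x = k x"
proof -
  have [measurable]: "\<Omega> \<in> sets borel" using op by auto
  note w = weak_gradient_lincomb[OF f h, of 1 "-1"]
  then have m[measurable]: "(\<lambda>x. 1 *\<^sub>R g x + (-1) *\<^sub>R k x) \<in> borel_measurable borel"
    and l: "locally_integrable \<Omega> (\<lambda>x. 1 *\<^sub>R g x + (-1) *\<^sub>R k x)"
    unfolding weak_gradient_def by auto
  have "AE x in lborel. x \<in> \<Omega> \<longrightarrow> (1 *\<^sub>R g x + (-1) *\<^sub>R k x) \<bullet> b = 0" if b: "b \<in> Basis" for b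
  proof (rule fundamental_lemma_real[OF op _ locally_integrable_inner[OF l]])
    fix \<phi> assume t: "test_function \<Omega> \<phi>"
    have "(LINT x:\<Omega>|lborel. (1 * f x + (-1) * h x) * frechet_derivative \<phi> (at x) b) =
      - (LINT x:\<Omega>|lborel. ((1 *\<^sub>R g x + (-1) *\<^sub>R k x) \<bullet> b) * \<phi> x)"
      using w t b unfolding weak_gradient_def by blast
    moreover have "(LINT x:\<Omega>|lborel. (1 * f x + (-1) * h x) * frechet_derivative \<phi> (at x) b) = 0"
      unfolding set_lebesgue_integral_def
      by (rule integral_eq_zero_AE) (use eq in eventually_elim, auto simp: indicator_def)
    ultimately show "(LINT x:\<Omega>|lborel. ((1 *\<^sub>R g x + (-1) *\<^sub>R k x) \<bullet> b) * \<phi> x) = 0" by simp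
  qed measurable
  then have "AE x in lborel. \<forall>b\<in>Basis. x \<in> \<Omega> \<longrightarrow> (1 *\<^sub>R g x + (-1) *\<^sub>R k x) \<bullet> b = 0"
    by (subst AE_ball_countable) (auto simp: countable_finite)
  then show ?thesis
  proof (rule AE_mp[OF _ AE_I2], intro impI)
    fix x assume *: "\<forall>b\<in>Basis. x \<in> \<Omega> \<longrightarrow> (1 *\<^sub>R g x + (-1) *\<^sub>R k x) \<bullet> b = 0" and x: "x \<in> \<Omega>"
    show "g x = k x"
    proof (rule euclidean_eqI)
      fix b :: 'a assume "b \<in> Basis"
      then have "(1 *\<^sub>R g x + (-1) *\<^sub>R k x) \<bullet> b = 0" using * x by blast
      then show "g x \<bullet> b = k x \<bullet> b" by (simp add: inner_diff_left)
    qed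
  qed
qed

section \<open>The chosen weak gradient of a Sobolev function\<close>

lemma W1p_borel_measurable: "u \<in> W1p \<Omega> p \<Longrightarrow> u \<in> borel_measurable borel"
  by (simp add: W1p_def)

lemma weak_gradient_wgrad:
  assumes "u \<in> W1p \<Omega> p" shows "weak_gradient \<Omega> u (wgrad \<Omega> u)"
proof -
  obtain g where "weak_gradient \<Omega> u g" using assms unfolding W1p_def by auto
  then show ?thesis unfolding wgrad_def by (rule someI[of "weak_gradient \<Omega> u"])
qed

lemma wgrad_borel_measurable: "u \<in> W1p \<Omega> p \<Longrightarrow> wgrad \<Omega> u \<in> borel_measurable borel"
  using weak_gradient_wgrad unfolding weak_gradient_def by blast

text \<open>Removes the dependence on the choice operator: from here on \<open>wgrad\<close> may be
  computed from any weak gradient, up to a null set.\<close>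

lemma wgrad_AE_eq:
  assumes "open \<Omega>" "weak_gradient \<Omega> u g"
  shows "AE x in lborel. x \<in> \<Omega> \<longrightarrow> wgrad \<Omega> u x = g x"
  unfolding wgrad_def
  by (rule weak_gradient_unique[OF assms(1) someI[of "weak_gradient \<Omega> u", OF assms(2)] assms(2)]) simp

lemma wgrad_integrable:
  assumes "open \<Omega>" "u \<in> W1p \<Omega> p"
  shows "set_integrable lborel \<Omega> (\<lambda>x. norm (wgrad \<Omega> u x) powr p)"
proof -
  obtain g where g: "weak_gradient \<Omega> u g" "set_integrable lborel \<Omega> (\<lambda>x. norm (g x) powr p)"
    using assms(2) unfolding W1p_def by auto
  have [measurable]: "\<Omega> \<in> sets borel" "wgrad \<Omega> u \<in> borel_measurable borel"
    using assms wgrad_borel_measurable by auto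
  show ?thesis unfolding set_integrable_def
    by (rule integrable_cong_AE_imp[OF g(2)[unfolded set_integrable_def]])
      (use wgrad_AE_eq[OF assms(1) g(1)] in \<open>auto simp: indicator_def\<close>)
qed

subsection \<open>Strict convexity of powers and Minkowski's inequality\<close>

lemma bernoulli_powr_strict:
  fixes t p :: real
  assumes p: "1 < p" and t: "0 \<le> t" "t \<noteq> 1"
  shows "1 + p * (t - 1) < t powr p"
proof -
  consider "t = 0" | "0 < t" "t < 1" | "1 < t" using t by linarith
  then show ?thesis
  proof cases
    case 1
    then show ?thesis using p by simp
  next
    case 2
    have "\<exists>z. t < z \<and> z < 1 \<and> 1 powr p - t powr p = (1 - t) * (p * z powr (p - 1))"
      by (rule MVT2) (use 2 in \<open>auto intro!: derivative_eq_intros has_real_derivative_powr\<close>)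
    then obtain z where z: "t < z" "z < 1" "1 - t powr p = (1 - t) * (p * z powr (p - 1))" by auto
    have "z powr (p - 1) < 1 powr (p - 1)" using z 2 p by (intro powr_less_mono2) auto
    then have "(1 - t) * (p * z powr (p - 1)) < (1 - t) * (p * 1)" using 2 p
      by (intro mult_strict_left_mono) auto
    then show ?thesis using z(3) by (simp add: algebra_simps)
  next
    case 3
    have "\<exists>z. 1 < z \<and> z < t \<and> t powr p - 1 powr p = (t - 1) * (p * z powr (p - 1))"
      by (rule MVT2) (use 3 in \<open>auto intro!: derivative_eq_intros has_real_derivative_powr\<close>)
    then obtain z where z: "1 < z" "z < t" "t powr p - 1 = (t - 1) * (p * z powr (p - 1))" by auto
    have "1 powr (p - 1) < z powr (p - 1)" using z p by (intro powr_less_mono2) auto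
    then have "(t - 1) * (p * 1) < (t - 1) * (p * z powr (p - 1))" using 3 p
      by (intro mult_strict_left_mono) auto
    then show ?thesis using z(3) by (simp add: algebra_simps)
  qed
qed

lemma bernoulli_powr:
  fixes t p :: real
  assumes "1 < p" "0 \<le> t"
  shows "1 + p * (t - 1) \<le> t powr p"
  using bernoulli_powr_strict[OF assms] by (cases "t = 1") auto

text \<open>Bernoulli's inequality at \<open>b / a\<close>, scaled by \<open>a powr p\<close>; its
  strictness gives the equality case.\<close>

lemma tangent_powr:
  fixes a b p :: real
  assumes p: "1 < p" and a: "0 < a" and b: "0 \<le> b"
  shows "a powr p + p * a powr (p - 1) * (b - a) \<le> b powr p"
    and "b powr p \<le> a powr p + p * a powr (p - 1) * (b - a) \<Longrightarrow> b = a"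
proof -
  have e: "a powr p * (1 + p * (b / a - 1)) = a powr p + p * a powr (p - 1) * (b - a)"
    using a by (simp add: powr_diff field_simps)
  have f: "a powr p * (b / a) powr p = b powr p"
    using a b by (simp add: powr_divide)
  have "a powr p * (1 + p * (b / a - 1)) \<le> a powr p * (b / a) powr p"
    using bernoulli_powr[OF p, of "b / a"] a b by (intro mult_left_mono) auto
  then show "a powr p + p * a powr (p - 1) * (b - a) \<le> b powr p" by (simp only: e f)
  assume h: "b powr p \<le> a powr p + p * a powr (p - 1) * (b - a)"
  show "b = a"
  proof (rule ccontr)
    assume "b \<noteq> a"
    then have "1 + p * (b / a - 1) < (b / a) powr p"
      using a b by (intro bernoulli_powr_strict p) auto
    then have "a powr p * (1 + p * (b / a - 1)) < a powr p * (b / a) powr p"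
      using a by (intro mult_strict_left_mono) auto
    then show False using h by (simp only: e f)
  qed
qed

text \<open>Cauchy-Schwarz reduces the vector inequality to the radial one, which is the tangent
  inequality for powers.\<close>

lemma norm_powr_tangent:
  fixes X Y :: "'b::real_inner"
  assumes p: "1 < p"
  shows "norm X powr p + p * norm X powr (p - 2) * (X \<bullet> (Y - X)) \<le> norm Y powr p"
proof (cases "X = 0")
  case False
  have "X \<bullet> (Y - X) = X \<bullet> Y - norm X ^ 2" by (simp add: inner_diff_right power2_norm_eq_inner)
  also have "\<dots> \<le> norm X * (norm Y - norm X)"
    using norm_cauchy_schwarz[of X Y] by (simp add: power2_eq_square algebra_simps)
  finally have "p * norm X powr (p - 2) * (X \<bullet> (Y - X)) \<le> p * norm X powr (p - 2) * (norm X * (norm Y - norm X))"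
    using p by (intro mult_left_mono) auto
  also have "\<dots> = p * norm X powr (p - 1) * (norm Y - norm X)"
    using False powr_add[of "norm X" "p - 2" 1] by simp
  finally show ?thesis using tangent_powr(1)[OF p, of "norm X" "norm Y"] False by simp
qed simp

text \<open>The slack in the tangent inequality is the sum of a radial part and a Cauchy-Schwarz
  part, both nonnegative. Equality kills both: the first gives equal moduli, the second equal
  signs.\<close>

lemma abs_powr_tangent_eq:
  fixes x y :: real
  assumes p: "1 < p" and h: "\<bar>y\<bar> powr p \<le> \<bar>x\<bar> powr p + p * \<bar>x\<bar> powr (p - 2) * (x * (y - x))"
  shows "y = x"
proof (cases "x = 0")
  case True
  then have "\<bar>y\<bar> powr p = 0" using h powr_ge_zero[of "\<bar>y\<bar>" p] by simp
  then show ?thesis using True by simp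
next
  case False
  have e: "\<bar>x\<bar> powr (p - 2) * (\<bar>x\<bar> * c) = \<bar>x\<bar> powr (p - 1) * c" for c
    using False powr_add[of "\<bar>x\<bar>" "p - 2" 1] by simp
  have pos: "0 < p * \<bar>x\<bar> powr (p - 2)" using False p by simp
  have sq: "x * (y - x) = x * y - \<bar>x\<bar> * \<bar>x\<bar>" by (simp add: algebra_simps)
  have le: "x * (y - x) \<le> \<bar>x\<bar> * (\<bar>y\<bar> - \<bar>x\<bar>)"
    using abs_ge_self[of "x * y"] by (simp add: sq abs_mult algebra_simps)
  have t: "\<bar>x\<bar> powr p + p * \<bar>x\<bar> powr (p - 2) * (\<bar>x\<bar> * (\<bar>y\<bar> - \<bar>x\<bar>)) \<le> \<bar>y\<bar> powr p"
    using tangent_powr(1)[OF p, of "\<bar>x\<bar>" "\<bar>y\<bar>"] False unfolding mult.assoc e by simp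
  have m: "p * \<bar>x\<bar> powr (p - 2) * (x * (y - x)) \<le> p * \<bar>x\<bar> powr (p - 2) * (\<bar>x\<bar> * (\<bar>y\<bar> - \<bar>x\<bar>))"
    using le pos by (intro mult_left_mono) auto
  have "\<bar>y\<bar> = \<bar>x\<bar>"
  proof (rule tangent_powr(2)[OF p])
    have "\<bar>y\<bar> powr p \<le> \<bar>x\<bar> powr p + p * \<bar>x\<bar> powr (p - 2) * (\<bar>x\<bar> * (\<bar>y\<bar> - \<bar>x\<bar>))"
      using h m by linarith
    then show "\<bar>y\<bar> powr p \<le> \<bar>x\<bar> powr p + p * \<bar>x\<bar> powr (p - 1) * (\<bar>y\<bar> - \<bar>x\<bar>)"
      unfolding mult.assoc e .
  qed (use False in auto)
  moreover have "x * (y - x) = \<bar>x\<bar> * (\<bar>y\<bar> - \<bar>x\<bar>)"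
  proof -
    have "p * \<bar>x\<bar> powr (p - 2) * (\<bar>x\<bar> * (\<bar>y\<bar> - \<bar>x\<bar>)) \<le> p * \<bar>x\<bar> powr (p - 2) * (x * (y - x))"
      using h t by linarith
    then show ?thesis using le pos by (simp only: mult_le_cancel_left_pos)
  qed
  ultimately have "x * (y - x) = 0" by simp
  then show ?thesis using False by simp
qed

text \<open>Keeping the two weighted summands apart makes this yield Minkowski's inequality as well.\<close>

lemma norm_powr_add_le:
  fixes X Y :: "'b::real_inner"
  assumes p: "1 < p" and \<theta>: "0 < \<theta>" "\<theta> < 1"
  shows "norm (X + Y) powr p \<le> \<theta> * norm (X /\<^sub>R \<theta>) powr p + (1 - \<theta>) * norm (Y /\<^sub>R (1 - \<theta>)) powr p"
proof -
  let ?Z = "X + Y" let ?c = "p * norm (X + Y) powr (p - 2)"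
  have 1: "\<theta> * (norm ?Z powr p + ?c * (?Z \<bullet> (X /\<^sub>R \<theta> - ?Z))) \<le> \<theta> * norm (X /\<^sub>R \<theta>) powr p"
    using \<theta> by (intro mult_left_mono norm_powr_tangent p) auto
  have 2: "(1 - \<theta>) * (norm ?Z powr p + ?c * (?Z \<bullet> (Y /\<^sub>R (1 - \<theta>) - ?Z))) \<le> (1 - \<theta>) * norm (Y /\<^sub>R (1 - \<theta>)) powr p"
    using \<theta> by (intro mult_left_mono norm_powr_tangent p) auto
  \<comment> \<open>The weights make the deviations from \<open>X + Y\<close> cancel, so the linear
    terms of the two tangent inequalities drop out of the sum.\<close>
  have "\<theta> *\<^sub>R (X /\<^sub>R \<theta> - ?Z) + (1 - \<theta>) *\<^sub>R (Y /\<^sub>R (1 - \<theta>) - ?Z) = 0"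
    using \<theta> by (simp add: scaleR_right_diff_distrib scaleR_left_diff_distrib)
  then have "?Z \<bullet> (\<theta> *\<^sub>R (X /\<^sub>R \<theta> - ?Z) + (1 - \<theta>) *\<^sub>R (Y /\<^sub>R (1 - \<theta>) - ?Z)) = 0"
    by (simp only: inner_zero_right)
  then have "\<theta> * (?Z \<bullet> (X /\<^sub>R \<theta> - ?Z)) + (1 - \<theta>) * (?Z \<bullet> (Y /\<^sub>R (1 - \<theta>) - ?Z)) = 0"
    by (simp only: inner_add_right[of ?Z "\<theta> *\<^sub>R (X /\<^sub>R \<theta> - ?Z)"] inner_scaleR_right)
  then have "?c * (\<theta> * (?Z \<bullet> (X /\<^sub>R \<theta> - ?Z)) + (1 - \<theta>) * (?Z \<bullet> (Y /\<^sub>R (1 - \<theta>) - ?Z))) = 0" by simp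
  then show ?thesis using 1 2 by (simp add: algebra_simps)
qed

text \<open>Bookkeeping for the equality case below: once the linear terms cancel, equality of the
  weighted sums leaves no slack in the first summand.\<close>

lemma convex_combination_eq_aux:
  fixes \<theta> c u v z A B :: real
  assumes "c * (\<theta> * u + (1 - \<theta>) * v) = 0" "(1 - \<theta>) * (z + c * v) \<le> (1 - \<theta>) * B"
    "\<theta> * A + (1 - \<theta>) * B \<le> z"
  shows "\<theta> * A \<le> \<theta> * (z + c * u)"
  using assms by (simp add: algebra_simps)

text \<open>Equality in the weighted sum forces equality in the tangent inequality of the first
  summand, so \<open>x / \<theta>\<close> is the point of tangency. Reals suffice: Minkowski's
  inequality below uses it in each coordinate separately.\<close>

lemma abs_powr_add_eq:
  fixes x y :: real
  assumes p: "1 < p" and \<theta>: "0 < \<theta>" "\<theta> < 1"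
    and h: "\<theta> * \<bar>x / \<theta>\<bar> powr p + (1 - \<theta>) * \<bar>y / (1 - \<theta>)\<bar> powr p \<le> \<bar>x + y\<bar> powr p"
  shows "x = \<theta> * (x + y)"
proof -
  let ?Z = "x + y" let ?c = "p * \<bar>x + y\<bar> powr (p - 2)"
  have 2: "(1 - \<theta>) * (\<bar>?Z\<bar> powr p + ?c * (?Z * (y / (1 - \<theta>) - ?Z))) \<le> (1 - \<theta>) * \<bar>y / (1 - \<theta>)\<bar> powr p"
    using \<theta> norm_powr_tangent[OF p, of ?Z "y / (1 - \<theta>)"] by (intro mult_left_mono) auto
  have "\<theta> * (?Z * (x / \<theta> - ?Z)) + (1 - \<theta>) * (?Z * (y / (1 - \<theta>) - ?Z)) = 0"
    using \<theta> by (simp add: field_simps)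
  then have "?c * (\<theta> * (?Z * (x / \<theta> - ?Z)) + (1 - \<theta>) * (?Z * (y / (1 - \<theta>) - ?Z))) = 0" by simp
  then have "\<theta> * \<bar>x / \<theta>\<bar> powr p \<le> \<theta> * (\<bar>?Z\<bar> powr p + ?c * (?Z * (x / \<theta> - ?Z)))"
    using 2 h by (rule convex_combination_eq_aux)
  then have "\<bar>x / \<theta>\<bar> powr p \<le> \<bar>?Z\<bar> powr p + ?c * (?Z * (x / \<theta> - ?Z))"
    using \<theta> by (simp only: mult_le_cancel_left_pos)
  then have "x / \<theta> = ?Z" by (rule abs_powr_tangent_eq[OF p])
  then show ?thesis using \<theta> by (simp add: field_simps)
qed

section \<open>Minkowski's inequality for the p-mean of two numbers\<close>

lemma powr_le_imp_le:
  fixes x y p :: real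
  shows "0 < p \<Longrightarrow> 0 \<le> y \<Longrightarrow> x powr p \<le> y powr p \<Longrightarrow> x \<le> y"
  by (meson leD le_less_linear less_imp_le order_trans powr_less_mono2)

text \<open>A multiple of the p-norm of the plane vector \<open>(s, t)\<close>. The normalization
  makes its p-th power the average that defines the midpoint curve.\<close>

definition pair_norm :: "real \<Rightarrow> real \<Rightarrow> real \<Rightarrow> real" where
  "pair_norm p s t = ((\<bar>s\<bar> powr p + \<bar>t\<bar> powr p) / 2) powr (1 / p)"

lemma pair_norm_powr: "1 < p \<Longrightarrow> pair_norm p s t powr p = (\<bar>s\<bar> powr p + \<bar>t\<bar> powr p) / 2"
  by (simp add: pair_norm_def powr_powr)

lemma pair_norm_nonneg: "0 \<le> pair_norm p s t"
  by (simp add: pair_norm_def)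

lemma pair_norm_eq_0: "1 < p \<Longrightarrow> pair_norm p s t = 0 \<longleftrightarrow> s = 0 \<and> t = 0"
  by (auto simp: pair_norm_def add_nonneg_eq_0_iff)

lemma scaled_powr:
  fixes a c \<theta> p :: real
  assumes "0 < \<theta>"
  shows "\<theta> * \<bar>c / \<theta>\<bar> powr p = \<theta> powr (1 - p) * \<bar>c\<bar> powr p"
  using assms by (simp add: powr_divide powr_diff)

text \<open>Convexity with weight \<theta> is applied in each coordinate; for \<theta> equal to
  \<open>?a / (?a + ?b)\<close> the two bounds average to exactly the p-th power of
  \<open>?a + ?b\<close>. In the equality case both coordinates are split in the same ratio
  \<theta>, which makes the vectors parallel.\<close>

lemma pair_norm_triangle:
  assumes p: "1 < p"
  shows "pair_norm p (x + x') (y + y') \<le> pair_norm p x y + pair_norm p x' y'"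
    and "pair_norm p x y + pair_norm p x' y' \<le> pair_norm p (x + x') (y + y') \<Longrightarrow> x * y' = x' * y"
proof -
  let ?a = "pair_norm p x y" and ?b = "pair_norm p x' y'" and ?N = "pair_norm p (x + x') (y + y')"
  have "?N \<le> ?a + ?b \<and> (?a + ?b \<le> ?N \<longrightarrow> x * y' = x' * y)"
  proof (cases "?a = 0 \<or> ?b = 0")
    case True
    then show ?thesis using p by (auto simp: pair_norm_eq_0 pair_norm_nonneg)
  next
    case False
    then have ab: "0 < ?a" "0 < ?b" using pair_norm_nonneg by (auto simp: less_le)
    define \<theta> where "\<theta> = ?a / (?a + ?b)"
    have \<theta>: "0 < \<theta>" "\<theta> < 1" using ab by (auto simp: \<theta>_def)
    have \<theta>': "?a = \<theta> * (?a + ?b)" "?b = (1 - \<theta>) * (?a + ?b)"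
      using ab by (auto simp: \<theta>_def field_simps)
    define F where "F c d = \<theta> * \<bar>c / \<theta>\<bar> powr p + (1 - \<theta>) * \<bar>d / (1 - \<theta>)\<bar> powr p" for c d
    have F: "\<bar>c + d\<bar> powr p \<le> F c d" for c d
      using norm_powr_add_le[OF p \<theta>, of c d] by (simp add: F_def divide_inverse mult.commute)
    have Fe: "c = \<theta> * (c + d)" if "F c d \<le> \<bar>c + d\<bar> powr p" for c d
      using abs_powr_add_eq[OF p \<theta>] that unfolding F_def by blast
    have "\<theta> powr (1 - p) * ?a powr p = \<theta> * (?a + ?b) powr p"
      by (subst \<theta>'(1), subst powr_mult) (use \<theta> ab in \<open>auto simp: powr_diff\<close>)
    moreover have "(1 - \<theta>) powr (1 - p) * ?b powr p = (1 - \<theta>) * (?a + ?b) powr p"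
      by (subst \<theta>'(2), subst powr_mult) (use \<theta> ab in \<open>auto simp: powr_diff\<close>)
    moreover have "(F x x' + F y y') / 2 = \<theta> powr (1 - p) * ?a powr p + (1 - \<theta>) powr (1 - p) * ?b powr p"
      unfolding F_def pair_norm_powr[OF p] scaled_powr[OF \<theta>(1)] using scaled_powr[of "1 - \<theta>" _ p] \<theta>
      by (simp add: algebra_simps add_divide_distrib)
    ultimately have S: "(F x x' + F y y') / 2 = (?a + ?b) powr p" by (simp add: algebra_simps)
    have "?N powr p \<le> (?a + ?b) powr p"
      unfolding S[symmetric] pair_norm_powr[OF p] using F[of x x'] F[of y y'] by simp
    then have "?N \<le> ?a + ?b" by (rule powr_le_imp_le[rotated 2]) (use p ab in auto)
    moreover have "x * y' = x' * y" if "?a + ?b \<le> ?N"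
    proof -
      have "(?a + ?b) powr p \<le> ?N powr p" using that ab p by (intro powr_mono2) auto
      then have "F x x' + F y y' \<le> \<bar>x + x'\<bar> powr p + \<bar>y + y'\<bar> powr p"
        unfolding S[symmetric] pair_norm_powr[OF p] by simp
      then have e: "x = \<theta> * (x + x')" "y = \<theta> * (y + y')"
        using F[of x x'] F[of y y'] by (auto intro!: Fe)
      have "x * (y + y') = (\<theta> * (x + x')) * (y + y')" using e(1) by simp
      also have "\<dots> = (x + x') * y" using e(2) by simp
      finally show ?thesis by (simp add: algebra_simps)
    qed
    ultimately show ?thesis by blast
  qed
  then show "?N \<le> ?a + ?b" "?a + ?b \<le> ?N \<Longrightarrow> x * y' = x' * y" by auto
qed

text \<open>The reverse triangle inequality of the p-mean. Applied to \<open>(u x, a x)\<close> and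
  \<open>(u y, a y)\<close> it bounds the increments of the midpoint curve, and its equality case is
  the source of rigidity.\<close>

lemma pair_norm_diff:
  assumes p: "1 < p"
  shows "\<bar>pair_norm p s t - pair_norm p s' t'\<bar> powr p \<le> (\<bar>s - s'\<bar> powr p + \<bar>t - t'\<bar> powr p) / 2"
    and "(\<bar>s - s'\<bar> powr p + \<bar>t - t'\<bar> powr p) / 2 \<le> \<bar>pair_norm p s t - pair_norm p s' t'\<bar> powr p
      \<Longrightarrow> s * t' = s' * t"
proof -
  let ?D = "pair_norm p (s - s') (t - t')"
  have sym: "?D = pair_norm p (s' - s) (t' - t)" by (simp add: pair_norm_def abs_minus_commute)
  note T = pair_norm_triangle[OF p, where x = s' and x' = "s - s'" and y = t' and y' = "t - t'"]
    pair_norm_triangle[OF p, where x = s and x' = "s' - s" and y = t and y' = "t' - t"]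
  have le: "\<bar>pair_norm p s t - pair_norm p s' t'\<bar> \<le> ?D"
    using T(1) T(3) by (simp add: sym[symmetric])
  show "\<bar>pair_norm p s t - pair_norm p s' t'\<bar> powr p \<le> (\<bar>s - s'\<bar> powr p + \<bar>t - t'\<bar> powr p) / 2"
    unfolding pair_norm_powr[OF p, symmetric] using le p by (intro powr_mono2) auto
  assume "(\<bar>s - s'\<bar> powr p + \<bar>t - t'\<bar> powr p) / 2 \<le> \<bar>pair_norm p s t - pair_norm p s' t'\<bar> powr p"
  then have "?D powr p \<le> \<bar>pair_norm p s t - pair_norm p s' t'\<bar> powr p"
    by (simp only: pair_norm_powr[OF p])
  then have ge: "?D \<le> \<bar>pair_norm p s t - pair_norm p s' t'\<bar>"
    by (rule powr_le_imp_le[rotated 2]) (use p in auto)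
  \<comment> \<open>Equality holds in the triangle inequality that decomposes the larger of the two
    vectors.\<close>
  show "s * t' = s' * t"
  proof (cases "pair_norm p s' t' \<le> pair_norm p s t")
    case True
    then have "s' * (t - t') = (s - s') * t'" using ge T(2) by simp
    then show ?thesis by (simp add: algebra_simps)
  next
    case False
    then have "s * (t' - t) = (s' - s) * t" using ge T(4) by (simp add: sym)
    then show ?thesis by (simp add: algebra_simps)
  qed
qed

subsection \<open>Spaces of functions with integrable powers\<close>

lemma norm_powr_add_le2:
  fixes X Y :: "'b::real_inner"
  assumes p: "1 < p"
  shows "norm (X + Y) powr p \<le> 2 powr p * (norm X powr p + norm Y powr p)"
proof -
  have "norm (X + Y) powr p \<le> 1/2 * norm (X /\<^sub>R (1/2)) powr p + (1 - 1/2) * norm (Y /\<^sub>R (1 - 1/2)) powr p"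
    by (rule norm_powr_add_le[OF p]) auto
  also have "\<dots> = 1/2 * (2 powr p * (norm X powr p + norm Y powr p))"
    by (simp add: powr_mult algebra_simps)
  also have "\<dots> \<le> 2 powr p * (norm X powr p + norm Y powr p)"
    by simp
  finally show ?thesis .
qed

text \<open>A predicate over an arbitrary measure, so that gradients on \<Omega> and increments
  under the Gagliardo kernel are handled by the same lemmas.\<close>

definition Lp :: "'x measure \<Rightarrow> real \<Rightarrow> ('x \<Rightarrow> 'b::euclidean_space) \<Rightarrow> bool" where
  "Lp M p f \<longleftrightarrow> f \<in> borel_measurable M \<and> integrable M (\<lambda>x. norm (f x) powr p)"

definition Lp_pow :: "'x measure \<Rightarrow> real \<Rightarrow> ('x \<Rightarrow> 'b::euclidean_space) \<Rightarrow> real" where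
  "Lp_pow M p f = (LINT x|M. norm (f x) powr p)"

text \<open>The duality form of the p-Laplacian; for suitable measures it is
  \<open>form_local\<close> as well as \<open>form_nonlocal\<close>.\<close>

definition pairing :: "'x measure \<Rightarrow> real \<Rightarrow> ('x \<Rightarrow> 'b::euclidean_space) \<Rightarrow> ('x \<Rightarrow> 'b) \<Rightarrow> real" where
  "pairing M p f g = (LINT x|M. norm (f x) powr (p - 2) * (f x \<bullet> g x))"

lemma Lp_pow_nonneg: "0 \<le> Lp_pow M p f"
  unfolding Lp_pow_def by (rule Bochner_Integration.integral_nonneg) simp

lemma Lp_pow_nn_integral:
  "Lp M p f \<Longrightarrow> (\<integral>\<^sup>+x. ennreal (norm (f x) powr p) \<partial>M) = ennreal (Lp_pow M p f)"
  unfolding Lp_def Lp_pow_def by (intro nn_integral_eq_integral) auto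

lemma LpI_nn_integral:
  assumes "f \<in> borel_measurable M" "(\<integral>\<^sup>+x. ennreal (norm (f x) powr p) \<partial>M) \<le> ennreal C" "0 \<le> C"
  shows "Lp M p f" "Lp_pow M p f \<le> C"
proof -
  have [measurable]: "f \<in> borel_measurable M" by fact
  have "(\<integral>\<^sup>+x. ennreal (norm (f x) powr p) \<partial>M) < \<infinity>"
    using assms(2) by (rule le_less_trans) simp
  then show L: "Lp M p f"
    unfolding Lp_def integrable_iff_bounded by simp
  show "Lp_pow M p f \<le> C"
    using assms(2,3) Lp_pow_nn_integral[OF L] by simp
qed

lemma Lp_lincomb:
  fixes f g :: "'x \<Rightarrow> 'b::euclidean_space"
  assumes p: "1 < p" and f: "Lp M p f" and g: "Lp M p g"
  shows "Lp M p (\<lambda>x. c *\<^sub>R f x + d *\<^sub>R g x)"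
    and "Lp_pow M p (\<lambda>x. c *\<^sub>R f x + d *\<^sub>R g x) \<le> 2 powr p * (\<bar>c\<bar> powr p * Lp_pow M p f + \<bar>d\<bar> powr p * Lp_pow M p g)"
proof -
  have [measurable]: "f \<in> borel_measurable M" "g \<in> borel_measurable M"
    and i: "integrable M (\<lambda>x. norm (f x) powr p)" "integrable M (\<lambda>x. norm (g x) powr p)"
    using f g unfolding Lp_def by auto
  let ?w = "\<lambda>x. 2 powr p * (\<bar>c\<bar> powr p * norm (f x) powr p + \<bar>d\<bar> powr p * norm (g x) powr p)"
  have w: "integrable M ?w" using i by simp
  have le: "norm (c *\<^sub>R f x + d *\<^sub>R g x) powr p \<le> ?w x" for x
    using norm_powr_add_le2[OF p, of "c *\<^sub>R f x" "d *\<^sub>R g x"] by (simp add: powr_mult)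
  have i2: "integrable M (\<lambda>x. norm (c *\<^sub>R f x + d *\<^sub>R g x) powr p)"
    by (rule Bochner_Integration.integrable_bound[OF w]) (use le in \<open>auto intro: order_trans[OF _ abs_ge_self]\<close>)
  then show "Lp M p (\<lambda>x. c *\<^sub>R f x + d *\<^sub>R g x)" unfolding Lp_def by simp
  have "Lp_pow M p (\<lambda>x. c *\<^sub>R f x + d *\<^sub>R g x) \<le> (LINT x|M. ?w x)"
    unfolding Lp_pow_def by (rule integral_mono[OF i2 w le])
  also have "\<dots> = 2 powr p * (\<bar>c\<bar> powr p * Lp_pow M p f + \<bar>d\<bar> powr p * Lp_pow M p g)"
    unfolding Lp_pow_def using i by simp
  finally show "Lp_pow M p (\<lambda>x. c *\<^sub>R f x + d *\<^sub>R g x) \<le> 2 powr p * (\<bar>c\<bar> powr p * Lp_pow M p f + \<bar>d\<bar> powr p * Lp_pow M p g)" .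
qed

lemma Lp_pow_scale:
  "Lp_pow M p (\<lambda>x. c *\<^sub>R f x) = \<bar>c\<bar> powr p * Lp_pow M p f"
  unfolding Lp_pow_def by (simp add: powr_mult)

lemma norm_powr_inner_le:
  fixes C B :: "'b::real_inner"
  shows "\<bar>norm C powr (p - 2) * (C \<bullet> B)\<bar> \<le> norm C powr (p - 1) * norm B"
proof (cases "C = 0")
  case False
  have "\<bar>norm C powr (p - 2) * (C \<bullet> B)\<bar> \<le> norm C powr (p - 2) * (norm C * norm B)"
    unfolding abs_mult by (simp add: mult_left_mono Cauchy_Schwarz_ineq2)
  also have "\<dots> = norm C powr (p - 1) * norm B"
    using False powr_add[of "norm C" "p - 2" 1] by simp
  finally show ?thesis .
qed simp

text \<open>Does the work of Hoelder's inequality. For \<open>C = A + t B\<close> with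
  \<open>0 \<le> t \<le> 1\<close> the bound does not depend on \<open>t\<close>, as dominated
  convergence requires.\<close>

lemma norm_powr_inner_bound:
  fixes A B C :: "'b::real_inner"
  assumes p: "1 < p" and le: "norm C \<le> norm A + norm B"
  shows "\<bar>norm C powr (p - 2) * (C \<bullet> B)\<bar> \<le> 2 powr p * (norm A powr p + norm B powr p)"
proof -
  have "\<bar>norm C powr (p - 2) * (C \<bullet> B)\<bar> \<le> norm C powr (p - 1) * norm B"
    by (rule norm_powr_inner_le)
  also have "\<dots> \<le> (norm A + norm B) powr (p - 1) * (norm A + norm B)"
    using p le by (intro mult_mono powr_mono2) auto
  also have "\<dots> = (norm A + norm B) powr p"
    using powr_add[of "norm A + norm B" "p - 1" 1] by (cases "norm A + norm B = 0") auto
  also have "\<dots> \<le> 2 powr p * (norm A powr p + norm B powr p)"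
    using norm_powr_add_le2[OF p, of "norm A" "norm B"] by simp
  finally show ?thesis .
qed

lemma pairing_integrable:
  fixes f g :: "'x \<Rightarrow> 'b::euclidean_space"
  assumes p: "1 < p" and f: "Lp M p f" and g: "Lp M p g"
  shows "integrable M (\<lambda>x. norm (f x) powr (p - 2) * (f x \<bullet> g x))"
proof -
  have [measurable]: "f \<in> borel_measurable M" "g \<in> borel_measurable M"
    and i: "integrable M (\<lambda>x. norm (f x) powr p)" "integrable M (\<lambda>x. norm (g x) powr p)"
    using f g unfolding Lp_def by auto
  have w: "integrable M (\<lambda>x. 2 powr p * (norm (f x) powr p + norm (g x) powr p))" using i by simp
  show ?thesis
    by (rule Bochner_Integration.integrable_bound[OF w])
      (auto intro!: AE_I2 order_trans[OF norm_powr_inner_bound[OF p]])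
qed

lemma pairing_self: "pairing M p f f = Lp_pow M p f"
proof -
  have "norm v powr (p - 2) * (v \<bullet> v) = norm v powr p" for v :: 'b
    using powr_add[of "norm v" "p - 2" 2] by (cases "v = 0") (auto simp: power2_norm_eq_inner)
  then show ?thesis by (simp add: pairing_def Lp_pow_def)
qed

text \<open>The tangent inequality is taken at the displaced point \<open>f + t g\<close> and
  evaluated at \<open>f\<close>. This bounds the growth from above by a pairing at the displaced
  point, which \<open>pairing_tendsto\<close> then moves back to \<open>f\<close>.\<close>

lemma Lp_pow_tangent:
  fixes f g :: "'x \<Rightarrow> 'b::euclidean_space"
  assumes p: "1 < p" and f: "Lp M p f" and g: "Lp M p g"
  shows "Lp_pow M p (\<lambda>x. f x + t *\<^sub>R g x) \<le> Lp_pow M p f + t * (p * pairing M p (\<lambda>x. f x + t *\<^sub>R g x) g)"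
proof -
  let ?h = "\<lambda>x. f x + t *\<^sub>R g x"
  have h: "Lp M p ?h" using Lp_lincomb(1)[OF p f g, of 1 t] by simp
  have i: "integrable M (\<lambda>x. norm (?h x) powr p)" "integrable M (\<lambda>x. norm (f x) powr p)"
    using h f unfolding Lp_def by auto
  note i2 = pairing_integrable[OF p h g]
  have le: "norm (?h x) powr p \<le> norm (f x) powr p + (t * p) * (norm (?h x) powr (p - 2) * (?h x \<bullet> g x))" for x
  proof -
    have "norm (?h x) powr p + p * norm (?h x) powr (p - 2) * (?h x \<bullet> (f x - ?h x)) \<le> norm (f x) powr p"
      by (rule norm_powr_tangent[OF p])
    moreover have "?h x \<bullet> (f x - ?h x) = - (t * (?h x \<bullet> g x))" by simp
    ultimately show ?thesis by (simp add: mult_ac)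
  qed
  have "Lp_pow M p ?h \<le> (LINT x|M. norm (f x) powr p + (t * p) * (norm (?h x) powr (p - 2) * (?h x \<bullet> g x)))"
    unfolding Lp_pow_def
    by (rule integral_mono[OF i(1) Bochner_Integration.integrable_add[OF i(2) integrable_mult_right[OF i2]] le])
  also have "\<dots> = Lp_pow M p f + (t * p) * pairing M p ?h g"
    unfolding Lp_pow_def pairing_def
    by (subst Bochner_Integration.integral_add[OF i(2) integrable_mult_right[OF i2]]) simp
  finally show ?thesis by (simp add: mult.assoc)
qed

lemma pairing_tendsto:
  fixes f g :: "'x \<Rightarrow> 'b::euclidean_space"
  assumes p: "1 < p" and f: "Lp M p f" and g: "Lp M p g"
    and t: "t \<longlonglongrightarrow> 0" "\<And>n. 0 \<le> t n" "\<And>n. t n \<le> 1"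
  shows "(\<lambda>n. pairing M p (\<lambda>x. f x + t n *\<^sub>R g x) g) \<longlonglongrightarrow> pairing M p f g"
proof -
  have [measurable]: "f \<in> borel_measurable M" "g \<in> borel_measurable M"
    and i: "integrable M (\<lambda>x. norm (f x) powr p)" "integrable M (\<lambda>x. norm (g x) powr p)"
    using f g unfolding Lp_def by auto
  show ?thesis unfolding pairing_def
  proof (rule integral_dominated_convergence[where w = "\<lambda>x. 2 powr p * (norm (f x) powr p + norm (g x) powr p)"])
    show "integrable M (\<lambda>x. 2 powr p * (norm (f x) powr p + norm (g x) powr p))" using i by simp
    show "AE x in M. norm (norm (f x + t n *\<^sub>R g x) powr (p - 2) * ((f x + t n *\<^sub>R g x) \<bullet> g x))
        \<le> 2 powr p * (norm (f x) powr p + norm (g x) powr p)" for n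
    proof (rule AE_I2)
      fix x
      have "norm (f x + t n *\<^sub>R g x) \<le> norm (f x) + norm (t n *\<^sub>R g x)" by (rule norm_triangle_ineq)
      also have "norm (t n *\<^sub>R g x) \<le> norm (g x)" using t(2,3)[of n] by (simp add: mult_left_le_one_le)
      finally show "norm (norm (f x + t n *\<^sub>R g x) powr (p - 2) * ((f x + t n *\<^sub>R g x) \<bullet> g x))
        \<le> 2 powr p * (norm (f x) powr p + norm (g x) powr p)"
        unfolding real_norm_def by (intro norm_powr_inner_bound[OF p]) simp
    qed
    show "AE x in M. (\<lambda>n. norm (f x + t n *\<^sub>R g x) powr (p - 2) * ((f x + t n *\<^sub>R g x) \<bullet> g x))
        \<longlonglongrightarrow> norm (f x) powr (p - 2) * (f x \<bullet> g x)"
    proof (rule AE_I2)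
      fix x
      have l: "(\<lambda>n. f x + t n *\<^sub>R g x) \<longlonglongrightarrow> f x + 0 *\<^sub>R g x"
        by (intro tendsto_intros t(1))
      show "(\<lambda>n. norm (f x + t n *\<^sub>R g x) powr (p - 2) * ((f x + t n *\<^sub>R g x) \<bullet> g x))
        \<longlonglongrightarrow> norm (f x) powr (p - 2) * (f x \<bullet> g x)"
      proof (cases "f x = 0")
        case False
        then show ?thesis using l by (auto intro!: tendsto_intros)
      next
        \<comment> \<open>For \<open>p < 2\<close> the power \<open>p - 2\<close> is singular at 0;
          after Cauchy-Schwarz only the positive power \<open>p - 1\<close> remains.\<close>
        case True
        have "(\<lambda>n. norm (f x + t n *\<^sub>R g x)) \<longlonglongrightarrow> 0" using tendsto_norm[OF l] True by simp
        then have "(\<lambda>n. norm (f x + t n *\<^sub>R g x) powr (p - 1)) \<longlonglongrightarrow> 0 powr (p - 1)"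
          using p by (intro tendsto_powr') auto
        then have "(\<lambda>n. norm (f x + t n *\<^sub>R g x) powr (p - 1) * norm (g x)) \<longlonglongrightarrow> 0"
          by (intro tendsto_mult_left_zero) simp
        then have "(\<lambda>n. norm (f x + t n *\<^sub>R g x) powr (p - 2) * ((f x + t n *\<^sub>R g x) \<bullet> g x)) \<longlonglongrightarrow> 0"
          by (rule Lim_null_comparison[rotated]) (auto simp only: real_norm_def norm_powr_inner_le eventually_True)
        then show ?thesis using True by simp
      qed
    qed
  qed auto
qed

text \<open>The weighted convexity bound with \<theta> close to 1 acts as a triangle inequality for
  p-th powers: it costs a factor \<open>\<theta> powr (1 - p)\<close> near 1 on \<open>f\<close>,
  and a large but fixed factor on the vanishing difference.\<close>

lemma Lp_pow_limit_le:
  fixes f :: "'x \<Rightarrow> 'b::euclidean_space"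
  assumes p: "1 < p" and f: "Lp M p f" and g: "\<And>n. Lp M p (g n)"
    and l: "(\<lambda>n. Lp_pow M p (\<lambda>x. g n x - f x)) \<longlonglongrightarrow> 0" and e: "0 < e"
  shows "\<forall>\<^sub>F n in sequentially. Lp_pow M p (g n) < Lp_pow M p f + e"
proof -
  have "((\<lambda>\<theta>. \<theta> powr (1 - p) * Lp_pow M p f) \<longlongrightarrow> 1 powr (1 - p) * Lp_pow M p f) (at_left 1)"
    by (intro tendsto_intros) auto
  then have "\<forall>\<^sub>F \<theta> in at_left (1::real). \<theta> powr (1 - p) * Lp_pow M p f < Lp_pow M p f + e / 2"
    using e by (intro order_tendstoD(2)) auto
  moreover have "\<forall>\<^sub>F \<theta> in at_left (1::real). \<theta> \<in> {0<..<1}"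
    by (rule eventually_at_left_real) simp
  ultimately obtain \<theta> where \<theta>: "\<theta> powr (1 - p) * Lp_pow M p f < Lp_pow M p f + e / 2" "0 < \<theta>" "\<theta> < 1"
    using eventually_happens[OF eventually_conj] by (metis (no_types, lifting) greaterThanLessThan_iff trivial_limit_at_left_real)
  have i: "integrable M (\<lambda>x. norm (g n x) powr p)" "integrable M (\<lambda>x. norm (f x) powr p)"
    "integrable M (\<lambda>x. norm (g n x - f x) powr p)" for n
    using f g[of n] Lp_lincomb(1)[OF p g[of n] f, where c = 1 and d = "-1"] unfolding Lp_def by auto
  have le: "Lp_pow M p (g n) \<le> \<theta> powr (1 - p) * Lp_pow M p f + (1 - \<theta>) powr (1 - p) * Lp_pow M p (\<lambda>x. g n x - f x)" for n
  proof -
    have "norm (g n x) powr p \<le> \<theta> powr (1 - p) * norm (f x) powr p + (1 - \<theta>) powr (1 - p) * norm (g n x - f x) powr p" for x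
    proof -
      have n: "norm (v /\<^sub>R c) = \<bar>norm v / c\<bar>" for v :: 'b and c
        by (simp add: divide_inverse abs_mult)
      have "norm (f x + (g n x - f x)) powr p \<le> \<theta> powr (1 - p) * \<bar>norm (f x)\<bar> powr p + (1 - \<theta>) powr (1 - p) * \<bar>norm (g n x - f x)\<bar> powr p"
        using norm_powr_add_le[OF p \<theta>(2,3), of "f x" "g n x - f x"]
        unfolding n scaled_powr[OF \<theta>(2)] scaled_powr[of "1 - \<theta>", OF diff_gt_0_iff_gt[THEN iffD2, OF \<theta>(3)]] .
      then show ?thesis by simp
    qed
    then have "Lp_pow M p (g n) \<le> (LINT x|M. \<theta> powr (1 - p) * norm (f x) powr p + (1 - \<theta>) powr (1 - p) * norm (g n x - f x) powr p)"
      unfolding Lp_pow_def using i by (intro integral_mono) auto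
    then show ?thesis unfolding Lp_pow_def using i by simp
  qed
  have "(\<lambda>n. (1 - \<theta>) powr (1 - p) * Lp_pow M p (\<lambda>x. g n x - f x)) \<longlonglongrightarrow> 0"
    by (rule tendsto_mult_right_zero[OF l])
  then have "\<forall>\<^sub>F n in sequentially. (1 - \<theta>) powr (1 - p) * Lp_pow M p (\<lambda>x. g n x - f x) < e / 2"
    using e by (intro order_tendstoD(2)) auto
  then show ?thesis
  proof eventually_elim
    case (elim n)
    then show ?case using le[of n] \<theta>(1) by linarith
  qed
qed

lemma nn_integral_AE_limit_le:
  fixes f :: "nat \<Rightarrow> 'x \<Rightarrow> ennreal"
  assumes [measurable]: "\<And>n. f n \<in> borel_measurable M" "g \<in> borel_measurable M"
    and l: "AE x in M. (\<lambda>n. f n x) \<longlonglongrightarrow> g x"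
    and C: "\<forall>\<^sub>F n in sequentially. (\<integral>\<^sup>+x. f n x \<partial>M) \<le> C"
  shows "(\<integral>\<^sup>+x. g x \<partial>M) \<le> C"
proof -
  have "(\<integral>\<^sup>+x. g x \<partial>M) = (\<integral>\<^sup>+x. liminf (\<lambda>n. f n x) \<partial>M)"
    by (rule nn_integral_cong_AE) (use l in eventually_elim, auto intro!: lim_imp_Liminf[symmetric])
  also have "\<dots> \<le> liminf (\<lambda>n. \<integral>\<^sup>+x. f n x \<partial>M)"
    by (rule nn_integral_liminf) auto
  also have "\<dots> \<le> C"
    by (rule Liminf_le[OF _ C]) auto
  finally show ?thesis .
qed

subsection \<open>Difference quotients and kernel integrals\<close>

text \<open>Dyadic shells in place of polar coordinates: on each shell \<open>f\<close> is dominated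
  by a constant on a ball, and constant times volume forms a geometric series.\<close>

lemma nn_integral_shells_finite:
  fixes f :: "'a::euclidean_space \<Rightarrow> ennreal"
  assumes q: "0 \<le> q" "q < 1" and K: "0 \<le> K" and c: "\<And>k. 0 \<le> c k" and r: "\<And>k. 0 \<le> r k"
    and geo: "\<And>k. c k * r k ^ DIM('a) = K * q ^ k"
    and f: "\<And>h. \<exists>k. f h \<le> ennreal (c k) * indicator (cball 0 (r k)) h"
  shows "(\<integral>\<^sup>+h. f h \<partial>lborel) < \<infinity>"
proof -
  let ?V = "unit_ball_vol (real DIM('a))"
  have V: "0 \<le> ?V" by simp
  have "(\<integral>\<^sup>+h. f h \<partial>lborel) \<le> (\<integral>\<^sup>+h. (\<Sum>k. ennreal (c k) * indicator (cball 0 (r k)) (h::'a)) \<partial>lborel)"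
  proof (rule nn_integral_mono)
    fix h :: 'a
    obtain k where "f h \<le> ennreal (c k) * indicator (cball 0 (r k)) h" using f by blast
    also have "\<dots> \<le> (\<Sum>k. ennreal (c k) * indicator (cball 0 (r k)) h)"
    proof -
      define g where "g k = ennreal (c k) * indicator (cball 0 (r k)) h" for k
      have "sum g {k} \<le> suminf g" by (rule sum_le_suminf) auto
      then have "g k \<le> suminf g" by simp
      then show ?thesis unfolding g_def .
    qed
    finally show "f h \<le> (\<Sum>k. ennreal (c k) * indicator (cball 0 (r k)) h)" .
  qed
  also have "\<dots> = (\<Sum>k. \<integral>\<^sup>+h. ennreal (c k) * indicator (cball 0 (r k)) (h::'a) \<partial>lborel)"
    by (rule nn_integral_suminf)
      (rule borel_measurable_times_ennreal[OF borel_measurable_const borel_measurable_indicator], simp)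
  also have "\<dots> = (\<Sum>k. ennreal (?V * K * q ^ k))"
  proof (rule suminf_cong)
    fix k
    have "(\<integral>\<^sup>+h. ennreal (c k) * indicator (cball 0 (r k)) (h::'a) \<partial>lborel)
        = ennreal (c k) * emeasure lborel (cball (0::'a) (r k))"
      by (rule nn_integral_cmult_indicator) auto
    also have "\<dots> = ennreal (?V * (c k * r k ^ DIM('a)))"
      using c[of k] r[of k] V by (simp add: emeasure_cball ennreal_mult[symmetric] mult_ac)
    finally show "(\<integral>\<^sup>+h. ennreal (c k) * indicator (cball 0 (r k)) (h::'a) \<partial>lborel) = ennreal (?V * K * q ^ k)"
      by (simp add: geo mult.assoc)
  qed
  also have "\<dots> < \<infinity>"
    using q K V unfolding infinity_ennreal_def less_top[symmetric]
    by (intro ennreal_suminf_neq_top summable_mult summable_geometric) auto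
  finally show ?thesis .
qed

lemma floor_log_bounds:
  fixes y :: real
  assumes "1 \<le> y"
  obtains L k where "y = 2 powr L" "real k \<le> L" "L < real k + 1"
proof (rule that[of "log 2 y" "nat \<lfloor>log 2 y\<rfloor>"])
  have "0 \<le> log 2 y" using assms by simp
  then show "real (nat \<lfloor>log 2 y\<rfloor>) \<le> log 2 y" "log 2 y < real (nat \<lfloor>log 2 y\<rfloor>) + 1" by linarith+
qed (use assms in simp)

lemma nn_integral_norm_powr_near:
  fixes b :: real
  assumes b: "b < real DIM('a::euclidean_space)"
  shows "(\<integral>\<^sup>+h. ennreal (norm (h::'a) powr (- b)) * indicator (cball 0 1) h \<partial>lborel) < \<infinity>"
proof (rule nn_integral_shells_finite)
  let ?N = "real DIM('a)"
  \<comment> \<open>The shell is \<open>2 powr (- k - 1) < norm h \<le> 2 powr (- k)\<close>. The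
    extra \<open>\<bar>b\<bar>\<close> covers the variation of \<open>norm h powr (- b)\<close>
    across one shell for either sign of \<open>b\<close>; in the application \<open>b\<close> may be
    negative.\<close>
  define c where "c k = 2 powr (\<bar>b\<bar> + b * real k)" for k
  define r where "r k = 2 powr (- real k)" for k
  show "0 \<le> (2::real) powr (b - ?N)" "(2::real) powr (b - ?N) < 1" "0 \<le> (2::real) powr \<bar>b\<bar>" "0 \<le> c k" "0 \<le> r k" for k
    using b by (auto simp: c_def r_def powr_less_one)
  show "c k * r k ^ DIM('a) = 2 powr \<bar>b\<bar> * (2 powr (b - ?N)) ^ k" for k
    by (simp add: c_def r_def powr_power powr_add[symmetric] algebra_simps)
  fix h :: 'a
  show "\<exists>k. ennreal (norm h powr (- b)) * indicator (cball 0 1) h \<le> ennreal (c k) * indicator (cball 0 (r k)) h"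
  proof (cases "h \<noteq> 0 \<and> norm h \<le> 1")
    case True
    then have "1 \<le> 1 / norm h" by simp
    then obtain L k where L: "1 / norm h = 2 powr L" "real k \<le> L" "L < real k + 1" by (rule floor_log_bounds)
    have n: "norm h = 2 powr (- L)" using L(1) True by (simp add: powr_minus field_simps)
    have "b * L - b * real k \<le> \<bar>b\<bar>"
    proof -
      have "b * (L - real k) \<le> \<bar>b\<bar> * 1" using L by (intro mult_mono) auto
      then show ?thesis by (simp add: algebra_simps)
    qed
    then have "norm h powr (- b) \<le> c k" unfolding n c_def by (simp add: powr_powr mult.commute)
    moreover have "norm h \<le> r k" using L unfolding n r_def by simp
    ultimately show ?thesis by (intro exI[of _ k]) (auto simp: indicator_def intro: ennreal_leI)
  next
    case False
    then show ?thesis by (auto simp: indicator_def)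
  qed
qed

lemma nn_integral_norm_powr_far:
  fixes a :: real
  assumes a: "real DIM('a::euclidean_space) < a"
  shows "(\<integral>\<^sup>+h. ennreal (norm (h::'a) powr (- a)) * indicator (- cball 0 1) h \<partial>lborel) < \<infinity>"
proof (rule nn_integral_shells_finite)
  let ?N = "real DIM('a)"
  \<comment> \<open>On the shell \<open>2 powr k \<le> norm h < 2 powr (k + 1)\<close> the integrand
    is bounded by its value at the inner radius, while the covering ball has the outer radius; hence
    the factor \<open>2 powr ?N\<close> in the series.\<close>
  define c where "c k = 2 powr (- a * real k)" for k
  define r where "r k = 2 powr (real k + 1)" for k
  show "0 \<le> (2::real) powr (?N - a)" "(2::real) powr (?N - a) < 1" "0 \<le> (2::real) powr ?N" "0 \<le> c k" "0 \<le> r k" for k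
    using a by (auto simp: c_def r_def powr_less_one)
  show "c k * r k ^ DIM('a) = 2 powr ?N * (2 powr (?N - a)) ^ k" for k
    by (simp add: c_def r_def powr_power powr_add[symmetric] algebra_simps)
  fix h :: 'a
  show "\<exists>k. ennreal (norm h powr (- a)) * indicator (- cball 0 1) h \<le> ennreal (c k) * indicator (cball 0 (r k)) h"
  proof (cases "1 < norm h")
    case True
    then have "1 \<le> norm h" by simp
    then obtain L k where L: "norm h = 2 powr L" "real k \<le> L" "L < real k + 1" by (rule floor_log_bounds)
    have "0 < a" using a by (smt (verit) of_nat_0_le_iff)
    then have "norm h powr (- a) \<le> c k" using L unfolding c_def by (simp add: powr_powr mult.commute mult_left_mono)
    moreover have "norm h \<le> r k" using L unfolding r_def by simp
    ultimately show ?thesis by (intro exI[of _ k]) (auto simp: indicator_def intro: ennreal_leI)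
  next
    case False
    then show ?thesis by (auto simp: indicator_def)
  qed
qed

text \<open>Jensen's inequality for the derivative of \<open>\<phi>\<close> along the segment from
  \<open>y\<close> to \<open>y + h\<close>, followed by Cauchy-Schwarz.\<close>

lemma test_function_increment_le:
  fixes \<phi> :: "'a::euclidean_space \<Rightarrow> real"
  assumes p: "1 < p" and sm: "smooth \<phi>"
  shows "ennreal (\<bar>\<phi> (y + h) - \<phi> y\<bar> powr p) \<le>
    (\<integral>\<^sup>+s. ennreal (norm h powr p * norm (grad \<phi> (y + s *\<^sub>R h)) powr p) * indicator {0..1} s \<partial>lborel)"
proof -
  define f where "f s = grad \<phi> (y + s *\<^sub>R h) \<bullet> h" for s
  define m where "m = \<phi> (y + h) - \<phi> y"
  define c where "c = p * \<bar>m\<bar> powr (p - 2)"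
  have "continuous_on {0..1} (\<lambda>s::real. y + s *\<^sub>R h)" by (intro continuous_intros)
  then have "continuous_on {0..1} (\<lambda>s. grad \<phi> (y + s *\<^sub>R h))"
    by (rule continuous_on_compose2[OF continuous_on_grad[OF sm]]) simp
  then have cf: "continuous_on {0..1} f"
    unfolding f_def[abs_def] by (intro continuous_on_inner continuous_on_const)
  have fi: "integrable lborel (\<lambda>s. indicator {0..1} s *\<^sub>R f s)"
    by (rule borel_integrable_compact[OF compact_Icc cf])
  have "continuous_on {0..1} (\<lambda>s. \<bar>f s\<bar> powr p)"
    using cf p by (intro continuous_on_powr' continuous_intros) auto
  then have fpi: "integrable lborel (\<lambda>s. indicator {0..1} s *\<^sub>R (\<bar>f s\<bar> powr p))"
    by (rule borel_integrable_compact[OF compact_Icc])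
  have int1: "integrable lborel (indicator {0..1::real} :: real \<Rightarrow> real)" by simp
  have "(\<integral>s. indicator {0..1} s *\<^sub>R f s \<partial>lborel) = m"
  proof -
    have "(\<integral>s. indicator {0..1} s *\<^sub>R f s \<partial>lborel) = \<phi> (y + 1 *\<^sub>R h) - \<phi> (y + 0 *\<^sub>R h)"
    proof (rule integral_FTC_Icc[OF _ _ cf])
      fix s :: real assume "0 \<le> s" "s \<le> 1"
      have "((\<lambda>s. \<phi> (y + s *\<^sub>R h)) has_real_derivative f s) (at s)"
        using smooth_has_real_derivative_line[OF sm, of y h s] by (simp add: f_def frechet_derivative_grad[OF sm])
      then show "((\<lambda>s. \<phi> (y + s *\<^sub>R h)) has_vector_derivative f s) (at s within {0..1})"
        unfolding has_real_derivative_iff_has_vector_derivative by (rule has_vector_derivative_at_within)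
    qed simp
    then show ?thesis by (simp add: m_def)
  qed
  note fm = this
  \<comment> \<open>The tangent inequality at \<open>m\<close>, integrated over
    \<open>{0..1}\<close>: the linear term has integral zero because \<open>m\<close> is the mean of
    \<open>f\<close>.\<close>
  have "\<bar>m\<bar> powr p = (\<integral>s. \<bar>m\<bar> powr p * indicator {0..1} s + (c * m) * (indicator {0..1} s *\<^sub>R f s - m * indicator {0..1} s) \<partial>lborel)"
    using fi int1 fm by simp
  also have "\<dots> \<le> (\<integral>s. indicator {0..1} s *\<^sub>R (\<bar>f s\<bar> powr p) \<partial>lborel)"
  proof (rule integral_mono)
    fix s :: real
    show "\<bar>m\<bar> powr p * indicator {0..1} s + (c * m) * (indicator {0..1} s *\<^sub>R f s - m * indicator {0..1} s) \<le> indicator {0..1} s *\<^sub>R (\<bar>f s\<bar> powr p)"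
      using norm_powr_tangent[OF p, of m "f s"] by (cases "s \<in> {0..1}") (auto simp: c_def mult_ac)
  qed (use fi int1 fpi in auto)
  finally have "ennreal (\<bar>m\<bar> powr p) \<le> ennreal (\<integral>s. indicator {0..1} s *\<^sub>R (\<bar>f s\<bar> powr p) \<partial>lborel)"
    by (rule ennreal_leI)
  also have "\<dots> = (\<integral>\<^sup>+s. ennreal (indicator {0..1} s *\<^sub>R (\<bar>f s\<bar> powr p)) \<partial>lborel)"
    by (rule nn_integral_eq_integral[OF fpi, symmetric]) auto
  also have "\<dots> \<le> (\<integral>\<^sup>+s. ennreal (norm h powr p * norm (grad \<phi> (y + s *\<^sub>R h)) powr p) * indicator {0..1} s \<partial>lborel)"
  proof (rule nn_integral_mono)
    fix s :: real
    have "\<bar>f s\<bar> \<le> norm (grad \<phi> (y + s *\<^sub>R h)) * norm h"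
      unfolding f_def by (rule Cauchy_Schwarz_ineq2)
    then have "\<bar>f s\<bar> powr p \<le> (norm (grad \<phi> (y + s *\<^sub>R h)) * norm h) powr p"
      using p by (intro powr_mono2) auto
    then show "ennreal (indicator {0..1} s *\<^sub>R (\<bar>f s\<bar> powr p)) \<le>
       ennreal (norm h powr p * norm (grad \<phi> (y + s *\<^sub>R h)) powr p) * indicator {0..1} s"
      by (cases "s \<in> {0..1}") (auto simp: powr_mult mult.commute intro: ennreal_leI)
  qed
  finally show ?thesis by (simp add: m_def)
qed

text \<open>The increment bound is integrated in \<open>y\<close>; after exchanging the integrals,
  the shift by \<open>s *\<^sub>R h\<close> disappears by translation invariance, for every
  \<open>s\<close> alike.\<close>

lemma nn_integral_translation_difference_le:
  fixes \<phi> :: "'a::euclidean_space \<Rightarrow> real"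
  assumes p: "1 < p" and sm: "smooth \<phi>"
  shows "(\<integral>\<^sup>+y. ennreal (\<bar>\<phi> (y + h) - \<phi> y\<bar> powr p) \<partial>lborel) \<le>
     ennreal (norm h powr p) * (\<integral>\<^sup>+y. ennreal (norm (grad \<phi> y) powr p) \<partial>lborel)"
proof -
  have [measurable]: "grad \<phi> \<in> borel_measurable borel" by (rule borel_measurable_grad[OF sm])
  have m: "(\<lambda>(y, s). ennreal (norm h powr p * norm (grad \<phi> (y + s *\<^sub>R h)) powr p) * indicator {0..1} s) \<in> borel_measurable (lborel \<Otimes>\<^sub>M lborel)"
    by measurable
  have "(\<integral>\<^sup>+y. ennreal (\<bar>\<phi> (y + h) - \<phi> y\<bar> powr p) \<partial>lborel) \<le>
     (\<integral>\<^sup>+y. (\<integral>\<^sup>+s. ennreal (norm h powr p * norm (grad \<phi> (y + s *\<^sub>R h)) powr p) * indicator {0..1} s \<partial>lborel) \<partial>lborel)"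
    by (rule nn_integral_mono) (rule test_function_increment_le[OF p sm])
  also have "\<dots> = (\<integral>\<^sup>+s. (\<integral>\<^sup>+y. ennreal (norm h powr p * norm (grad \<phi> (y + s *\<^sub>R h)) powr p) * indicator {0..1} s \<partial>lborel) \<partial>lborel)"
    using lborel_pair.Fubini[OF m] by simp
  also have "\<dots> = (\<integral>\<^sup>+s. ennreal (norm h powr p) * (\<integral>\<^sup>+y. ennreal (norm (grad \<phi> y) powr p) \<partial>lborel) * indicator {0..1} (s::real) \<partial>lborel)"
  proof (rule nn_integral_cong)
    fix s :: real
    have "(\<integral>\<^sup>+y. ennreal (norm h powr p * norm (grad \<phi> (y + s *\<^sub>R h)) powr p) * indicator {0..1} s \<partial>lborel)
      = (\<integral>\<^sup>+y. ennreal (norm h powr p) * (ennreal (norm (grad \<phi> (y + s *\<^sub>R h)) powr p)) * indicator {0..1} s \<partial>lborel)"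
      by (simp add: ennreal_mult)
    also have "\<dots> = ennreal (norm h powr p) * (\<integral>\<^sup>+y. ennreal (norm (grad \<phi> (y + s *\<^sub>R h)) powr p) \<partial>lborel) * indicator {0..1} s"
      by (simp add: nn_integral_multc nn_integral_cmult)
    also have "(\<integral>\<^sup>+y. ennreal (norm (grad \<phi> (y + s *\<^sub>R h)) powr p) \<partial>lborel) = (\<integral>\<^sup>+y. ennreal (norm (grad \<phi> y) powr p) \<partial>lborel)"
      by (rule nn_integral_lborel_translate[of "\<lambda>y. ennreal (norm (grad \<phi> y) powr p)"]) measurable
    finally show "(\<integral>\<^sup>+y. ennreal (norm h powr p * norm (grad \<phi> (y + s *\<^sub>R h)) powr p) * indicator {0..1} s \<partial>lborel)
      = ennreal (norm h powr p) * (\<integral>\<^sup>+y. ennreal (norm (grad \<phi> y) powr p) \<partial>lborel) * indicator {0..1} s" .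
  qed
  also have "\<dots> = ennreal (norm h powr p) * (\<integral>\<^sup>+y. ennreal (norm (grad \<phi> y) powr p) \<partial>lborel)"
    by (simp add: nn_integral_cmult_indicator)
  finally show ?thesis .
qed

text \<open>For use with \<open>norm h > 1\<close>, where the gradient bound grows too fast to be
  integrated against the kernel.\<close>

lemma nn_integral_translation_difference_le2:
  fixes \<phi> :: "'a::euclidean_space \<Rightarrow> real"
  assumes p: "1 < p" and [measurable]: "\<phi> \<in> borel_measurable borel"
  shows "(\<integral>\<^sup>+y. ennreal (\<bar>\<phi> (y + h) - \<phi> y\<bar> powr p) \<partial>lborel) \<le>
     ennreal (2 * 2 powr p) * (\<integral>\<^sup>+y. ennreal (\<bar>\<phi> y\<bar> powr p) \<partial>lborel)"
proof -
  have "(\<integral>\<^sup>+y. ennreal (\<bar>\<phi> (y + h) - \<phi> y\<bar> powr p) \<partial>lborel) \<le>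
    (\<integral>\<^sup>+y. ennreal (2 powr p) * (ennreal (\<bar>\<phi> (y + h)\<bar> powr p) + ennreal (\<bar>\<phi> y\<bar> powr p)) \<partial>lborel)"
  proof (rule nn_integral_mono)
    fix y
    show "ennreal (\<bar>\<phi> (y + h) - \<phi> y\<bar> powr p) \<le> ennreal (2 powr p) * (ennreal (\<bar>\<phi> (y + h)\<bar> powr p) + ennreal (\<bar>\<phi> y\<bar> powr p))"
    proof -
      have "\<bar>\<phi> (y + h) - \<phi> y\<bar> powr p \<le> 2 powr p * (\<bar>\<phi> (y + h)\<bar> powr p + \<bar>\<phi> y\<bar> powr p)"
        using norm_powr_add_le2[OF p, of "\<phi> (y + h)" "- \<phi> y"] by simp
      then have "ennreal (\<bar>\<phi> (y + h) - \<phi> y\<bar> powr p) \<le> ennreal (2 powr p * (\<bar>\<phi> (y + h)\<bar> powr p + \<bar>\<phi> y\<bar> powr p))"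
        by (rule ennreal_leI)
      then show ?thesis by (simp add: ennreal_mult)
    qed
  qed
  also have "\<dots> = ennreal (2 powr p) * ((\<integral>\<^sup>+y. ennreal (\<bar>\<phi> (y + h)\<bar> powr p) \<partial>lborel) + (\<integral>\<^sup>+y. ennreal (\<bar>\<phi> y\<bar> powr p) \<partial>lborel))"
    by (simp add: nn_integral_cmult nn_integral_add)
  also have "(\<integral>\<^sup>+y. ennreal (\<bar>\<phi> (y + h)\<bar> powr p) \<partial>lborel) = (\<integral>\<^sup>+y. ennreal (\<bar>\<phi> y\<bar> powr p) \<partial>lborel)"
    by (rule nn_integral_lborel_translate[of "\<lambda>y. ennreal (\<bar>\<phi> y\<bar> powr p)"]) measurable
  also have "ennreal (2 powr p) * ((\<integral>\<^sup>+y. ennreal (\<bar>\<phi> y\<bar> powr p) \<partial>lborel) + (\<integral>\<^sup>+y. ennreal (\<bar>\<phi> y\<bar> powr p) \<partial>lborel))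
    = ennreal (2 * 2 powr p) * (\<integral>\<^sup>+y. ennreal (\<bar>\<phi> y\<bar> powr p) \<partial>lborel)"
    unfolding mult_2[symmetric] by (simp add: ennreal_mult mult.assoc mult.left_commute)
  finally show ?thesis .
qed

subsection \<open>The Gagliardo seminorm of test functions\<close>

definition gdiff :: "('a \<Rightarrow> real) \<Rightarrow> 'a \<times> 'a \<Rightarrow> real" where
  "gdiff w z = w (fst z) - w (snd z)"

text \<open>The kernel becomes the density of a measure on pairs of points, so that the Gagliardo
  seminorm is the \<open>Lp\<close> norm of \<open>gdiff w\<close> and the general lemmas apply to
  it.\<close>

definition gmeasure :: "real \<Rightarrow> real \<Rightarrow> ('a::euclidean_space \<times> 'a) measure" where
  "gmeasure p t = density (lborel \<Otimes>\<^sub>M lborel)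
     (\<lambda>z. ennreal (1 / norm (fst z - snd z) powr (real DIM('a) + t * p)))"

lemma borel_measurable_gmeasure:
  "borel_measurable (gmeasure p t :: ('a::euclidean_space \<times> 'a) measure) = borel_measurable (lborel \<Otimes>\<^sub>M lborel)"
  unfolding gmeasure_def by (rule measurable_cong_sets) simp_all

lemma gdiff_borel_measurable:
  fixes w :: "'a::euclidean_space \<Rightarrow> real"
  assumes [measurable]: "w \<in> borel_measurable borel"
  shows "gdiff w \<in> borel_measurable (lborel \<Otimes>\<^sub>M lborel)"
  unfolding gdiff_def[abs_def] by measurable

lemma gagliardo_pow_eq_Lp_pow:
  fixes w :: "'a::euclidean_space \<Rightarrow> real"
  assumes [measurable]: "w \<in> borel_measurable borel"
  shows "gagliardo_pow p t w = Lp_pow (gmeasure p t) p (gdiff w)"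
  unfolding gagliardo_pow_def Lp_pow_def gmeasure_def gdiff_def
  by (subst integral_density) (auto simp: divide_inverse mult.commute)

lemma form_nonlocal_eq_pairing:
  fixes w \<psi> :: "'a::euclidean_space \<Rightarrow> real"
  assumes [measurable]: "w \<in> borel_measurable borel" "\<psi> \<in> borel_measurable borel"
  shows "form_nonlocal t p w \<psi> = pairing (gmeasure p t) p (gdiff w) (gdiff \<psi>)"
  unfolding form_nonlocal_def pairing_def gmeasure_def gdiff_def
  by (subst integral_density) (auto simp: divide_inverse mult_ac)

lemma AE_lborel_pair:
  assumes "AE x in lborel. P (x::'a::euclidean_space)"
  shows "AE z in (lborel \<Otimes>\<^sub>M lborel). P (fst z) \<and> P (snd z)"
proof -
  obtain N where N: "{x. \<not> P x} \<subseteq> N" "emeasure lborel N = 0" "N \<in> sets borel"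
    using AE_E[OF assms] by auto
  have "emeasure (lborel \<Otimes>\<^sub>M lborel) (N \<times> (UNIV::'a set)) = 0"
    "emeasure (lborel \<Otimes>\<^sub>M lborel) ((UNIV::'a set) \<times> N) = 0"
    using N by (simp_all add: lborel.emeasure_pair_measure_Times)
  then have "N \<times> (UNIV::'a set) \<union> UNIV \<times> N \<in> null_sets (lborel \<Otimes>\<^sub>M lborel)"
    using N(3) by (intro null_sets.Un null_setsI pair_measureI) auto
  then show ?thesis
    by (rule AE_I') (use N(1) in auto)
qed

lemma AE_gmeasure:
  assumes "AE x in lborel. P (x::'a::euclidean_space)"
  shows "AE z in gmeasure p t. P (fst z) \<and> P (snd z)"
  unfolding gmeasure_def by (subst AE_density) (use AE_lborel_pair[OF assms] in auto)

text \<open>The diagonal, where the kernel takes the junk value \<open>1 / 0 = 0\<close>, needs a separate hypothesis.\<close>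

lemma AE_gmeasureD:
  assumes "AE z in (gmeasure p t :: ('a::euclidean_space \<times> 'a) measure). Q z" and "\<And>x. Q (x, x)"
  shows "AE z in (lborel \<Otimes>\<^sub>M lborel). Q z"
proof -
  have "AE z in (lborel \<Otimes>\<^sub>M lborel). 0 < ennreal (1 / norm (fst z - snd z) powr (real DIM('a) + t * p)) \<longrightarrow> Q z"
    using assms(1) unfolding gmeasure_def by (subst (asm) AE_density) auto
  then show ?thesis
  proof (rule AE_mp, intro AE_I2 impI)
    fix z :: "'a \<times> 'a"
    assume "0 < ennreal (1 / norm (fst z - snd z) powr (real DIM('a) + t * p)) \<longrightarrow> Q z"
    then show "Q z" using assms(2)[of "fst z"] by (cases z) (auto simp: ennreal_zero_less_divide)
  qed
qed

text \<open>Substituting \<open>x = y + h\<close> turns the seminorm into an integral over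
  increments \<open>h\<close>, split at \<open>norm h = 1\<close>: the gradient estimate gains
  \<open>norm h powr p\<close> near 0, the crude estimate serves at infinity.\<close>

lemma gagliardo_kernel_bound:
  fixes \<phi> :: "'a::euclidean_space \<Rightarrow> real"
  assumes p: "1 < p" and sm: "smooth \<phi>"
  shows "(\<integral>\<^sup>+z. ennreal (\<bar>gdiff \<phi> z\<bar> powr p) \<partial>gmeasure p t) \<le>
    (\<integral>\<^sup>+h. ennreal (norm (h::'a) powr (- (real DIM('a) + t * p - p))) * indicator (cball 0 1) h \<partial>lborel)
       * (\<integral>\<^sup>+y. ennreal (norm (grad \<phi> y) powr p) \<partial>lborel)
    + (\<integral>\<^sup>+h. ennreal (norm (h::'a) powr (- (real DIM('a) + t * p))) * indicator (- cball 0 1) h \<partial>lborel)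
       * (ennreal (2 * 2 powr p) * (\<integral>\<^sup>+y. ennreal (\<bar>\<phi> y\<bar> powr p) \<partial>lborel))"
    (is "_ \<le> ?near * ?G + ?far * ?A")
proof -
  have [measurable]: "\<phi> \<in> borel_measurable borel" by (rule smooth_borel_measurable[OF sm])
  let ?a = "real DIM('a) + t * p"
  define k where "k h = ennreal (norm (h::'a) powr (- ?a))" for h
  have [measurable]: "k \<in> borel_measurable borel" unfolding k_def[abs_def] by measurable
  have k: "ennreal (1 / norm h powr ?a) = k h" for h
    unfolding k_def powr_minus divide_inverse by simp
  have "(\<integral>\<^sup>+z. ennreal (\<bar>gdiff \<phi> z\<bar> powr p) \<partial>gmeasure p t) =
     (\<integral>\<^sup>+z. k (fst z - snd z) * ennreal (\<bar>\<phi> (fst z) - \<phi> (snd z)\<bar> powr p) \<partial>(lborel \<Otimes>\<^sub>M lborel))"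
    unfolding gmeasure_def gdiff_def k by (subst nn_integral_density) auto
  also have "\<dots> = (\<integral>\<^sup>+y. (\<integral>\<^sup>+x. k (x - y) * ennreal (\<bar>\<phi> x - \<phi> y\<bar> powr p) \<partial>lborel) \<partial>lborel)"
    by (subst lborel_pair.nn_integral_snd[symmetric]) auto
  also have "\<dots> = (\<integral>\<^sup>+y. (\<integral>\<^sup>+h. k h * ennreal (\<bar>\<phi> (y + h) - \<phi> y\<bar> powr p) \<partial>lborel) \<partial>lborel)"
  proof (rule nn_integral_cong)
    fix y
    show "(\<integral>\<^sup>+x. k (x - y) * ennreal (\<bar>\<phi> x - \<phi> y\<bar> powr p) \<partial>lborel) =
        (\<integral>\<^sup>+h. k h * ennreal (\<bar>\<phi> (y + h) - \<phi> y\<bar> powr p) \<partial>lborel)"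
      using nn_integral_lborel_translate[of "\<lambda>x. k (x - y) * ennreal (\<bar>\<phi> x - \<phi> y\<bar> powr p)" y]
      by (simp add: add.commute)
  qed
  also have "\<dots> = (\<integral>\<^sup>+h. (\<integral>\<^sup>+y. k h * ennreal (\<bar>\<phi> (y + h) - \<phi> y\<bar> powr p) \<partial>lborel) \<partial>lborel)"
    by (rule lborel_pair.Fubini'[symmetric]) measurable
  also have "\<dots> = (\<integral>\<^sup>+h. k h * (\<integral>\<^sup>+y. ennreal (\<bar>\<phi> (y + h) - \<phi> y\<bar> powr p) \<partial>lborel) \<partial>lborel)"
    by (simp add: nn_integral_cmult)
  also have "\<dots> \<le> (\<integral>\<^sup>+h. (ennreal (norm (h::'a) powr (- (?a - p))) * indicator (cball 0 1) h) * ?G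
      + (k h * indicator (- cball 0 1) h) * ?A \<partial>lborel)"
  proof (rule nn_integral_mono)
    fix h :: 'a
    show "k h * (\<integral>\<^sup>+y. ennreal (\<bar>\<phi> (y + h) - \<phi> y\<bar> powr p) \<partial>lborel) \<le>
      (ennreal (norm (h::'a) powr (- (?a - p))) * indicator (cball 0 1) h) * ?G + (k h * indicator (- cball 0 1) h) * ?A"
    proof (cases "norm h \<le> 1")
      case True
      have "k h * ennreal (norm h powr p) = ennreal (norm h powr (- (?a - p)))"
        unfolding k_def by (simp add: ennreal_mult[symmetric] powr_add[symmetric] algebra_simps)
      moreover have "k h * (\<integral>\<^sup>+y. ennreal (\<bar>\<phi> (y + h) - \<phi> y\<bar> powr p) \<partial>lborel) \<le> k h * (ennreal (norm h powr p) * ?G)"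
        by (intro mult_left_mono nn_integral_translation_difference_le[OF p sm]) simp
      ultimately show ?thesis using True by (simp add: mult.assoc[symmetric])
    next
      case False
      have "k h * (\<integral>\<^sup>+y. ennreal (\<bar>\<phi> (y + h) - \<phi> y\<bar> powr p) \<partial>lborel) \<le> k h * ?A"
        by (intro mult_left_mono nn_integral_translation_difference_le2[OF p]) simp_all
      then show ?thesis using False by simp
    qed
  qed
  also have "\<dots> = ?near * ?G + ?far * ?A"
  proof -
    define f1 where "f1 h = ennreal (norm (h::'a) powr (- (?a - p))) * indicator (cball 0 1) h" for h
    define f2 where "f2 h = k h * indicator (- cball 0 1) h" for h
    have "(\<lambda>h. norm (h::'a) powr (- (?a - p))) \<in> borel_measurable borel" by measurable
    then have [measurable]: "f1 \<in> borel_measurable borel" "f2 \<in> borel_measurable borel"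
      unfolding f1_def[abs_def] f2_def[abs_def]
      by (auto intro!: borel_measurable_times_ennreal borel_measurable_indicator)
    have "(\<integral>\<^sup>+h. f1 h * ?G + f2 h * ?A \<partial>lborel) = (\<integral>\<^sup>+h. f1 h \<partial>lborel) * ?G + (\<integral>\<^sup>+h. f2 h \<partial>lborel) * ?A"
      by (simp add: nn_integral_add nn_integral_multc)
    then show ?thesis unfolding f1_def f2_def k_def .
  qed
  finally show ?thesis .
qed

lemma Lp_test_function:
  assumes t: "test_function \<Omega> \<phi>" and p: "1 < p"
  shows "Lp lborel p \<phi>" "Lp lborel p (grad \<phi>)"
proof -
  note sm = test_function_smooth[OF t]
  let ?K = "closure {x. \<phi> x \<noteq> 0}"
  have K: "compact ?K" using t unfolding test_function_def by auto
  have z: "\<phi> x = 0" if "x \<notin> ?K" for x using that closure_subset[of "{x. \<phi> x \<noteq> 0}"] by auto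
  have z2: "grad \<phi> x = 0" if "x \<notin> ?K" for x
    unfolding grad_def frechet_derivative_zero_outside_support[OF that] scaleR_zero_left sum.neutral_const by (rule refl)
  have "integrable lborel (\<lambda>x. norm (\<phi> x) powr p)"
  proof (rule integrable_compact_support[OF _ K])
    show "continuous_on UNIV (\<lambda>x. norm (\<phi> x) powr p)"
      by (rule continuous_on_powr'[OF continuous_on_norm[OF smooth_continuous_on[OF sm]] continuous_on_const])
        (use p in auto)
    fix x assume "x \<notin> ?K"
    then have "\<phi> x = 0" by (rule z)
    then show "norm (\<phi> x) powr p = 0" by simp
  qed
  then show "Lp lborel p \<phi>" unfolding Lp_def using smooth_borel_measurable[OF sm] by simp
  have "integrable lborel (\<lambda>x. norm (grad \<phi> x) powr p)"
  proof (rule integrable_compact_support[OF _ K])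
    show "continuous_on UNIV (\<lambda>x. norm (grad \<phi> x) powr p)"
      by (rule continuous_on_powr'[OF continuous_on_norm[OF continuous_on_grad[OF sm]] continuous_on_const])
        (use p in auto)
    fix x assume "x \<notin> ?K"
    then have "grad \<phi> x = 0" by (rule z2)
    then show "norm (grad \<phi> x) powr p = 0" by simp
  qed
  then show "Lp lborel p (grad \<phi>)" unfolding Lp_def using borel_measurable_grad[OF sm] by simp
qed

text \<open>The inner kernel integral converges because \<open>t < 1\<close>, the outer one because
  \<open>t > 0\<close>. The constant depends on neither \<Omega> nor \<phi>, which lets the bound
  survive limits.\<close>

lemma gagliardo_test_function:
  assumes p: "1 < p" and t: "0 < t" "t < 1"
  obtains C where "0 \<le> C"
    "\<And>\<Omega> (\<phi> :: 'a::euclidean_space \<Rightarrow> real). test_function \<Omega> \<phi> \<Longrightarrow>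
       (\<integral>\<^sup>+z. ennreal (\<bar>gdiff \<phi> z\<bar> powr p) \<partial>gmeasure p t) \<le> ennreal (C * (Lp_pow lborel p \<phi> + Lp_pow lborel p (grad \<phi>)))"
proof -
  let ?a = "real DIM('a) + t * p"
  let ?near = "\<integral>\<^sup>+h. ennreal (norm (h::'a) powr (- (?a - p))) * indicator (cball 0 1) h \<partial>lborel"
  let ?far = "\<integral>\<^sup>+h. ennreal (norm (h::'a) powr (- ?a)) * indicator (- cball 0 1) h \<partial>lborel"
  have "t * p < 1 * p" using t p by (intro mult_strict_right_mono) auto
  then have "?near < \<infinity>" by (intro nn_integral_norm_powr_near) simp
  then obtain c1 where c1: "0 \<le> c1" "?near = ennreal c1"
    by (cases ?near) (auto simp: top_unique less_top[symmetric])
  have "?far < \<infinity>" using t p by (intro nn_integral_norm_powr_far) simp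
  then obtain c2 where c2: "0 \<le> c2" "?far = ennreal c2"
    by (cases ?far) (auto simp: top_unique less_top[symmetric])
  let ?C = "c1 + c2 * (2 * 2 powr p)"
  show thesis
  proof (rule that[of ?C])
    show "0 \<le> ?C" using c1 c2 by simp
    fix \<Omega> and \<phi> :: "'a \<Rightarrow> real" assume tf: "test_function \<Omega> \<phi>"
    have A: "(\<integral>\<^sup>+y. ennreal (\<bar>\<phi> y\<bar> powr p) \<partial>lborel) = ennreal (Lp_pow lborel p \<phi>)"
      "(\<integral>\<^sup>+y. ennreal (norm (grad \<phi> y) powr p) \<partial>lborel) = ennreal (Lp_pow lborel p (grad \<phi>))"
      using Lp_pow_nn_integral[OF Lp_test_function(1)[OF tf p]] Lp_pow_nn_integral[OF Lp_test_function(2)[OF tf p]] by simp_all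
    note n = Lp_pow_nonneg[of lborel p \<phi>] Lp_pow_nonneg[of lborel p "grad \<phi>"]
    have "(\<integral>\<^sup>+z. ennreal (\<bar>gdiff \<phi> z\<bar> powr p) \<partial>gmeasure p t) \<le>
        ennreal (c1 * Lp_pow lborel p (grad \<phi>) + c2 * (2 * 2 powr p * Lp_pow lborel p \<phi>))"
      using gagliardo_kernel_bound[OF p test_function_smooth[OF tf], of t] c1(1) c2(1) n
      unfolding A c1(2) c2(2) by (simp add: ennreal_mult)
    also have "\<dots> \<le> ennreal (?C * (Lp_pow lborel p \<phi> + Lp_pow lborel p (grad \<phi>)))"
      using c1(1) c2(1) n by (intro ennreal_leI) (simp add: algebra_simps)
    finally show "(\<integral>\<^sup>+z. ennreal (\<bar>gdiff \<phi> z\<bar> powr p) \<partial>gmeasure p t) \<le> ennreal (?C * (Lp_pow lborel p \<phi> + Lp_pow lborel p (grad \<phi>)))" .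
  qed
qed

subsection \<open>Sobolev functions with zero boundary values\<close>

lemma LIMSEQ_0_dominated:
  fixes f g :: "nat \<Rightarrow> real"
  assumes "g \<longlonglongrightarrow> 0" "\<And>n. 0 \<le> f n" "\<And>n. f n \<le> g n"
  shows "f \<longlonglongrightarrow> 0"
  by (rule tendsto_sandwich[OF always_eventually always_eventually tendsto_const assms(1)])
    (simp_all add: assms)

text \<open>A measure in its own right rather than a set integral, so that the \<open>Lp\<close>
  lemmas can be instantiated with it.\<close>

abbreviation lborel_on :: "'a::euclidean_space set \<Rightarrow> 'a measure" where
  "lborel_on \<Omega> \<equiv> restrict_space lborel \<Omega>"

lemma set_integral_lborel_on:
  fixes f :: "'a::euclidean_space \<Rightarrow> 'b::{banach, second_countable_topology}"
  shows "open \<Omega> \<Longrightarrow> (LINT x:\<Omega>|lborel. f x) = (LINT x|lborel_on \<Omega>. f x)"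
  unfolding set_lebesgue_integral_def by (subst integral_restrict_space) auto

lemma set_integrable_lborel_on:
  fixes f :: "'a::euclidean_space \<Rightarrow> 'b::{banach, second_countable_topology}"
  shows "open \<Omega> \<Longrightarrow> set_integrable lborel \<Omega> f \<longleftrightarrow> integrable (lborel_on \<Omega>) f"
  unfolding set_integrable_def by (subst integrable_restrict_space) auto

lemma AE_lborel_on:
  "open \<Omega> \<Longrightarrow> (AE x in lborel_on \<Omega>. P x) \<longleftrightarrow> (AE x in lborel. x \<in> \<Omega> \<longrightarrow> P x)"
  by (subst AE_restrict_space_iff) auto

lemma borel_measurable_lborel_on:
  "f \<in> borel_measurable borel \<Longrightarrow> f \<in> borel_measurable (lborel_on \<Omega>)"
  by (rule measurable_restrict_space1) simp

lemma Lp_pow_cong_AE: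
  fixes f g :: "'x \<Rightarrow> 'b::euclidean_space"
  assumes "f \<in> borel_measurable M" "g \<in> borel_measurable M" "AE x in M. f x = g x"
  shows "Lp_pow M p f = Lp_pow M p g"
  unfolding Lp_pow_def
  by (rule integral_cong_AE) (use assms in \<open>auto elim: eventually_mono\<close>)

lemma Lp_pow_lborel_on:
  fixes f :: "'a::euclidean_space \<Rightarrow> 'b::euclidean_space"
  assumes "open \<Omega>" "\<And>x. x \<notin> \<Omega> \<Longrightarrow> f x = 0"
  shows "Lp_pow (lborel_on \<Omega>) p f = Lp_pow lborel p f"
proof -
  have "indicator \<Omega> x *\<^sub>R (norm (f x) powr p) = norm (f x) powr p" for x
    using assms(2)[of x] by (cases "x \<in> \<Omega>") auto
  then show ?thesis unfolding Lp_pow_def set_integral_lborel_on[OF assms(1), symmetric] set_lebesgue_integral_def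
    by (simp only:)
qed

lemma Lp_lborel_on:
  fixes f :: "'a::euclidean_space \<Rightarrow> 'b::euclidean_space"
  assumes op: "open \<Omega>" and f: "Lp lborel p f"
  shows "Lp (lborel_on \<Omega>) p f"
proof -
  have m: "f \<in> borel_measurable borel" and i: "integrable lborel (\<lambda>x. norm (f x) powr p)"
    using f by (simp_all add: Lp_def)
  have "set_integrable lborel \<Omega> (\<lambda>x. norm (f x) powr p)"
    by (rule set_integrable_lborel[OF i]) (use op in simp)
  then show ?thesis
    using borel_measurable_lborel_on[OF m] by (simp add: Lp_def set_integrable_lborel_on[OF op])
qed

lemma W1p_iff:
  assumes op: "open \<Omega>"
  shows "u \<in> W1p \<Omega> p \<longleftrightarrow> u \<in> borel_measurable borel \<and> Lp (lborel_on \<Omega>) p u \<and>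
    (\<exists>g. weak_gradient \<Omega> u g \<and> Lp (lborel_on \<Omega>) p g)"
proof -
  have "Lp (lborel_on \<Omega>) p f \<longleftrightarrow> set_integrable lborel \<Omega> (\<lambda>x. norm (f x) powr p)"
    if "f \<in> borel_measurable borel" for f :: "'a \<Rightarrow> 'b::euclidean_space"
    using borel_measurable_lborel_on[OF that] unfolding Lp_def set_integrable_lborel_on[OF op] by simp
  note L = this
  have G: "weak_gradient \<Omega> u g \<Longrightarrow> g \<in> borel_measurable borel" for g
    by (simp add: weak_gradient_def)
  have "(\<exists>g. weak_gradient \<Omega> u g \<and> set_integrable lborel \<Omega> (\<lambda>x. norm (g x) powr p)) \<longleftrightarrow>
      (\<exists>g. weak_gradient \<Omega> u g \<and> Lp (lborel_on \<Omega>) p g)"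
    using L[OF G] by metis
  then show ?thesis
    unfolding W1p_def mem_Collect_eq using L[of u] by (simp only: real_norm_def) metis
qed

lemma W1p_Lp:
  assumes "open \<Omega>" "u \<in> W1p \<Omega> p"
  shows "Lp (lborel_on \<Omega>) p u" "Lp (lborel_on \<Omega>) p (wgrad \<Omega> u)"
proof -
  show "Lp (lborel_on \<Omega>) p u" using assms(2) by (simp add: W1p_iff[OF assms(1)])
  show "Lp (lborel_on \<Omega>) p (wgrad \<Omega> u)"
    using wgrad_integrable[OF assms] borel_measurable_lborel_on[OF wgrad_borel_measurable[OF assms(2)]]
    by (simp add: Lp_def set_integrable_lborel_on[OF assms(1)])
qed

text \<open>Convergence to zero is insensitive to the root, and the p-th power has a quasi-triangle
  inequality that holds pointwise under the integral.\<close>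

definition W1p_pow :: "'a::euclidean_space set \<Rightarrow> real \<Rightarrow> ('a \<Rightarrow> real) \<Rightarrow> real" where
  "W1p_pow \<Omega> p u = Lp_pow (lborel_on \<Omega>) p u + Lp_pow (lborel_on \<Omega>) p (wgrad \<Omega> u)"

lemma W1p_pow_nonneg: "0 \<le> W1p_pow \<Omega> p u"
  by (simp add: W1p_pow_def Lp_pow_nonneg)

lemma W1p_norm_tendsto_0_iff:
  assumes op: "open \<Omega>" and p: "1 < p"
  shows "(\<lambda>n. W1p_norm \<Omega> p (f n)) \<longlonglongrightarrow> 0 \<longleftrightarrow> (\<lambda>n. W1p_pow \<Omega> p (f n)) \<longlonglongrightarrow> 0"
proof -
  have e: "W1p_norm \<Omega> p u = W1p_pow \<Omega> p u powr (1 / p)" for u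
    by (simp add: W1p_norm_def W1p_pow_def Lp_pow_def set_integral_lborel_on[OF op])
  have e2: "W1p_pow \<Omega> p u = W1p_norm \<Omega> p u powr p" for u
    using p W1p_pow_nonneg[of \<Omega> p u] by (simp add: e powr_powr)
  have "(\<lambda>n. g n powr q) \<longlonglongrightarrow> 0" if "g \<longlonglongrightarrow> 0" "\<And>n. 0 \<le> g n" "0 < q" for g :: "nat \<Rightarrow> real" and q
  proof -
    have "(\<lambda>n. g n powr q) \<longlonglongrightarrow> 0 powr q"
      using that by (intro tendsto_powr' tendsto_const) auto
    then show ?thesis by simp
  qed
  note P = this
  show ?thesis
  proof
    assume "(\<lambda>n. W1p_norm \<Omega> p (f n)) \<longlonglongrightarrow> 0"
    then show "(\<lambda>n. W1p_pow \<Omega> p (f n)) \<longlonglongrightarrow> 0"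
      unfolding e2 using p by (intro P) (auto simp: e)
  next
    assume "(\<lambda>n. W1p_pow \<Omega> p (f n)) \<longlonglongrightarrow> 0"
    then show "(\<lambda>n. W1p_norm \<Omega> p (f n)) \<longlonglongrightarrow> 0"
      unfolding e using p by (intro P) (auto simp: W1p_pow_nonneg)
  qed
qed

lemma W1p_lincomb:
  assumes op: "open \<Omega>" and p: "1 < p" and u: "u \<in> W1p \<Omega> p" and w: "w \<in> W1p \<Omega> p"
  shows "(\<lambda>x. c * u x + d * w x) \<in> W1p \<Omega> p"
    and "AE x in lborel_on \<Omega>. wgrad \<Omega> (\<lambda>x. c * u x + d * w x) x = c *\<^sub>R wgrad \<Omega> u x + d *\<^sub>R wgrad \<Omega> w x"
    and "W1p_pow \<Omega> p (\<lambda>x. c * u x + d * w x) \<le> 2 powr p * (\<bar>c\<bar> powr p * W1p_pow \<Omega> p u + \<bar>d\<bar> powr p * W1p_pow \<Omega> p w)"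
proof -
  let ?M = "lborel_on \<Omega>" and ?z = "\<lambda>x. c * u x + d * w x"
  note wg = weak_gradient_lincomb[OF weak_gradient_wgrad[OF u] weak_gradient_wgrad[OF w], of c d]
  note L = W1p_Lp[OF op u] W1p_Lp[OF op w]
  note L1 = Lp_lincomb[OF p L(1) L(3), of c d] and L2 = Lp_lincomb[OF p L(2) L(4), of c d]
  show z: "?z \<in> W1p \<Omega> p"
    unfolding W1p_iff[OF op] using wg L1(1) L2(1)
    by (intro conjI exI[of _ "\<lambda>x. c *\<^sub>R wgrad \<Omega> u x + d *\<^sub>R wgrad \<Omega> w x"]) (simp_all add: weak_gradient_def)
  show ae: "AE x in ?M. wgrad \<Omega> ?z x = c *\<^sub>R wgrad \<Omega> u x + d *\<^sub>R wgrad \<Omega> w x"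
    unfolding AE_lborel_on[OF op] by (rule wgrad_AE_eq[OF op wg])
  have "Lp_pow ?M p (wgrad \<Omega> ?z) = Lp_pow ?M p (\<lambda>x. c *\<^sub>R wgrad \<Omega> u x + d *\<^sub>R wgrad \<Omega> w x)"
    by (rule Lp_pow_cong_AE[OF _ _ ae]) (use L2(1) W1p_Lp(2)[OF op z] in \<open>simp_all add: Lp_def\<close>)
  then show "W1p_pow \<Omega> p ?z \<le> 2 powr p * (\<bar>c\<bar> powr p * W1p_pow \<Omega> p u + \<bar>d\<bar> powr p * W1p_pow \<Omega> p w)"
    using L1(2) L2(2) unfolding W1p_pow_def by (simp add: algebra_simps)
qed

lemma test_function_W1p:
  assumes op: "open \<Omega>" and p: "1 < p" and t: "test_function \<Omega> \<phi>"
  shows "\<phi> \<in> W1p \<Omega> p" "AE x in lborel_on \<Omega>. wgrad \<Omega> \<phi> x = grad \<phi> x"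
proof -
  note wg = weak_gradient_test_function[OF t]
  show "\<phi> \<in> W1p \<Omega> p"
    unfolding W1p_iff[OF op] using wg Lp_lborel_on[OF op Lp_test_function(1)[OF t p]]
      Lp_lborel_on[OF op Lp_test_function(2)[OF t p]]
    by (intro conjI exI[of _ "grad \<phi>"]) (simp_all add: weak_gradient_def)
  show "AE x in lborel_on \<Omega>. wgrad \<Omega> \<phi> x = grad \<phi> x"
    unfolding AE_lborel_on[OF op] by (rule wgrad_AE_eq[OF op wg])
qed

lemma W01p_W1p: "u \<in> W01p \<Omega> p \<Longrightarrow> u \<in> W1p \<Omega> p"
  by (simp add: W01p_def)

lemma W01p_zero_outside: "u \<in> W01p \<Omega> p \<Longrightarrow> x \<notin> \<Omega> \<Longrightarrow> u x = 0"
  by (simp add: W01p_def)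

lemma W01p_borel_measurable: "u \<in> W01p \<Omega> p \<Longrightarrow> u \<in> borel_measurable borel"
  using W01p_W1p W1p_borel_measurable by blast

lemma W01p_iff:
  assumes op: "open \<Omega>" and p: "1 < p"
  shows "u \<in> W01p \<Omega> p \<longleftrightarrow> u \<in> W1p \<Omega> p \<and> (\<forall>x. x \<notin> \<Omega> \<longrightarrow> u x = 0) \<and>
     (\<exists>\<phi>. (\<forall>n. test_function \<Omega> (\<phi> n)) \<and> (\<lambda>n. W1p_pow \<Omega> p (\<lambda>x. \<phi> n x - u x)) \<longlonglongrightarrow> 0)"
  unfolding W01p_def mem_Collect_eq by (simp only: W1p_norm_tendsto_0_iff[OF op p])

lemma W01p_lincomb:
  assumes op: "open \<Omega>" and p: "1 < p" and u: "u \<in> W01p \<Omega> p" and w: "w \<in> W01p \<Omega> p"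
  shows "(\<lambda>x. c * u x + d * w x) \<in> W01p \<Omega> p"
proof -
  obtain \<phi> where \<phi>: "\<And>n. test_function \<Omega> (\<phi> n)" "(\<lambda>n. W1p_pow \<Omega> p (\<lambda>x. \<phi> n x - u x)) \<longlonglongrightarrow> 0"
    using u unfolding W01p_iff[OF op p] by blast
  obtain \<psi> where \<psi>: "\<And>n. test_function \<Omega> (\<psi> n)" "(\<lambda>n. W1p_pow \<Omega> p (\<lambda>x. \<psi> n x - w x)) \<longlonglongrightarrow> 0"
    using w unfolding W01p_iff[OF op p] by blast
  let ?\<theta> = "\<lambda>n x. c * \<phi> n x + d * \<psi> n x"
  note u' = W01p_W1p[OF u] and w' = W01p_W1p[OF w]
  have a: "(\<lambda>x. \<phi> n x - u x) \<in> W1p \<Omega> p" "(\<lambda>x. \<psi> n x - w x) \<in> W1p \<Omega> p" for n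
    using W1p_lincomb(1)[OF op p test_function_W1p(1)[OF op p \<phi>(1)[of n]] u', where c = 1 and d = "-1"]
      W1p_lincomb(1)[OF op p test_function_W1p(1)[OF op p \<psi>(1)[of n]] w', where c = 1 and d = "-1"] by simp_all
  have le: "W1p_pow \<Omega> p (\<lambda>x. ?\<theta> n x - (c * u x + d * w x)) \<le>
      2 powr p * (\<bar>c\<bar> powr p * W1p_pow \<Omega> p (\<lambda>x. \<phi> n x - u x) + \<bar>d\<bar> powr p * W1p_pow \<Omega> p (\<lambda>x. \<psi> n x - w x))" for n
    using W1p_lincomb(3)[OF op p a(1) a(2), of c n d n] by (simp add: algebra_simps)
  have "(\<lambda>n. 2 powr p * (\<bar>c\<bar> powr p * W1p_pow \<Omega> p (\<lambda>x. \<phi> n x - u x) + \<bar>d\<bar> powr p * W1p_pow \<Omega> p (\<lambda>x. \<psi> n x - w x)))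
      \<longlonglongrightarrow> 2 powr p * (\<bar>c\<bar> powr p * 0 + \<bar>d\<bar> powr p * 0)"
    by (intro tendsto_intros \<phi>(2) \<psi>(2))
  then have "(\<lambda>n. 2 powr p * (\<bar>c\<bar> powr p * W1p_pow \<Omega> p (\<lambda>x. \<phi> n x - u x) + \<bar>d\<bar> powr p * W1p_pow \<Omega> p (\<lambda>x. \<psi> n x - w x))) \<longlonglongrightarrow> 0"
    by simp
  then have "(\<lambda>n. W1p_pow \<Omega> p (\<lambda>x. ?\<theta> n x - (c * u x + d * w x))) \<longlonglongrightarrow> 0"
    by (rule LIMSEQ_0_dominated[OF _ W1p_pow_nonneg le])
  moreover have "test_function \<Omega> (?\<theta> n)" for n
    by (intro test_function_add test_function_cmult \<phi> \<psi>)
  ultimately show ?thesis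
    unfolding W01p_iff[OF op p] using W1p_lincomb(1)[OF op p u' w', of c d]
    by (intro conjI allI impI exI[of _ ?\<theta>]) (simp_all add: W01p_zero_outside[OF u] W01p_zero_outside[OF w])
qed

lemma test_function_W01p:
  assumes op: "open \<Omega>" and p: "1 < p" and t: "test_function \<Omega> \<phi>"
  shows "\<phi> \<in> W01p \<Omega> p"
proof -
  \<comment> \<open>Written as a combination with zero coefficients: \<open>wgrad\<close> of the
    zero function is known only almost everywhere, and \<open>W1p_lincomb\<close> already accounts
    for that.\<close>
  have "W1p_pow \<Omega> p (\<lambda>x. 0 * \<phi> x + 0 * \<phi> x) \<le> 0"
    using W1p_lincomb(3)[OF op p test_function_W1p(1)[OF op p t] test_function_W1p(1)[OF op p t], of 0 0] by simp
  then have "W1p_pow \<Omega> p (\<lambda>x. \<phi> x - \<phi> x) = 0"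
    using W1p_pow_nonneg[of \<Omega> p "\<lambda>x. 0"] by simp
  then show ?thesis
    unfolding W01p_iff[OF op p] using test_function_W1p(1)[OF op p t]
    by (intro conjI allI impI exI[of _ "\<lambda>n. \<phi>"]) (simp_all add: t test_function_zero_outside[OF t])
qed

text \<open>The numerator of the quotient splits into one such term per component, so both
  components share all lemmas, with \<open>t\<close> equal to \<open>r\<close> or
  \<open>s\<close>.\<close>

definition energy1 :: "'a::euclidean_space set \<Rightarrow> real \<Rightarrow> real \<Rightarrow> ('a \<Rightarrow> real) \<Rightarrow> real" where
  "energy1 \<Omega> p t w = Lp_pow (lborel_on \<Omega>) p (wgrad \<Omega> w) + Lp_pow (gmeasure p t) p (gdiff w)"

lemma gdiff_lincomb: "gdiff (\<lambda>x. c * u x + d * w x) = (\<lambda>z. c *\<^sub>R gdiff u z + d *\<^sub>R gdiff w z)"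
  by (auto simp: gdiff_def algebra_simps)

text \<open>Convergence of p-th power integrals gives an a.e. convergent subsequence inside
  \<Omega>. Outside, all functions vanish, so the convergence is a.e. in the whole space, as the
  pairs of points in the Gagliardo integral demand.\<close>

lemma W01p_approx_AE:
  assumes op: "open \<Omega>" and p: "1 < p" and u: "u \<in> W01p \<Omega> p"
  obtains \<phi> where "\<And>n. test_function \<Omega> (\<phi> n)" "AE x in lborel. (\<lambda>n. \<phi> n x) \<longlonglongrightarrow> u x"
    "(\<lambda>n. W1p_pow \<Omega> p (\<lambda>x. \<phi> n x - u x)) \<longlonglongrightarrow> 0"
proof -
  obtain \<phi> where \<phi>: "\<And>n. test_function \<Omega> (\<phi> n)" "(\<lambda>n. W1p_pow \<Omega> p (\<lambda>x. \<phi> n x - u x)) \<longlonglongrightarrow> 0"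
    using u unfolding W01p_iff[OF op p] by blast
  let ?M = "lborel_on \<Omega>"
  have L: "Lp ?M p (\<lambda>x. \<phi> n x - u x)" for n
    using W1p_lincomb(1)[OF op p test_function_W1p(1)[OF op p \<phi>(1)[of n]] W01p_W1p[OF u], where c = 1 and d = "-1"]
    by (simp add: W1p_Lp[OF op])
  have "(\<lambda>n. LINT x|?M. norm (norm (\<phi> n x - u x) powr p)) \<longlonglongrightarrow> 0"
  proof (rule LIMSEQ_0_dominated[OF \<phi>(2)])
    show "0 \<le> (LINT x|?M. norm (norm (\<phi> n x - u x) powr p))" for n
      by (rule Bochner_Integration.integral_nonneg) simp
    show "(LINT x|?M. norm (norm (\<phi> n x - u x) powr p)) \<le> W1p_pow \<Omega> p (\<lambda>x. \<phi> n x - u x)" for n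
      using Lp_pow_nonneg[of ?M p "wgrad \<Omega> (\<lambda>x. \<phi> n x - u x)"] by (simp add: W1p_pow_def Lp_pow_def)
  qed
  then obtain q where q: "strict_mono q" "AE x in ?M. (\<lambda>n. norm (\<phi> (q n) x - u x) powr p) \<longlonglongrightarrow> 0"
    using tendsto_L1_AE_subseq[of ?M "\<lambda>n x. norm (\<phi> n x - u x) powr p"] L unfolding Lp_def by blast
  show thesis
  proof (rule that[of "\<lambda>n. \<phi> (q n)"])
    show "test_function \<Omega> (\<phi> (q n))" for n by (rule \<phi>)
    show "(\<lambda>n. W1p_pow \<Omega> p (\<lambda>x. \<phi> (q n) x - u x)) \<longlonglongrightarrow> 0"
      using LIMSEQ_subseq_LIMSEQ[OF \<phi>(2) q(1)] by (simp add: o_def)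
    show "AE x in lborel. (\<lambda>n. \<phi> (q n) x) \<longlonglongrightarrow> u x"
      using q(2) unfolding AE_lborel_on[OF op]
    proof (rule AE_mp, intro AE_I2 impI)
      fix x assume h: "x \<in> \<Omega> \<longrightarrow> (\<lambda>n. norm (\<phi> (q n) x - u x) powr p) \<longlonglongrightarrow> 0"
      show "(\<lambda>n. \<phi> (q n) x) \<longlonglongrightarrow> u x"
      proof (cases "x \<in> \<Omega>")
        case True
        then have "(\<lambda>n. (norm (\<phi> (q n) x - u x) powr p) powr (1 / p)) \<longlonglongrightarrow> 0 powr (1 / p)"
          using h p by (intro tendsto_powr' tendsto_const) auto
        then have "(\<lambda>n. norm (\<phi> (q n) x - u x)) \<longlonglongrightarrow> 0" using p by (simp add: powr_powr)
        then have "(\<lambda>n. \<phi> (q n) x - u x) \<longlonglongrightarrow> 0" by (simp only: tendsto_norm_zero_iff)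
        then show ?thesis by (simp only: LIM_zero_iff)
      next
        case False
        then show ?thesis using test_function_zero_outside[OF \<phi>(1)] W01p_zero_outside[OF u] by simp
      qed
    qed
  qed
qed

lemma Lp_pow_wgrad_limit_le:
  assumes op: "open \<Omega>" and p: "1 < p" and u: "u \<in> W1p \<Omega> p" and \<phi>: "\<And>n. \<phi> n \<in> W1p \<Omega> p"
    and l: "(\<lambda>n. W1p_pow \<Omega> p (\<lambda>x. \<phi> n x - u x)) \<longlonglongrightarrow> 0" and e: "0 < e"
  shows "\<forall>\<^sub>F n in sequentially. Lp_pow (lborel_on \<Omega>) p (wgrad \<Omega> (\<phi> n)) < Lp_pow (lborel_on \<Omega>) p (wgrad \<Omega> u) + e"
    and "\<forall>\<^sub>F n in sequentially. Lp_pow (lborel_on \<Omega>) p (\<phi> n) < Lp_pow (lborel_on \<Omega>) p u + e"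
proof -
  let ?M = "lborel_on \<Omega>"
  note d = W1p_lincomb(1,2)[OF op p \<phi> u, where c = 1 and d = "-1", simplified]
  have eq: "Lp_pow ?M p (\<lambda>x. wgrad \<Omega> (\<phi> n) x - wgrad \<Omega> u x) = Lp_pow ?M p (wgrad \<Omega> (\<lambda>x. \<phi> n x - u x))" for n
    by (rule Lp_pow_cong_AE) (use d[of n] W1p_Lp(2)[OF op \<phi>[of n]] W1p_Lp(2)[OF op u] W1p_Lp(2)[OF op d(1)[of n]] in
      \<open>auto simp: Lp_def elim: eventually_mono\<close>)
  have "(\<lambda>n. Lp_pow ?M p (\<lambda>x. wgrad \<Omega> (\<phi> n) x - wgrad \<Omega> u x)) \<longlonglongrightarrow> 0"
    by (rule LIMSEQ_0_dominated[OF l Lp_pow_nonneg]) (simp add: eq W1p_pow_def Lp_pow_nonneg)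
  then show "\<forall>\<^sub>F n in sequentially. Lp_pow ?M p (wgrad \<Omega> (\<phi> n)) < Lp_pow ?M p (wgrad \<Omega> u) + e"
    by (rule Lp_pow_limit_le[OF p W1p_Lp(2)[OF op u] W1p_Lp(2)[OF op \<phi>] _ e])
  have "(\<lambda>n. Lp_pow ?M p (\<lambda>x. \<phi> n x - u x)) \<longlonglongrightarrow> 0"
    by (rule LIMSEQ_0_dominated[OF l Lp_pow_nonneg]) (simp add: W1p_pow_def Lp_pow_nonneg)
  then show "\<forall>\<^sub>F n in sequentially. Lp_pow ?M p (\<phi> n) < Lp_pow ?M p u + e"
    by (rule Lp_pow_limit_le[OF p W1p_Lp(1)[OF op u] W1p_Lp(1)[OF op \<phi>] _ e])
qed

text \<open>The bound for test functions passes to the limit by Fatou along an a.e. convergent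
  sequence. The constant must not depend on \<open>u\<close>, because the bound is later applied to
  the differences \<open>\<phi> n - u\<close>.\<close>

lemma W01p_gagliardo:
  assumes op: "open \<Omega>" and p: "1 < p" and t: "0 < t" "t < 1"
  obtains C where "0 \<le> C" "\<And>u. u \<in> W01p \<Omega> p \<Longrightarrow> Lp (gmeasure p t) p (gdiff u) \<and>
     Lp_pow (gmeasure p t) p (gdiff u) \<le> C * W1p_pow \<Omega> p u"
proof -
  obtain C where C: "0 \<le> C" "\<And>\<Omega> (\<phi> :: 'a \<Rightarrow> real). test_function \<Omega> \<phi> \<Longrightarrow>
       (\<integral>\<^sup>+z. ennreal (\<bar>gdiff \<phi> z\<bar> powr p) \<partial>gmeasure p t) \<le> ennreal (C * (Lp_pow lborel p \<phi> + Lp_pow lborel p (grad \<phi>)))"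
    using gagliardo_test_function[OF p t] by metis
  let ?M = "lborel_on \<Omega>" and ?G = "gmeasure p t :: ('a \<times> 'a) measure"
  have "Lp ?G p (gdiff u) \<and> Lp_pow ?G p (gdiff u) \<le> C * W1p_pow \<Omega> p u" if u: "u \<in> W01p \<Omega> p" for u
  proof -
    obtain \<phi> where \<phi>: "\<And>n. test_function \<Omega> (\<phi> n)" "AE x in lborel. (\<lambda>n. \<phi> n x) \<longlonglongrightarrow> u x"
      "(\<lambda>n. W1p_pow \<Omega> p (\<lambda>x. \<phi> n x - u x)) \<longlonglongrightarrow> 0"
      by (rule W01p_approx_AE[OF op p u]) (rule that)
    note \<phi>W = test_function_W1p[OF op p \<phi>(1)]
    have m: "gdiff u \<in> borel_measurable ?G" "\<And>n. gdiff (\<phi> n) \<in> borel_measurable ?G"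
      unfolding borel_measurable_gmeasure
      using gdiff_borel_measurable[OF W01p_borel_measurable[OF u]]
        gdiff_borel_measurable[OF W1p_borel_measurable[OF \<phi>W(1)]] by auto
    note [measurable] = m
    have lim: "AE z in ?G. (\<lambda>n. ennreal (\<bar>gdiff (\<phi> n) z\<bar> powr p)) \<longlonglongrightarrow> ennreal (\<bar>gdiff u z\<bar> powr p)"
      using AE_gmeasure[OF \<phi>(2), of p t]
    proof (rule AE_mp, intro AE_I2 impI)
      fix z assume "(\<lambda>n. \<phi> n (fst z)) \<longlonglongrightarrow> u (fst z) \<and> (\<lambda>n. \<phi> n (snd z)) \<longlonglongrightarrow> u (snd z)"
      then show "(\<lambda>n. ennreal (\<bar>gdiff (\<phi> n) z\<bar> powr p)) \<longlonglongrightarrow> ennreal (\<bar>gdiff u z\<bar> powr p)"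
        unfolding gdiff_def using p by (intro tendsto_ennrealI tendsto_powr' tendsto_rabs tendsto_diff tendsto_const) auto
    qed
    \<comment> \<open>The error \<open>2 * e\<close> consists of one \<open>e\<close> for the
      function and one for its gradient.\<close>
    have bound: "(\<integral>\<^sup>+z. ennreal (\<bar>gdiff u z\<bar> powr p) \<partial>?G) \<le> ennreal (C * (W1p_pow \<Omega> p u + 2 * e))" if e: "0 < e" for e
    proof (rule nn_integral_AE_limit_le[OF _ _ lim])
      have "\<forall>\<^sub>F n in sequentially. Lp_pow ?M p (\<phi> n) + Lp_pow ?M p (wgrad \<Omega> (\<phi> n)) \<le> W1p_pow \<Omega> p u + 2 * e"
        using Lp_pow_wgrad_limit_le[OF op p W01p_W1p[OF u] \<phi>W(1) \<phi>(3) e]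
        by eventually_elim (simp add: W1p_pow_def)
      then show "\<forall>\<^sub>F n in sequentially. (\<integral>\<^sup>+z. ennreal (\<bar>gdiff (\<phi> n) z\<bar> powr p) \<partial>?G) \<le> ennreal (C * (W1p_pow \<Omega> p u + 2 * e))"
      proof eventually_elim
        case (elim n)
        have "Lp_pow ?M p (\<phi> n) = Lp_pow lborel p (\<phi> n)"
          by (rule Lp_pow_lborel_on[OF op test_function_zero_outside[OF \<phi>(1)]])
        moreover have "Lp_pow ?M p (wgrad \<Omega> (\<phi> n)) = Lp_pow ?M p (grad (\<phi> n))"
          by (rule Lp_pow_cong_AE[OF _ _ \<phi>W(2)])
            (use W1p_Lp(2)[OF op \<phi>W(1)[of n]] Lp_lborel_on[OF op Lp_test_function(2)[OF \<phi>(1)[of n] p]] in \<open>auto simp: Lp_def\<close>)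
        moreover have "Lp_pow ?M p (grad (\<phi> n)) = Lp_pow lborel p (grad (\<phi> n))"
          by (rule Lp_pow_lborel_on[OF op grad_zero_outside[OF \<phi>(1)]])
        ultimately have "C * (Lp_pow lborel p (\<phi> n) + Lp_pow lborel p (grad (\<phi> n))) \<le> C * (W1p_pow \<Omega> p u + 2 * e)"
          using elim C(1) by (intro mult_left_mono) auto
        then show ?case using C(2)[OF \<phi>(1)[of n]] by (meson ennreal_leI order_trans)
      qed
    qed measurable
    have pos: "0 \<le> C * (W1p_pow \<Omega> p u + 2 * e)" if "0 < e" for e
      using C(1) W1p_pow_nonneg[of \<Omega> p u] that by simp
    note L = LpI_nn_integral[OF m(1), of p, unfolded real_norm_def, OF bound pos]
    have "Lp_pow ?G p (gdiff u) \<le> C * W1p_pow \<Omega> p u"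
    proof (cases "C = 0")
      case True
      then show ?thesis using L(2)[of 1] by simp
    next
      case False
      show ?thesis
      proof (rule field_le_epsilon)
        fix e :: real assume e: "0 < e"
        have "C * (W1p_pow \<Omega> p u + 2 * (e / (2 * C))) = C * W1p_pow \<Omega> p u + e"
          using False by (simp add: distrib_left)
        then show "Lp_pow ?G p (gdiff u) \<le> C * W1p_pow \<Omega> p u + e"
          using L(2)[of "e / (2 * C)"] e C(1) False by simp
      qed
    qed
    then show ?thesis using L(1)[of 1] by simp
  qed
  then show thesis using that C(1) by blast
qed

lemma W01p_Lp_gdiff:
  assumes "open \<Omega>" "1 < p" "0 < t" "t < 1" "u \<in> W01p \<Omega> p"
  shows "Lp (gmeasure p t) p (gdiff u)"
proof -
  obtain C where "\<And>u. u \<in> W01p \<Omega> p \<Longrightarrow> Lp (gmeasure p t) p (gdiff u) \<and>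
     Lp_pow (gmeasure p t) p (gdiff u) \<le> C * W1p_pow \<Omega> p u"
    by (rule W01p_gagliardo[OF assms(1-4)]) (rule that)
  then show ?thesis using assms(5) by blast
qed

text \<open>Only an upper bound for the approximating energies is extracted. For the seminorm it
  comes from \<open>W01p_gagliardo\<close> applied to the differences, which are small in the
  Sobolev norm.\<close>

lemma W01p_approx_energy:
  assumes op: "open \<Omega>" and p: "1 < p" and t: "0 < t" "t < 1" and u: "u \<in> W01p \<Omega> p"
  obtains \<phi> where "\<And>n. test_function \<Omega> (\<phi> n)" "AE x in lborel. (\<lambda>n. \<phi> n x) \<longlonglongrightarrow> u x"
    "\<And>e. 0 < e \<Longrightarrow> \<forall>\<^sub>F n in sequentially. energy1 \<Omega> p t (\<phi> n) < energy1 \<Omega> p t u + e"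
proof -
  let ?G = "gmeasure p t :: ('a \<times> 'a) measure"
  obtain \<phi> where \<phi>: "\<And>n. test_function \<Omega> (\<phi> n)" "AE x in lborel. (\<lambda>n. \<phi> n x) \<longlonglongrightarrow> u x"
    "(\<lambda>n. W1p_pow \<Omega> p (\<lambda>x. \<phi> n x - u x)) \<longlonglongrightarrow> 0"
    by (rule W01p_approx_AE[OF op p u]) (rule that)
  note \<phi>W = test_function_W01p[OF op p \<phi>(1)]
  obtain C where C: "0 \<le> C" "\<And>u. u \<in> W01p \<Omega> p \<Longrightarrow> Lp ?G p (gdiff u) \<and> Lp_pow ?G p (gdiff u) \<le> C * W1p_pow \<Omega> p u"
    by (rule W01p_gagliardo[OF op p t]) (rule that)
  have d: "(\<lambda>x. \<phi> n x - u x) \<in> W01p \<Omega> p" for n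
    using W01p_lincomb[OF op p \<phi>W u, where c = 1 and d = "-1"] by simp
  have "(\<lambda>n. C * W1p_pow \<Omega> p (\<lambda>x. \<phi> n x - u x)) \<longlonglongrightarrow> 0" by (rule tendsto_mult_right_zero[OF \<phi>(3)])
  then have "(\<lambda>n. Lp_pow ?G p (\<lambda>z. gdiff (\<phi> n) z - gdiff u z)) \<longlonglongrightarrow> 0"
  proof (rule LIMSEQ_0_dominated[OF _ Lp_pow_nonneg])
    have "(\<lambda>z. gdiff (\<phi> n) z - gdiff u z) = gdiff (\<lambda>x. \<phi> n x - u x)" for n by (auto simp: gdiff_def)
    then show "Lp_pow ?G p (\<lambda>z. gdiff (\<phi> n) z - gdiff u z) \<le> C * W1p_pow \<Omega> p (\<lambda>x. \<phi> n x - u x)" for n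
      using C(2)[OF d] by simp
  qed
  note G = Lp_pow_limit_le[OF p conjunct1[OF C(2)[OF u]] conjunct1[OF C(2)[OF \<phi>W]] this]
  show thesis
  proof (rule that[OF \<phi>(1,2)])
    fix e :: real assume "0 < e"
    then have e: "0 < e / 2" by simp
    show "\<forall>\<^sub>F n in sequentially. energy1 \<Omega> p t (\<phi> n) < energy1 \<Omega> p t u + e"
      using G[OF e] Lp_pow_wgrad_limit_le(1)[OF op p W01p_W1p[OF u] W01p_W1p[OF \<phi>W] \<phi>(3) e]
      by eventually_elim (simp add: energy1_def)
  qed
qed

subsection \<open>The midpoint curve\<close>

text \<open>For \<gamma> = 1 the factor \<open>\<bar>x\<bar> powr (\<gamma> - 2) * x\<close> is
  \<open>sgn x\<close>, a subgradient of the modulus, and the value 0 at \<open>x = 0\<close> is an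
  admissible choice. So a single inequality covers smooth and nonsmooth exponents.\<close>

lemma abs_powr_tangent_ge1:
  fixes x y \<gamma> :: real
  assumes "1 \<le> \<gamma>"
  shows "\<bar>x\<bar> powr \<gamma> + \<gamma> * (\<bar>x\<bar> powr (\<gamma> - 2) * x * (y - x)) \<le> \<bar>y\<bar> powr \<gamma>"
proof (cases "\<gamma> = 1")
  case True
  show ?thesis
  proof (cases "x = 0")
    case False
    then have s: "\<bar>x\<bar> powr (1 - 2) * x = sgn x" by (simp add: powr_minus_divide sgn_real_def)
    have "sgn x * x = \<bar>x\<bar>" by (simp add: sgn_real_def)
    then have "\<bar>x\<bar> powr 1 + 1 * (\<bar>x\<bar> powr (1 - 2) * x * (y - x)) = sgn x * y"
      unfolding s using False by (simp add: right_diff_distrib)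
    also have "\<dots> \<le> \<bar>y\<bar>" by (simp add: sgn_real_def abs_ge_self abs_ge_minus_self)
    finally show ?thesis using True by simp
  qed (use True in simp)
next
  case False
  then show ?thesis using norm_powr_tangent[of \<gamma> x y] assms by (simp add: mult.assoc)
qed

text \<open>A crude domination that makes the coupling integrable: both bases are bounded by the
  larger of \<open>a\<close> and \<open>b\<close>.\<close>

lemma powr_mult_powr_le:
  fixes a b \<gamma> \<delta> :: real
  assumes "0 \<le> a" "0 \<le> b" "0 \<le> \<gamma>" "0 \<le> \<delta>"
  shows "a powr \<gamma> * b powr \<delta> \<le> a powr (\<gamma> + \<delta>) + b powr (\<gamma> + \<delta>)"
proof (cases "a \<le> b")
  case True
  then have "a powr \<gamma> * b powr \<delta> \<le> b powr \<gamma> * b powr \<delta>"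
    using assms by (intro mult_right_mono powr_mono2) auto
  then show ?thesis by (simp add: powr_add add_increasing)
next
  case False
  then have "a powr \<gamma> * b powr \<delta> \<le> a powr \<gamma> * a powr \<delta>"
    using assms by (intro mult_left_mono powr_mono2) auto
  then show ?thesis by (simp add: powr_add add_increasing2)
qed

lemma abs_powr_times_self:
  fixes x \<gamma> :: real
  shows "\<bar>x\<bar> powr (\<gamma> - 2) * x * x = \<bar>x\<bar> powr \<gamma>"
proof (cases "x = 0")
  case False
  have "\<bar>x\<bar> powr 2 = x * x" using False by (simp add: power2_eq_square)
  then have "\<bar>x\<bar> powr (\<gamma> - 2) * x * x = \<bar>x\<bar> powr (\<gamma> - 2) * \<bar>x\<bar> powr 2"
    by (simp only: mult.assoc)
  also have "\<dots> = \<bar>x\<bar> powr (\<gamma> - 2 + 2)" by (rule powr_add[symmetric])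
  finally show ?thesis by (simp only: diff_add_cancel)
qed simp

text \<open>This gives the concavity of the coupling term along the midpoint curve.\<close>

lemma pair_norm_product_ge:
  fixes a b c d \<gamma> \<delta> p :: real
  assumes g: "1 \<le> \<gamma>" "1 \<le> \<delta>" "\<gamma> + \<delta> = p"
  shows "(\<bar>a\<bar> powr \<gamma> * \<bar>c\<bar> powr \<delta> + \<bar>b\<bar> powr \<gamma> * \<bar>d\<bar> powr \<delta>) / 2
    \<le> pair_norm p a b powr \<gamma> * pair_norm p c d powr \<delta>"
proof -
  have p: "1 < p" using g by linarith
  let ?S = "pair_norm p a b" and ?T = "pair_norm p c d"
  have S: "?S powr p = (\<bar>a\<bar> powr p + \<bar>b\<bar> powr p) / 2" "?T powr p = (\<bar>c\<bar> powr p + \<bar>d\<bar> powr p) / 2"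
    by (rule pair_norm_powr[OF p])+
  show ?thesis
  proof (cases "?S = 0 \<or> ?T = 0")
    case True
    then have "(a = 0 \<and> b = 0) \<or> (c = 0 \<and> d = 0)" by (simp add: pair_norm_eq_0[OF p])
    then show ?thesis by auto
  next
    case False
    then have pos: "0 < ?S" "0 < ?T" using pair_norm_nonneg by (auto simp: less_le)
    \<comment> \<open>Young's inequality with \<open>x\<close> and \<open>y\<close> measured in
      units of \<open>?S\<close> and \<open>?T\<close>. In the sum over the two pairs the normalized
      p-th powers of each component add up to 2.\<close>
    have Y: "\<bar>x\<bar> powr \<gamma> * \<bar>y\<bar> powr \<delta> \<le> (?S powr \<gamma> * ?T powr \<delta>) * (\<gamma> / p * (\<bar>x\<bar> powr p / ?S powr p) + \<delta> / p * (\<bar>y\<bar> powr p / ?T powr p))"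
      for x y
    proof (cases "x = 0 \<or> y = 0")
      case True
      then show ?thesis using g p by auto
    next
      case False
      let ?X = "(\<bar>x\<bar> / ?S) powr p" and ?Y = "(\<bar>y\<bar> / ?T) powr p"
      have "?X powr (\<gamma> / p) * ?Y powr (\<delta> / p) \<le> \<gamma> / p * ?X + \<delta> / p * ?Y"
        using False pos g p by (intro Youngs_inequality_0) (auto simp: add_divide_distrib[symmetric])
      moreover have "?X powr (\<gamma> / p) = (\<bar>x\<bar> / ?S) powr \<gamma>" "?Y powr (\<delta> / p) = (\<bar>y\<bar> / ?T) powr \<delta>"
        using p by (simp_all add: powr_powr)
      ultimately have "(\<bar>x\<bar> / ?S) powr \<gamma> * (\<bar>y\<bar> / ?T) powr \<delta> \<le> \<gamma> / p * ?X + \<delta> / p * ?Y" by simp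
      then have "(?S powr \<gamma> * ?T powr \<delta>) * ((\<bar>x\<bar> / ?S) powr \<gamma> * (\<bar>y\<bar> / ?T) powr \<delta>) \<le>
          (?S powr \<gamma> * ?T powr \<delta>) * (\<gamma> / p * ?X + \<delta> / p * ?Y)"
        by (rule mult_left_mono) simp
      moreover have "(?S powr \<gamma> * ?T powr \<delta>) * ((\<bar>x\<bar> / ?S) powr \<gamma> * (\<bar>y\<bar> / ?T) powr \<delta>) = \<bar>x\<bar> powr \<gamma> * \<bar>y\<bar> powr \<delta>"
        using pos by (simp add: powr_divide)
      moreover have "?X = \<bar>x\<bar> powr p / ?S powr p" "?Y = \<bar>y\<bar> powr p / ?T powr p"
        using pos by (simp_all add: powr_divide)
      ultimately show ?thesis by simp
    qed
    let ?c = "?S powr \<gamma> * ?T powr \<delta>"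
    have "(\<bar>a\<bar> powr p + \<bar>b\<bar> powr p) / ?S powr p = 2" "(\<bar>c\<bar> powr p + \<bar>d\<bar> powr p) / ?T powr p = 2"
      using pos S by (simp_all add: field_simps)
    then have two: "\<bar>a\<bar> powr p / ?S powr p + \<bar>b\<bar> powr p / ?S powr p = 2" "\<bar>c\<bar> powr p / ?T powr p + \<bar>d\<bar> powr p / ?T powr p = 2"
      by (simp_all add: add_divide_distrib)
    have "\<bar>a\<bar> powr \<gamma> * \<bar>c\<bar> powr \<delta> + \<bar>b\<bar> powr \<gamma> * \<bar>d\<bar> powr \<delta> \<le>
       ?c * (\<gamma> / p * (\<bar>a\<bar> powr p / ?S powr p) + \<delta> / p * (\<bar>c\<bar> powr p / ?T powr p))
       + ?c * (\<gamma> / p * (\<bar>b\<bar> powr p / ?S powr p) + \<delta> / p * (\<bar>d\<bar> powr p / ?T powr p))"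
      by (rule add_mono[OF Y Y])
    also have "\<dots> = ?c * (\<gamma> / p * (\<bar>a\<bar> powr p / ?S powr p + \<bar>b\<bar> powr p / ?S powr p)
        + \<delta> / p * (\<bar>c\<bar> powr p / ?T powr p + \<bar>d\<bar> powr p / ?T powr p))"
      by (simp only: distrib_left add_ac)
    also have "\<dots> = ?c * ((\<gamma> + \<delta>) / p * 2)" unfolding two by (simp add: add_divide_distrib)
    also have "\<dots> = 2 * ?c" using g(3) p by simp
    finally show ?thesis by simp
  qed
qed

text \<open>A smooth version of \<open>pair_norm\<close>: each modulus is replaced by
  \<open>sqrt (\<epsilon>^2 + x^2)\<close>. Subtracting \<epsilon> restores the value 0 at the
  origin, so that compact supports are kept. Products and sums with negated terms match the closure
  rules for smooth functions.\<close>

definition smooth_pair :: "real \<Rightarrow> real \<Rightarrow> real \<Rightarrow> real \<Rightarrow> real" where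
  "smooth_pair p \<epsilon> x y =
     (((\<epsilon> * \<epsilon> + x * x) powr (p / 2) + (\<epsilon> * \<epsilon> + y * y) powr (p / 2)) * (1 / 2)) powr (1 / p) + (- \<epsilon>)"

lemma smooth_pair_eq: "smooth_pair p \<epsilon> x y = pair_norm p (sqrt (\<epsilon> * \<epsilon> + x * x)) (sqrt (\<epsilon> * \<epsilon> + y * y)) - \<epsilon>"
proof -
  have "\<bar>sqrt (\<epsilon> * \<epsilon> + z * z)\<bar> powr p = (\<epsilon> * \<epsilon> + z * z) powr (p / 2)" for z
  proof -
    have "\<bar>sqrt (\<epsilon> * \<epsilon> + z * z)\<bar> = (\<epsilon> * \<epsilon> + z * z) powr (1 / 2)" by (simp add: powr_half_sqrt)
    then show ?thesis by (simp only: powr_powr) simp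
  qed
  then show ?thesis by (simp add: smooth_pair_def pair_norm_def)
qed

text \<open>Smoothing does not weaken the increment bound: \<open>sqrt (\<epsilon>^2 + z^2)\<close>
  is the modulus of \<open>Complex \<epsilon> z\<close>, hence 1-Lipschitz in \<open>z\<close>, and
  the subtracted \<epsilon> cancels.\<close>

lemma smooth_pair_diff:
  assumes p: "1 < p"
  shows "\<bar>smooth_pair p \<epsilon> x y - smooth_pair p \<epsilon> x' y'\<bar> powr p \<le> (\<bar>x - x'\<bar> powr p + \<bar>y - y'\<bar> powr p) / 2"
proof -
  have lip: "\<bar>sqrt (\<epsilon> * \<epsilon> + z * z) - sqrt (\<epsilon> * \<epsilon> + w * w)\<bar> powr p \<le> \<bar>z - w\<bar> powr p" for z w
  proof -
    have "sqrt (\<epsilon> * \<epsilon> + z * z) = norm (Complex \<epsilon> z)" for z by (simp add: complex_norm power2_eq_square)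
    then have "\<bar>sqrt (\<epsilon> * \<epsilon> + z * z) - sqrt (\<epsilon> * \<epsilon> + w * w)\<bar> \<le> norm (Complex \<epsilon> z - Complex \<epsilon> w)"
      using norm_triangle_ineq3[of "Complex \<epsilon> z" "Complex \<epsilon> w"] by simp
    also have "Complex \<epsilon> z - Complex \<epsilon> w = Complex 0 (z - w)" by (simp add: complex_diff)
    also have "norm (Complex 0 (z - w)) = \<bar>z - w\<bar>" by (simp add: complex_norm)
    finally show ?thesis using p by (intro powr_mono2) auto
  qed
  have "\<bar>smooth_pair p \<epsilon> x y - smooth_pair p \<epsilon> x' y'\<bar> powr p \<le>
    (\<bar>sqrt (\<epsilon> * \<epsilon> + x * x) - sqrt (\<epsilon> * \<epsilon> + x' * x')\<bar> powr p + \<bar>sqrt (\<epsilon> * \<epsilon> + y * y) - sqrt (\<epsilon> * \<epsilon> + y' * y')\<bar> powr p) / 2"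
    unfolding smooth_pair_eq using pair_norm_diff(1)[OF p] by simp
  also have "\<dots> \<le> (\<bar>x - x'\<bar> powr p + \<bar>y - y'\<bar> powr p) / 2"
    using lip[of x x'] lip[of y y'] by simp
  finally show ?thesis .
qed

lemma smooth_pair_0: "1 < p \<Longrightarrow> 0 < \<epsilon> \<Longrightarrow> smooth_pair p \<epsilon> 0 0 = 0"
  by (simp add: smooth_pair_eq pair_norm_def powr_powr)

lemma smooth_pair_tendsto:
  assumes p: "1 < p" and "e \<longlonglongrightarrow> 0" "f \<longlonglongrightarrow> x" "g \<longlonglongrightarrow> y"
  shows "(\<lambda>n. smooth_pair p (e n) (f n) (g n)) \<longlonglongrightarrow> pair_norm p x y"
proof -
  have s: "(\<lambda>n. \<bar>sqrt (e n * e n + h n * h n)\<bar> powr p) \<longlonglongrightarrow> \<bar>sqrt (0 * 0 + z * z)\<bar> powr p" if "h \<longlonglongrightarrow> z" for h z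
    using p by (intro tendsto_powr' tendsto_rabs tendsto_real_sqrt tendsto_add tendsto_mult assms that tendsto_const) auto
  have "(\<lambda>n. smooth_pair p (e n) (f n) (g n)) \<longlonglongrightarrow> pair_norm p (sqrt (0 * 0 + x * x)) (sqrt (0 * 0 + y * y)) - 0"
    unfolding smooth_pair_eq pair_norm_def using p
    by (intro tendsto_diff tendsto_powr' tendsto_divide tendsto_add s assms tendsto_const) auto
  then show ?thesis by (simp add: pair_norm_def)
qed

lemma test_function_smooth_pair:
  assumes p: "1 < p" and e: "0 < \<epsilon>" and t: "test_function \<Omega> \<phi>" "test_function \<Omega> \<eta>"
  shows "test_function \<Omega> (\<lambda>x. smooth_pair p \<epsilon> (\<phi> x) (\<eta> x))"
proof (rule test_functionI[OF _ t])
  have a: "0 < \<epsilon> * \<epsilon> + z * z" for z using e by (simp add: add_pos_nonneg)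
  have b: "smooth (\<lambda>x. (\<epsilon> * \<epsilon> + f x * f x) powr (p / 2))" if "smooth f" for f :: "'a \<Rightarrow> real"
    by (rule smooth_powr[OF smooth_add[OF smooth_const smooth_mult[OF that that]] a])
  have c: "0 < ((\<epsilon> * \<epsilon> + \<phi> x * \<phi> x) powr (p / 2) + (\<epsilon> * \<epsilon> + \<eta> x * \<eta> x) powr (p / 2)) * (1 / 2)" for x
  proof -
    have "0 < (\<epsilon> * \<epsilon> + z * z) powr (p / 2)" for z
      unfolding powr_gt_zero by (rule less_imp_neq[OF a, THEN not_sym])
    from add_pos_pos[OF this this] show ?thesis by (rule mult_pos_pos) simp
  qed
  show "smooth (\<lambda>x. smooth_pair p \<epsilon> (\<phi> x) (\<eta> x))"
    unfolding smooth_pair_def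
    by (rule smooth_add[OF smooth_powr[OF smooth_mult[OF smooth_add[OF b[OF test_function_smooth[OF t(1)]]
      b[OF test_function_smooth[OF t(2)]]] smooth_const] c] smooth_const])
  fix x assume "\<phi> x = 0" "\<eta> x = 0"
  then show "smooth_pair p \<epsilon> (\<phi> x) (\<eta> x) = 0" using smooth_pair_0[OF p e] by simp
qed

text \<open>The infinitesimal form of the increment inequality: divide by the step, let it tend to 0
  in the direction of \<open>grad f x\<close>, and use Cauchy-Schwarz on the right. Thus one
  pointwise bound serves both energy terms.\<close>

lemma norm_grad_powr_le:
  fixes f \<phi> \<eta> :: "'a::euclidean_space \<Rightarrow> real"
  assumes p: "1 < p" and sm: "smooth f" "smooth \<phi>" "smooth \<eta>"
    and le: "\<And>x y. \<bar>f x - f y\<bar> powr p \<le> (\<bar>\<phi> x - \<phi> y\<bar> powr p + \<bar>\<eta> x - \<eta> y\<bar> powr p) / 2"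
  shows "norm (grad f x) powr p \<le> (norm (grad \<phi> x) powr p + norm (grad \<eta> x) powr p) / 2"
proof (cases "grad f x = 0")
  case False
  define h where "h = sgn (grad f x)"
  have h: "norm h = 1" "grad f x \<bullet> h = norm (grad f x)"
    using False by (simp_all add: h_def norm_sgn sgn_div_norm power2_norm_eq_inner[symmetric] power2_eq_square)
  have q: "((\<lambda>s. \<bar>(g (x + s *\<^sub>R h) - g x) / s\<bar> powr p) \<longlongrightarrow> \<bar>grad g x \<bullet> h\<bar> powr p) (at 0)" if "smooth g" for g
  proof -
    have "((\<lambda>s. (g (x + s *\<^sub>R h) - g x) / s) \<longlongrightarrow> grad g x \<bullet> h) (at 0)"
      using smooth_has_real_derivative_line[OF that, of x h 0] by (simp add: DERIV_def frechet_derivative_grad[OF that])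
    then show ?thesis using p by (intro tendsto_powr' tendsto_rabs tendsto_const) auto
  qed
  have "\<bar>grad f x \<bullet> h\<bar> powr p \<le> (\<bar>grad \<phi> x \<bullet> h\<bar> powr p + \<bar>grad \<eta> x \<bullet> h\<bar> powr p) / 2"
  proof (rule tendsto_le[OF _ _ q[OF sm(1)]])
    show "((\<lambda>s. (\<bar>(\<phi> (x + s *\<^sub>R h) - \<phi> x) / s\<bar> powr p + \<bar>(\<eta> (x + s *\<^sub>R h) - \<eta> x) / s\<bar> powr p) / 2)
      \<longlongrightarrow> (\<bar>grad \<phi> x \<bullet> h\<bar> powr p + \<bar>grad \<eta> x \<bullet> h\<bar> powr p) / 2) (at 0)"
      by (intro tendsto_divide tendsto_add q sm tendsto_const) simp
    show "\<forall>\<^sub>F s in at 0. \<bar>(f (x + s *\<^sub>R h) - f x) / s\<bar> powr p \<le>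
      (\<bar>(\<phi> (x + s *\<^sub>R h) - \<phi> x) / s\<bar> powr p + \<bar>(\<eta> (x + s *\<^sub>R h) - \<eta> x) / s\<bar> powr p) / 2"
    proof (rule always_eventually, rule allI)
      fix s :: real
      have "\<bar>f (x + s *\<^sub>R h) - f x\<bar> powr p / \<bar>s\<bar> powr p \<le>
        ((\<bar>\<phi> (x + s *\<^sub>R h) - \<phi> x\<bar> powr p + \<bar>\<eta> (x + s *\<^sub>R h) - \<eta> x\<bar> powr p) / 2) / \<bar>s\<bar> powr p"
        by (rule divide_right_mono[OF le]) simp
      then show "\<bar>(f (x + s *\<^sub>R h) - f x) / s\<bar> powr p \<le>
        (\<bar>(\<phi> (x + s *\<^sub>R h) - \<phi> x) / s\<bar> powr p + \<bar>(\<eta> (x + s *\<^sub>R h) - \<eta> x) / s\<bar> powr p) / 2"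
        by (simp add: powr_divide add_divide_distrib)
    qed
  qed simp
  also have "\<dots> \<le> (norm (grad \<phi> x) powr p + norm (grad \<eta> x) powr p) / 2"
    using p Cauchy_Schwarz_ineq2[of "grad \<phi> x" h] Cauchy_Schwarz_ineq2[of "grad \<eta> x" h] h(1)
    by (intro divide_right_mono add_mono powr_mono2) auto
  finally show ?thesis using h(2) by simp
qed simp

text \<open>By Fubini, for almost every fixed \<open>x\<close> the relation holds for almost all
  \<open>y\<close>; since \<open>u\<close> is not null, some such \<open>x\<close> has
  \<open>u x \<noteq> 0\<close> and supplies the constant \<open>a x / u x\<close>.\<close>

lemma AE_proportional:
  fixes u a :: "'a::euclidean_space \<Rightarrow> real"
  assumes ae: "AE z in (lborel \<Otimes>\<^sub>M lborel). u (fst z) * a (snd z) = u (snd z) * a (fst z)"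
    and u: "\<not> (AE x in lborel. u x = 0)"
  obtains k where "AE x in lborel. a x = k * u x"
proof -
  have P: "AE x in lborel. AE y in lborel. u x * a y = u y * a x"
    using lborel_pair.AE_pair[OF ae] by simp
  have "\<exists>x. u x \<noteq> 0 \<and> (AE y in lborel. u x * a y = u y * a x)"
  proof (rule ccontr)
    assume n: "\<not> ?thesis"
    have "AE x in lborel. u x = 0"
      using P by (rule AE_mp) (use n in auto)
    then show False using u by simp
  qed
  then obtain x where x: "u x \<noteq> 0" "AE y in lborel. u x * a y = u y * a x" by blast
  have "AE y in lborel. a y = (a x / u x) * u y"
    using x(2) by eventually_elim (use x(1) in \<open>simp add: field_simps\<close>)
  then show thesis by (rule that)
qed

text \<open>Fatou's lemma as an eventual lower bound. The integral of \<open>g\<close> may be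
  infinite, hence its place in \<open>ennreal\<close>.\<close>

lemma nn_integral_Fatou_eventually:
  fixes f :: "nat \<Rightarrow> 'x \<Rightarrow> real"
  assumes f: "\<And>n. integrable M (f n)" "\<And>n x. 0 \<le> f n x" and [measurable]: "g \<in> borel_measurable M"
    and l: "AE x in M. (\<lambda>n. f n x) \<longlonglongrightarrow> g x"
    and K: "ennreal K \<le> (\<integral>\<^sup>+x. ennreal (g x) \<partial>M)" and e: "0 < e"
  shows "\<forall>\<^sub>F n in sequentially. K - e < (LINT x|M. f n x)"
proof (cases "0 \<le> K - e")
  case True
  have [measurable]: "f n \<in> borel_measurable M" for n using f(1) by auto
  have eq: "(\<integral>\<^sup>+x. ennreal (f n x) \<partial>M) = ennreal (LINT x|M. f n x)" for n
    by (rule nn_integral_eq_integral) (use f in auto)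
  have "ennreal (K - e) < ennreal K" using True e by (simp add: ennreal_less_iff)
  also have "ennreal K \<le> (\<integral>\<^sup>+x. liminf (\<lambda>n. ennreal (f n x)) \<partial>M)"
  proof -
    have "(\<integral>\<^sup>+x. ennreal (g x) \<partial>M) = (\<integral>\<^sup>+x. liminf (\<lambda>n. ennreal (f n x)) \<partial>M)"
      by (rule nn_integral_cong_AE) (use l in eventually_elim, rule lim_imp_Liminf[symmetric], auto intro: tendsto_ennrealI)
    then show ?thesis using K by simp
  qed
  also have "\<dots> \<le> liminf (\<lambda>n. ennreal (LINT x|M. f n x))"
    unfolding eq[symmetric] by (rule nn_integral_liminf) auto
  finally have "\<forall>\<^sub>F n in sequentially. ennreal (K - e) < ennreal (LINT x|M. f n x)"
    by (rule less_LiminfD)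
  then show ?thesis by eventually_elim (use True in \<open>simp add: ennreal_less_iff\<close>)
next
  \<comment> \<open>A negative bound would be truncated in \<open>ennreal\<close>, but then
    nonnegativity of the integrand suffices.\<close>
  case False
  then have "K - e < (LINT x|M. f n x)" for n
    using Bochner_Integration.integral_nonneg[of M "f n"] f(2) by (smt (verit))
  then show ?thesis by simp
qed

subsection \<open>Eigenpairs and their uniqueness\<close>

lemma Lp_pow_wgrad_test_function:
  assumes op: "open \<Omega>" and p: "1 < p" and t: "test_function \<Omega> \<phi>"
  shows "Lp_pow (lborel_on \<Omega>) p (wgrad \<Omega> \<phi>) = Lp_pow (lborel_on \<Omega>) p (grad \<phi>)"
  by (rule Lp_pow_cong_AE[OF _ _ test_function_W1p(2)[OF op p t]])
    (use W1p_Lp(2)[OF op test_function_W1p(1)[OF op p t]] Lp_lborel_on[OF op Lp_test_function(2)[OF t p]] in \<open>simp_all add: Lp_def\<close>)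

text \<open>The Gagliardo seminorm of the midpoint curve falls short of the average by \<open>d\<close>; a vanishing
  deficit forces equality in Minkowski's inequality at almost every pair of points.\<close>

lemma midpoint_sequence:
  assumes op: "open \<Omega>" and p: "1 < p" and t: "0 < t" "t < 1"
    and u: "u \<in> W01p \<Omega> p" and a: "a \<in> W01p \<Omega> p"
  obtains \<sigma> d where "\<And>n. \<sigma> n \<in> W01p \<Omega> p"
    "AE x in lborel. (\<lambda>n. \<sigma> n x) \<longlonglongrightarrow> pair_norm p (u x) (a x)"
    "\<And>n::nat. 0 \<le> d n"
    "\<And>e. 0 < e \<Longrightarrow> \<forall>\<^sub>F n in sequentially. energy1 \<Omega> p t (\<sigma> n) + d n < (energy1 \<Omega> p t u + energy1 \<Omega> p t a) / 2 + e"
    "(\<forall>e>0. \<forall>\<^sub>F n in sequentially. d n \<le> e) \<longrightarrow>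
      (AE z in (lborel \<Otimes>\<^sub>M lborel). u (fst z) * a (snd z) = u (snd z) * a (fst z))"
proof -
  let ?M = "lborel_on \<Omega>" and ?G = "gmeasure p t :: ('a \<times> 'a) measure"
  obtain \<phi> where \<phi>: "\<And>n. test_function \<Omega> (\<phi> n)" "AE x in lborel. (\<lambda>n. \<phi> n x) \<longlonglongrightarrow> u x"
    "\<And>e. 0 < e \<Longrightarrow> \<forall>\<^sub>F n in sequentially. energy1 \<Omega> p t (\<phi> n) < energy1 \<Omega> p t u + e"
    by (rule W01p_approx_energy[OF op p t u]) (rule that)
  obtain \<eta> where \<eta>: "\<And>n. test_function \<Omega> (\<eta> n)" "AE x in lborel. (\<lambda>n. \<eta> n x) \<longlonglongrightarrow> a x"
    "\<And>e. 0 < e \<Longrightarrow> \<forall>\<^sub>F n in sequentially. energy1 \<Omega> p t (\<eta> n) < energy1 \<Omega> p t a + e"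
    by (rule W01p_approx_energy[OF op p t a]) (rule that)
  define \<epsilon> where "\<epsilon> n = inverse (real (Suc n))" for n
  have \<epsilon>: "0 < \<epsilon> n" "\<epsilon> \<longlonglongrightarrow> 0" for n
    unfolding \<epsilon>_def using LIMSEQ_inverse_real_of_nat by simp_all
  define \<sigma> where "\<sigma> n x = smooth_pair p (\<epsilon> n) (\<phi> n x) (\<eta> n x)" for n x
  have \<sigma>: "test_function \<Omega> (\<sigma> n)" for n
    unfolding \<sigma>_def[abs_def] by (rule test_function_smooth_pair[OF p \<epsilon>(1) \<phi>(1) \<eta>(1)])
  have le: "\<bar>\<sigma> n x - \<sigma> n y\<bar> powr p \<le> (\<bar>\<phi> n x - \<phi> n y\<bar> powr p + \<bar>\<eta> n x - \<eta> n y\<bar> powr p) / 2" for n x y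
    unfolding \<sigma>_def by (rule smooth_pair_diff[OF p])
  \<comment> \<open>The pointwise slack in the increment inequality; its integral against the kernel
    is the deficit \<open>d\<close>.\<close>
  define D where "D n z = (\<bar>gdiff (\<phi> n) z\<bar> powr p + \<bar>gdiff (\<eta> n) z\<bar> powr p) / 2 - \<bar>gdiff (\<sigma> n) z\<bar> powr p" for n z
  have D0: "0 \<le> D n z" for n z unfolding D_def gdiff_def using le[of n "fst z" "snd z"] by simp
  note W = test_function_W01p[OF op p \<phi>(1)] test_function_W01p[OF op p \<eta>(1)] test_function_W01p[OF op p \<sigma>]
  have ig: "integrable ?G (\<lambda>z. \<bar>gdiff (\<phi> n) z\<bar> powr p)" "integrable ?G (\<lambda>z. \<bar>gdiff (\<eta> n) z\<bar> powr p)"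
    "integrable ?G (\<lambda>z. \<bar>gdiff (\<sigma> n) z\<bar> powr p)" for n
    using W01p_Lp_gdiff[OF op p t W(1)[of n]] W01p_Lp_gdiff[OF op p t W(2)[of n]] W01p_Lp_gdiff[OF op p t W(3)[of n]]
    by (simp_all add: Lp_def)
  have iD: "integrable ?G (D n)" for n unfolding D_def[abs_def] using ig[of n] by simp
  define d where "d n = (LINT z|?G. D n z)" for n
  have d: "d n = (Lp_pow ?G p (gdiff (\<phi> n)) + Lp_pow ?G p (gdiff (\<eta> n))) / 2 - Lp_pow ?G p (gdiff (\<sigma> n))" for n
    unfolding d_def D_def Lp_pow_def using ig[of n] by simp
  have grad_le: "Lp_pow ?M p (wgrad \<Omega> (\<sigma> n)) \<le> (Lp_pow ?M p (wgrad \<Omega> (\<phi> n)) + Lp_pow ?M p (wgrad \<Omega> (\<eta> n))) / 2" for n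
  proof -
    have i: "integrable ?M (\<lambda>x. norm (grad (\<phi> n) x) powr p)" "integrable ?M (\<lambda>x. norm (grad (\<eta> n) x) powr p)"
      "integrable ?M (\<lambda>x. norm (grad (\<sigma> n) x) powr p)"
      using Lp_lborel_on[OF op Lp_test_function(2)[OF \<phi>(1)[of n] p]] Lp_lborel_on[OF op Lp_test_function(2)[OF \<eta>(1)[of n] p]]
        Lp_lborel_on[OF op Lp_test_function(2)[OF \<sigma>[of n] p]] by (simp_all add: Lp_def)
    have "Lp_pow ?M p (grad (\<sigma> n)) \<le> (LINT x|?M. (norm (grad (\<phi> n) x) powr p + norm (grad (\<eta> n) x) powr p) / 2)"
      unfolding Lp_pow_def
    proof (rule integral_mono[OF i(3)])
      show "integrable ?M (\<lambda>x. (norm (grad (\<phi> n) x) powr p + norm (grad (\<eta> n) x) powr p) / 2)" using i by simp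
      show "norm (grad (\<sigma> n) x) powr p \<le> (norm (grad (\<phi> n) x) powr p + norm (grad (\<eta> n) x) powr p) / 2" for x
        by (rule norm_grad_powr_le[OF p test_function_smooth[OF \<sigma>] test_function_smooth[OF \<phi>(1)] test_function_smooth[OF \<eta>(1)] le])
    qed
    also have "\<dots> = (Lp_pow ?M p (grad (\<phi> n)) + Lp_pow ?M p (grad (\<eta> n))) / 2"
      unfolding Lp_pow_def using i by simp
    finally show ?thesis unfolding Lp_pow_wgrad_test_function[OF op p \<phi>(1)]
        Lp_pow_wgrad_test_function[OF op p \<eta>(1)] Lp_pow_wgrad_test_function[OF op p \<sigma>] .
  qed
  \<comment> \<open>The slack in the gradient inequality is dropped here; only the nonlocal one
    survives in \<open>d\<close>.\<close>
  have en: "energy1 \<Omega> p t (\<sigma> n) + d n \<le> (energy1 \<Omega> p t (\<phi> n) + energy1 \<Omega> p t (\<eta> n)) / 2" for n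
    using grad_le[of n] unfolding energy1_def d by (simp add: field_simps)
  define q where "q x = pair_norm p (u x) (a x)" for x
  have lim: "AE x in lborel. (\<lambda>n. \<phi> n x) \<longlonglongrightarrow> u x \<and> (\<lambda>n. \<eta> n x) \<longlonglongrightarrow> a x \<and> (\<lambda>n. \<sigma> n x) \<longlonglongrightarrow> q x"
    using \<phi>(2) \<eta>(2)
  proof eventually_elim
    case (elim x)
    then show ?case using smooth_pair_tendsto[OF p \<epsilon>(2), of "\<lambda>n. \<phi> n x" "u x" "\<lambda>n. \<eta> n x" "a x"]
      unfolding \<sigma>_def q_def by blast
  qed
  show thesis
  proof (rule that[of \<sigma> d])
    show "\<sigma> n \<in> W01p \<Omega> p" for n by (rule W(3))
    show "AE x in lborel. (\<lambda>n. \<sigma> n x) \<longlonglongrightarrow> pair_norm p (u x) (a x)"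
      using lim unfolding q_def by (rule AE_mp) (rule AE_I2, blast)
    show "0 \<le> d n" for n unfolding d_def by (rule Bochner_Integration.integral_nonneg) (rule D0)
    show "\<forall>\<^sub>F n in sequentially. energy1 \<Omega> p t (\<sigma> n) + d n < (energy1 \<Omega> p t u + energy1 \<Omega> p t a) / 2 + e" if "0 < e" for e
      using \<phi>(3)[OF that] \<eta>(3)[OF that]
    proof eventually_elim
      case (elim n)
      then show ?case using en[of n] by (simp add: field_simps)
    qed
    show "(\<forall>e>0. \<forall>\<^sub>F n in sequentially. d n \<le> e) \<longrightarrow>
      (AE z in (lborel \<Otimes>\<^sub>M lborel). u (fst z) * a (snd z) = u (snd z) * a (fst z))"
    proof
      assume small: "\<forall>e>0. \<forall>\<^sub>F n in sequentially. d n \<le> e"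
      define E where "E z = (\<bar>gdiff u z\<bar> powr p + \<bar>gdiff a z\<bar> powr p) / 2 - \<bar>gdiff q z\<bar> powr p" for z
      have [measurable]: "u \<in> borel_measurable borel" "a \<in> borel_measurable borel"
        by (rule W01p_borel_measurable[OF u], rule W01p_borel_measurable[OF a])
      have "q \<in> borel_measurable borel" unfolding q_def[abs_def] pair_norm_def by measurable
      then have [measurable]: "gdiff u \<in> borel_measurable ?G" "gdiff a \<in> borel_measurable ?G" "gdiff q \<in> borel_measurable ?G"
        unfolding borel_measurable_gmeasure by (auto intro!: gdiff_borel_measurable)
      have [measurable]: "D n \<in> borel_measurable ?G" for n using iD[of n] by (rule borel_measurable_integrable)
      have [measurable]: "E \<in> borel_measurable ?G" unfolding E_def[abs_def] by measurable
      have limD: "AE z in ?G. (\<lambda>n. ennreal (D n z)) \<longlonglongrightarrow> ennreal (E z)"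
        using AE_gmeasure[OF lim, of p t]
      proof (rule AE_mp, intro AE_I2 impI)
        fix z
        assume h: "((\<lambda>n. \<phi> n (fst z)) \<longlonglongrightarrow> u (fst z) \<and> (\<lambda>n. \<eta> n (fst z)) \<longlonglongrightarrow> a (fst z) \<and> (\<lambda>n. \<sigma> n (fst z)) \<longlonglongrightarrow> q (fst z)) \<and>
          (\<lambda>n. \<phi> n (snd z)) \<longlonglongrightarrow> u (snd z) \<and> (\<lambda>n. \<eta> n (snd z)) \<longlonglongrightarrow> a (snd z) \<and> (\<lambda>n. \<sigma> n (snd z)) \<longlonglongrightarrow> q (snd z)"
        have P: "(\<lambda>n. \<bar>gdiff (f n) z\<bar> powr p) \<longlonglongrightarrow> \<bar>gdiff g z\<bar> powr p"
          if "(\<lambda>n. f n (fst z)) \<longlonglongrightarrow> g (fst z)" "(\<lambda>n. f n (snd z)) \<longlonglongrightarrow> g (snd z)" for f g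
          unfolding gdiff_def using p that by (intro tendsto_powr' tendsto_rabs tendsto_diff tendsto_const) auto
        show "(\<lambda>n. ennreal (D n z)) \<longlonglongrightarrow> ennreal (E z)"
          unfolding D_def E_def using h
          by (intro tendsto_ennrealI tendsto_diff tendsto_divide tendsto_add P tendsto_const) auto
      qed
      \<comment> \<open>Fatou again: the \<open>D n\<close> are nonnegative with integrals
        \<open>d n\<close> that become arbitrarily small, so their pointwise limit \<open>E\<close>
        has integral zero.\<close>
      have "(\<integral>\<^sup>+z. ennreal (E z) \<partial>?G) \<le> ennreal e" if "0 < e" for e
      proof (rule nn_integral_AE_limit_le[OF _ _ limD])
        have eq: "(\<integral>\<^sup>+z. ennreal (D n z) \<partial>?G) = ennreal (d n)" for n
          unfolding d_def by (rule nn_integral_eq_integral[OF iD]) (simp add: D0)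
        show "\<forall>\<^sub>F n in sequentially. (\<integral>\<^sup>+z. ennreal (D n z) \<partial>?G) \<le> ennreal e"
          using small[rule_format, OF that] unfolding eq by eventually_elim (rule ennreal_leI)
      qed measurable
      then have "(\<integral>\<^sup>+z. ennreal (E z) \<partial>?G) \<le> 0"
        by - (rule ennreal_le_epsilon, simp)
      then have "(\<integral>\<^sup>+z. ennreal (E z) \<partial>?G) = 0" by simp
      then have "AE z in ?G. ennreal (E z) = 0"
        using nn_integral_0_iff_AE[of "\<lambda>z. ennreal (E z)" ?G] by simp
      then have "AE z in ?G. u (fst z) * a (snd z) = u (snd z) * a (fst z)"
      proof (rule AE_mp, intro AE_I2 impI)
        fix z assume "ennreal (E z) = 0"
        then have "E z \<le> 0" by (simp add: ennreal_eq_0_iff)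
        then show "u (fst z) * a (snd z) = u (snd z) * a (fst z)"
          unfolding E_def gdiff_def q_def by (intro pair_norm_diff(2)[OF p]) simp
      qed
      then show "AE z in (lborel \<Otimes>\<^sub>M lborel). u (fst z) * a (snd z) = u (snd z) * a (fst z)"
        by (rule AE_gmeasureD) simp
    qed
  qed
qed

section \<open>The coupled system and its variational problem\<close>

locale coupled_system =
  fixes \<Omega> :: "'a::euclidean_space set" and p r s \<alpha> \<beta> :: real
  assumes bounded_domain: "bounded \<Omega>" and open_domain: "open \<Omega>"
    and p: "1 < p" and r: "0 < r" "r < 1" and s: "0 < s" "s < 1"
    and \<alpha>: "1 \<le> \<alpha>" and \<beta>: "1 \<le> \<beta>" and sum: "\<alpha> + \<beta> = p"
begin

definition coupling :: "('a \<Rightarrow> real) \<Rightarrow> ('a \<Rightarrow> real) \<Rightarrow> real" where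
  "coupling w z = (LINT x|lborel_on \<Omega>. \<bar>w x\<bar> powr \<alpha> * \<bar>z x\<bar> powr \<beta>)"

definition energy :: "('a \<Rightarrow> real) \<Rightarrow> ('a \<Rightarrow> real) \<Rightarrow> real" where
  "energy w z = energy1 \<Omega> p r w + energy1 \<Omega> p s z"

abbreviation lam :: real where "lam \<equiv> lambda_p \<Omega> p r s \<alpha> \<beta>"

lemma energy1_nonneg: "0 \<le> energy1 \<Omega> p t w"
  by (simp add: energy1_def Lp_pow_nonneg)

lemma energy_nonneg: "0 \<le> energy w z"
  by (simp add: energy_def energy1_nonneg)

lemma coupling_nonneg: "0 \<le> coupling w z"
  unfolding coupling_def by (rule Bochner_Integration.integral_nonneg) simp

lemma product_integrable:
  assumes w: "w \<in> W01p \<Omega> p" and z: "z \<in> W01p \<Omega> p" and g: "1 \<le> \<gamma>" "1 \<le> \<delta>" "\<gamma> + \<delta> = p"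
  shows "integrable (lborel_on \<Omega>) (\<lambda>x. \<bar>w x\<bar> powr \<gamma> * \<bar>z x\<bar> powr \<delta>)"
proof -
  note L = W1p_Lp(1)[OF open_domain W01p_W1p[OF w]] W1p_Lp(1)[OF open_domain W01p_W1p[OF z]]
  have [measurable]: "w \<in> borel_measurable (lborel_on \<Omega>)" "z \<in> borel_measurable (lborel_on \<Omega>)"
    and i: "integrable (lborel_on \<Omega>) (\<lambda>x. \<bar>w x\<bar> powr p)" "integrable (lborel_on \<Omega>) (\<lambda>x. \<bar>z x\<bar> powr p)"
    using L by (simp_all add: Lp_def)
  show ?thesis
  proof (rule Bochner_Integration.integrable_bound[OF Bochner_Integration.integrable_add[OF i]])
    show "AE x in lborel_on \<Omega>. norm (\<bar>w x\<bar> powr \<gamma> * \<bar>z x\<bar> powr \<delta>) \<le> norm (\<bar>w x\<bar> powr p + \<bar>z x\<bar> powr p)"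
    proof (rule AE_I2)
      fix x
      show "norm (\<bar>w x\<bar> powr \<gamma> * \<bar>z x\<bar> powr \<delta>) \<le> norm (\<bar>w x\<bar> powr p + \<bar>z x\<bar> powr p)"
        using powr_mult_powr_le[of "\<bar>w x\<bar>" "\<bar>z x\<bar>" \<gamma> \<delta>] g by simp
    qed
  qed measurable
qed

lemma energy_J_eq:
  assumes "w \<in> W01p \<Omega> p" "z \<in> W01p \<Omega> p"
  shows "energy_J \<Omega> p r s \<alpha> \<beta> w z = 1 / 2 * (energy w z / coupling w z)"
  using assms[THEN W01p_borel_measurable]
  unfolding energy_J_def energy_def energy1_def coupling_def
  by (simp add: set_integral_lborel_on[OF open_domain] gagliardo_pow_eq_Lp_pow) (simp add: Lp_pow_def)

lemma coupling_pos_iff: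
  assumes w: "w \<in> W01p \<Omega> p" and z: "z \<in> W01p \<Omega> p"
  shows "0 < coupling w z \<longleftrightarrow> (w, z) \<in> admissible \<Omega> p"
proof -
  have "coupling w z = 0 \<longleftrightarrow> (AE x in lborel_on \<Omega>. \<bar>w x\<bar> powr \<alpha> * \<bar>z x\<bar> powr \<beta> = 0)"
    unfolding coupling_def
    by (rule integral_nonneg_eq_0_iff_AE[OF product_integrable[OF w z \<alpha> \<beta> sum]]) simp
  also have "\<dots> \<longleftrightarrow> (AE x in lborel. x \<in> \<Omega> \<longrightarrow> w x * z x = 0)"
    by (simp add: AE_lborel_on[OF open_domain])
  finally show ?thesis
    using coupling_nonneg[of w z] w z by (auto simp: admissible_def less_le)
qed

text \<open>Nonnegativity of the quotient makes the infimum of reals meaningful; the second claim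
  also rests on an admissible pair, since the infimum of the empty set is unspecified.\<close>

lemma lam_le_energy_J:
  assumes "(w, z) \<in> admissible \<Omega> p"
  shows "lam \<le> energy_J \<Omega> p r s \<alpha> \<beta> w z" "0 \<le> lam"
proof -
  have nn: "0 \<le> energy_J \<Omega> p r s \<alpha> \<beta> w z" if "(w, z) \<in> admissible \<Omega> p" for w z
    using that energy_J_eq[of w z] energy_nonneg[of w z] coupling_nonneg[of w z] by (simp add: admissible_def)
  have "bdd_below ((\<lambda>(w, z). energy_J \<Omega> p r s \<alpha> \<beta> w z) ` admissible \<Omega> p)"
    by (rule bdd_belowI[of _ 0]) (use nn in auto)
  from cINF_lower[OF this assms] show "lam \<le> energy_J \<Omega> p r s \<alpha> \<beta> w z" by (simp add: lambda_p_def)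
  show "0 \<le> lam" unfolding lambda_p_def
    by (rule cINF_greatest) (use nn assms in auto)
qed

text \<open>The quotient bound with its denominator cleared. It holds trivially when the coupling
  vanishes, so it applies to the approximating curves without a check of admissibility.\<close>

lemma energy_ge:
  assumes w: "w \<in> W01p \<Omega> p" and z: "z \<in> W01p \<Omega> p"
  shows "2 * lam * coupling w z \<le> energy w z"
proof (cases "0 < coupling w z")
  case True
  then have "lam \<le> 1 / 2 * (energy w z / coupling w z)"
    using lam_le_energy_J(1)[of w z] energy_J_eq[OF w z] coupling_pos_iff[OF w z] by simp
  then show ?thesis using True by (simp add: field_simps)
next
  case False
  then show ?thesis using coupling_nonneg[of w z] energy_nonneg[of w z] by simp
qed

text \<open>No limit is taken in the coupling term, whose integrand is convex in each variable. This is
  why the case of exponent \<open>1\<close>, where it is not differentiable, needs no separate treatment.\<close>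

lemma first_variation:
  assumes t: "0 < t" "t < 1" and g: "1 \<le> \<gamma>" "1 \<le> \<delta>" "\<gamma> + \<delta> = p" and \<mu>: "0 \<le> \<mu>"
    and w: "w \<in> W01p \<Omega> p" and h: "h \<in> W01p \<Omega> p" and \<psi>: "\<psi> \<in> W01p \<Omega> p"
    and min: "\<And>y. y \<in> W01p \<Omega> p \<Longrightarrow>
       energy1 \<Omega> p t w - 2 * \<mu> * (LINT x|lborel_on \<Omega>. \<bar>w x\<bar> powr \<gamma> * \<bar>h x\<bar> powr \<delta>) \<le>
       energy1 \<Omega> p t y - 2 * \<mu> * (LINT x|lborel_on \<Omega>. \<bar>y x\<bar> powr \<gamma> * \<bar>h x\<bar> powr \<delta>)"
  shows "form_local \<Omega> p w \<psi> + form_nonlocal t p w \<psi> =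
    \<mu> * (2 * \<gamma> / p) * (LINT x:\<Omega>|lborel. \<bar>w x\<bar> powr (\<gamma> - 2) * w x * \<bar>h x\<bar> powr \<delta> * \<psi> x)"
proof -
  let ?M = "lborel_on \<Omega>" and ?G = "gmeasure p t :: ('a \<times> 'a) measure"
  note w' = W01p_W1p[OF w] and \<psi>' = W01p_W1p[OF \<psi>]
  note Lw = W1p_Lp(2)[OF open_domain w'] and L\<psi> = W1p_Lp(2)[OF open_domain \<psi>']
  note Gw = W01p_Lp_gdiff[OF open_domain p t w] and G\<psi> = W01p_Lp_gdiff[OF open_domain p t \<psi>]
  note iw = product_integrable[OF w h g]
  have [measurable]: "w \<in> borel_measurable ?M" "h \<in> borel_measurable ?M" "\<psi> \<in> borel_measurable ?M"
    by (rule borel_measurable_lborel_on[OF W01p_borel_measurable[OF w]],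
        rule borel_measurable_lborel_on[OF W01p_borel_measurable[OF h]],
        rule borel_measurable_lborel_on[OF W01p_borel_measurable[OF \<psi>]])
  define k where "k x = \<bar>w x\<bar> powr (\<gamma> - 2) * w x * \<bar>h x\<bar> powr \<delta> * \<psi> x" for x
  have tangent: "\<bar>w x\<bar> powr \<gamma> * \<bar>h x\<bar> powr \<delta> + (\<tau> * \<gamma>) * k x \<le> \<bar>w x + \<tau> * \<psi> x\<bar> powr \<gamma> * \<bar>h x\<bar> powr \<delta>" for x \<tau>
  proof -
    have "(\<bar>w x\<bar> powr \<gamma> + \<gamma> * (\<bar>w x\<bar> powr (\<gamma> - 2) * w x * (w x + \<tau> * \<psi> x - w x))) * \<bar>h x\<bar> powr \<delta>
        \<le> \<bar>w x + \<tau> * \<psi> x\<bar> powr \<gamma> * \<bar>h x\<bar> powr \<delta>"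
      by (intro mult_right_mono abs_powr_tangent_ge1 g) simp
    then show ?thesis by (simp add: k_def algebra_simps)
  qed
  have y: "(\<lambda>x. w x + \<tau> * \<psi> x) \<in> W01p \<Omega> p" for \<tau>
    using W01p_lincomb[OF open_domain p w \<psi>, of 1 \<tau>] by simp
  note iy = product_integrable[OF y h g]
  \<comment> \<open>The tangent inequality at \<open>\<tau> = 1\<close> and
    \<open>\<tau> = -1\<close> traps \<open>\<gamma> * k\<close> between integrable functions, and
    \<open>\<gamma> \<ge> 1\<close> removes the factor.\<close>
  have ik: "integrable ?M k"
  proof (rule Bochner_Integration.integrable_bound)
    let ?f = "\<lambda>x. (\<bar>w x + 1 * \<psi> x\<bar> powr \<gamma> * \<bar>h x\<bar> powr \<delta> + \<bar>w x + (-1) * \<psi> x\<bar> powr \<gamma> * \<bar>h x\<bar> powr \<delta>)"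
    show "integrable ?M ?f" by (intro Bochner_Integration.integrable_add iy)
    show "k \<in> borel_measurable ?M" unfolding k_def[abs_def] by measurable
    show "AE x in ?M. norm (k x) \<le> norm (?f x)"
    proof (rule AE_I2)
      fix x
      have a: "0 \<le> \<bar>w x\<bar> powr \<gamma> * \<bar>h x\<bar> powr \<delta>" "0 \<le> \<bar>w x + 1 * \<psi> x\<bar> powr \<gamma> * \<bar>h x\<bar> powr \<delta>"
        "0 \<le> \<bar>w x + (-1) * \<psi> x\<bar> powr \<gamma> * \<bar>h x\<bar> powr \<delta>" by simp_all
      have "\<gamma> * k x \<le> ?f x" "- (\<gamma> * k x) \<le> ?f x"
        using tangent[of x 1] tangent[of x "-1"] a unfolding mult_1_left mult_minus_left by linarith+
      then have "\<gamma> * \<bar>k x\<bar> \<le> ?f x" by (simp add: abs_if)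
      moreover have "1 * \<bar>k x\<bar> \<le> \<gamma> * \<bar>k x\<bar>" by (rule mult_right_mono[OF g(1)]) simp
      ultimately show "norm (k x) \<le> norm (?f x)" by simp
    qed
  qed
  let ?E = "\<lambda>c. c * (pairing ?M p (wgrad \<Omega> w) (wgrad \<Omega> \<psi>) + pairing ?G p (gdiff w) (gdiff \<psi>))"
  \<comment> \<open>The real \<open>c\<close> scales the test direction while the step \<tau> stays
    positive; \<open>c = 1\<close> and \<open>c = -1\<close> together give equality.\<close>
  have one_sided: "2 * \<mu> * (c * \<gamma>) * (LINT x|?M. k x) \<le> p * ?E c" for c :: real
  proof -
    define \<tau> where "\<tau> n = inverse (real (Suc n))" for n
    have \<tau>: "\<tau> \<longlonglongrightarrow> 0" "0 < \<tau> n" "0 \<le> \<tau> n" "\<tau> n \<le> 1" for n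
      unfolding \<tau>_def[abs_def] by (rule LIMSEQ_inverse_real_of_nat) (simp_all add: inverse_le_1_iff del: inverse_eq_divide)
    let ?g = "\<lambda>x. c *\<^sub>R wgrad \<Omega> \<psi> x" and ?d = "\<lambda>z. c *\<^sub>R gdiff \<psi> z"
    have Lg: "Lp ?M p ?g" using Lp_lincomb(1)[OF p L\<psi> L\<psi>, of c 0] by simp
    have Ld: "Lp ?G p ?d" using Lp_lincomb(1)[OF p G\<psi> G\<psi>, of c 0] by simp
    define P where "P n = pairing ?M p (\<lambda>x. wgrad \<Omega> w x + \<tau> n *\<^sub>R ?g x) ?g + pairing ?G p (\<lambda>z. gdiff w z + \<tau> n *\<^sub>R ?d z) ?d" for n
    have "P \<longlonglongrightarrow> pairing ?M p (wgrad \<Omega> w) ?g + pairing ?G p (gdiff w) ?d"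
      unfolding P_def[abs_def]
      by (rule tendsto_add[OF pairing_tendsto[OF p Lw Lg \<tau>(1,3,4)] pairing_tendsto[OF p Gw Ld \<tau>(1,3,4)]])
    also have "pairing ?M p (wgrad \<Omega> w) ?g + pairing ?G p (gdiff w) ?d = ?E c"
      by (simp add: pairing_def mult.left_commute[of _ c] distrib_left)
    finally have lim: "P \<longlonglongrightarrow> ?E c" .
    have "2 * \<mu> * (c * \<gamma>) * (LINT x|?M. k x) \<le> p * P n" for n
    proof -
      let ?y = "\<lambda>x. w x + (\<tau> n * c) * \<psi> x"
      have "AE x in ?M. wgrad \<Omega> ?y x = wgrad \<Omega> w x + \<tau> n *\<^sub>R ?g x"
        using W1p_lincomb(2)[OF open_domain p w' \<psi>', of 1 "\<tau> n * c"] by simp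
      moreover have "(\<lambda>x. wgrad \<Omega> w x + \<tau> n *\<^sub>R ?g x) \<in> borel_measurable ?M"
        using Lp_lincomb(1)[OF p Lw Lg, of 1 "\<tau> n"] by (simp add: Lp_def)
      ultimately have e1: "Lp_pow ?M p (wgrad \<Omega> ?y) = Lp_pow ?M p (\<lambda>x. wgrad \<Omega> w x + \<tau> n *\<^sub>R ?g x)"
        using W1p_Lp(2)[OF open_domain W01p_W1p[OF y]] by (intro Lp_pow_cong_AE) (simp_all add: Lp_def)
      have e2: "gdiff ?y = (\<lambda>z. gdiff w z + \<tau> n *\<^sub>R ?d z)"
        using gdiff_lincomb[of 1 w "\<tau> n * c" \<psi>] by (simp add: mult.assoc)
      have up: "energy1 \<Omega> p t ?y \<le> energy1 \<Omega> p t w + \<tau> n * (p * P n)"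
        using Lp_pow_tangent[OF p Lw Lg, of "\<tau> n"] Lp_pow_tangent[OF p Gw Ld, of "\<tau> n"]
        unfolding energy1_def e1 e2 P_def distrib_left by linarith
      have "(LINT x|?M. \<bar>w x\<bar> powr \<gamma> * \<bar>h x\<bar> powr \<delta>) + (\<tau> n * c * \<gamma>) * (LINT x|?M. k x)
          = (LINT x|?M. \<bar>w x\<bar> powr \<gamma> * \<bar>h x\<bar> powr \<delta> + (\<tau> n * c * \<gamma>) * k x)"
        by (simp only: Bochner_Integration.integral_add[OF iw integrable_mult_right[OF ik]] integral_mult_right_zero)
      also have "\<dots> \<le> (LINT x|?M. \<bar>?y x\<bar> powr \<gamma> * \<bar>h x\<bar> powr \<delta>)"
        by (rule integral_mono[OF Bochner_Integration.integrable_add[OF iw integrable_mult_right[OF ik]] iy tangent])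
      finally have "2 * \<mu> * ((LINT x|?M. \<bar>w x\<bar> powr \<gamma> * \<bar>h x\<bar> powr \<delta>) + (\<tau> n * c * \<gamma>) * (LINT x|?M. k x))
          \<le> 2 * \<mu> * (LINT x|?M. \<bar>?y x\<bar> powr \<gamma> * \<bar>h x\<bar> powr \<delta>)"
        using \<mu> by (intro mult_left_mono) auto
      \<comment> \<open>Minimality bounds the gain in coupling by the gain in energy; both estimates
        carry the factor \<open>\<tau> n\<close>, which cancels.\<close>
      then have "\<tau> n * (2 * \<mu> * (c * \<gamma>) * (LINT x|?M. k x)) \<le> \<tau> n * (p * P n)"
        using min[OF y[of "\<tau> n * c"]] up by (simp add: algebra_simps)
      then show ?thesis using \<tau>(2) by simp
    qed
    then show ?thesis
      by (intro tendsto_le[OF _ tendsto_mult_left[OF lim] tendsto_const]) (auto intro: always_eventually)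
  qed
  have "2 * \<mu> * \<gamma> * (LINT x|?M. k x) = p * ?E 1"
    using one_sided[of 1] one_sided[of "-1"] by (intro antisym) (simp_all add: algebra_simps)
  then have "?E 1 = \<mu> * (2 * \<gamma> / p) * (LINT x|?M. k x)" using p by (simp add: field_simps)
  moreover have "form_local \<Omega> p w \<psi> = pairing ?M p (wgrad \<Omega> w) (wgrad \<Omega> \<psi>)"
    by (simp add: form_local_def pairing_def set_integral_lborel_on[OF open_domain])
  ultimately show ?thesis
    by (simp add: form_nonlocal_eq_pairing W01p_borel_measurable[OF w] W01p_borel_measurable[OF \<psi>] set_integral_lborel_on[OF open_domain] k_def)
qed

lemma minimizer_energy:
  assumes "min_attained_at \<Omega> p r s \<alpha> \<beta> u v"
  shows "u \<in> W01p \<Omega> p" "v \<in> W01p \<Omega> p" "energy u v = 2 * lam * coupling u v" "0 < coupling u v" "0 \<le> lam"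
proof -
  have adm: "(u, v) \<in> admissible \<Omega> p" and J: "energy_J \<Omega> p r s \<alpha> \<beta> u v = lam"
    using assms by (auto simp: min_attained_at_def)
  show u: "u \<in> W01p \<Omega> p" and v: "v \<in> W01p \<Omega> p" using adm by (auto simp: admissible_def)
  show pos: "0 < coupling u v" using adm coupling_pos_iff[OF u v] by simp
  show "energy u v = 2 * lam * coupling u v" using J pos unfolding energy_J_eq[OF u v] by (simp add: field_simps)
  show "0 \<le> lam" by (rule lam_le_energy_J(2)[OF adm])
qed

lemma coupling_swap: "(LINT x|lborel_on \<Omega>. \<bar>z x\<bar> powr \<beta> * \<bar>w x\<bar> powr \<alpha>) = coupling w z"
  unfolding coupling_def by (simp add: mult.commute)

text \<open>Energy minus \<open>2 * lam\<close> times coupling is nonnegative and vanishes at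
  \<open>(u, v)\<close>. With one component frozen, the other therefore minimizes it, which is the
  hypothesis of \<open>first_variation\<close>.\<close>

lemma minimizer_eigenpair:
  assumes m: "min_attained_at \<Omega> p r s \<alpha> \<beta> u v"
  shows "eigenpair \<Omega> p r s \<alpha> \<beta> lam u v"
proof -
  note M = minimizer_energy[OF m]
  have "form_local \<Omega> p u \<psi> + form_nonlocal r p u \<psi> =
    lam * (2 * \<alpha> / p) * (LINT x:\<Omega>|lborel. \<bar>u x\<bar> powr (\<alpha> - 2) * u x * \<bar>v x\<bar> powr \<beta> * \<psi> x)" if "\<psi> \<in> W01p \<Omega> p" for \<psi>
  proof (rule first_variation[OF r \<alpha> \<beta> sum M(5) M(1,2) that])
    fix y assume "y \<in> W01p \<Omega> p"
    from energy_ge[OF this M(2)] show "energy1 \<Omega> p r u - 2 * lam * (LINT x|lborel_on \<Omega>. \<bar>u x\<bar> powr \<alpha> * \<bar>v x\<bar> powr \<beta>)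
      \<le> energy1 \<Omega> p r y - 2 * lam * (LINT x|lborel_on \<Omega>. \<bar>y x\<bar> powr \<alpha> * \<bar>v x\<bar> powr \<beta>)"
      using M(3) unfolding energy_def coupling_def by linarith
  qed
  moreover have "form_local \<Omega> p v \<psi> + form_nonlocal s p v \<psi> =
    lam * (2 * \<beta> / p) * (LINT x:\<Omega>|lborel. \<bar>v x\<bar> powr (\<beta> - 2) * v x * \<bar>u x\<bar> powr \<alpha> * \<psi> x)" if "\<psi> \<in> W01p \<Omega> p" for \<psi>
  proof (rule first_variation[OF s \<beta> \<alpha> _ M(5) M(2,1) that])
    show "\<beta> + \<alpha> = p" using sum by simp
    fix y assume "y \<in> W01p \<Omega> p"
    from energy_ge[OF M(1) this] show "energy1 \<Omega> p s v - 2 * lam * (LINT x|lborel_on \<Omega>. \<bar>v x\<bar> powr \<beta> * \<bar>u x\<bar> powr \<alpha>)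
      \<le> energy1 \<Omega> p s y - 2 * lam * (LINT x|lborel_on \<Omega>. \<bar>y x\<bar> powr \<beta> * \<bar>u x\<bar> powr \<alpha>)"
      using M(3) unfolding energy_def coupling_swap by linarith
  qed
  ultimately have "weak_solution \<Omega> p r s \<alpha> \<beta> lam u v"
    unfolding weak_solution_def sum using M(1,2) by (simp add: mult_ac)
  moreover have "\<not> (AE x in lborel. x \<in> \<Omega> \<longrightarrow> u x = 0 \<and> v x = 0)"
  proof
    assume "AE x in lborel. x \<in> \<Omega> \<longrightarrow> u x = 0 \<and> v x = 0"
    then have "AE x in lborel. x \<in> \<Omega> \<longrightarrow> u x * v x = 0" by (rule AE_mp) (rule AE_I2, simp)
    then show False using m unfolding min_attained_at_def admissible_def by blast
  qed
  ultimately show ?thesis by (simp add: eigenpair_def)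
qed

text \<open>The energies of the components are recorded separately, and not only their sum, because
  the comparison of the proportionality factors at the end uses each equation on its own.\<close>

lemma weak_solution_energy:
  assumes "weak_solution \<Omega> p r s \<alpha> \<beta> lam u v"
  shows "energy1 \<Omega> p r u = lam * (2 * \<alpha> / p) * coupling u v"
    and "energy1 \<Omega> p s v = lam * (2 * \<beta> / p) * coupling u v"
    and "energy u v = 2 * lam * coupling u v"
proof -
  have u: "u \<in> W01p \<Omega> p" and v: "v \<in> W01p \<Omega> p" using assms by (auto simp: weak_solution_def)
  have e: "energy1 \<Omega> p t w = form_local \<Omega> p w w + form_nonlocal t p w w" if "w \<in> W01p \<Omega> p" for t w
    using W01p_borel_measurable[OF that]
    by (simp add: energy1_def form_nonlocal_eq_pairing pairing_self form_local_def set_integral_lborel_on[OF open_domain]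
        pairing_def[symmetric])
  have 1: "\<bar>u x\<bar> powr (\<alpha> - 2) * u x * \<bar>v x\<bar> powr \<beta> * u x = \<bar>u x\<bar> powr \<alpha> * \<bar>v x\<bar> powr \<beta>" for x
    using abs_powr_times_self[of "u x" \<alpha>] by (metis mult.assoc mult.commute)
  have 2: "\<bar>u x\<bar> powr \<alpha> * \<bar>v x\<bar> powr (\<beta> - 2) * v x * v x = \<bar>u x\<bar> powr \<alpha> * \<bar>v x\<bar> powr \<beta>" for x
    using abs_powr_times_self[of "v x" \<beta>] by (simp add: mult.assoc)
  show A: "energy1 \<Omega> p r u = lam * (2 * \<alpha> / p) * coupling u v"
    using assms u unfolding weak_solution_def e[OF u] sum coupling_def
    by (simp add: set_integral_lborel_on[OF open_domain] 1)
  show B: "energy1 \<Omega> p s v = lam * (2 * \<beta> / p) * coupling u v"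
    using assms v unfolding weak_solution_def e[OF v] sum coupling_def
    by (simp add: set_integral_lborel_on[OF open_domain] 2)
  have "2 * \<alpha> / p + 2 * \<beta> / p = 2" using sum p by (simp add: add_divide_distrib[symmetric] distrib_left[symmetric])
  then have "lam * coupling u v * (2 * \<alpha> / p + 2 * \<beta> / p) = lam * coupling u v * 2" by simp
  then show "energy u v = 2 * lam * coupling u v"
    unfolding energy_def A B by (simp add: algebra_simps)
qed

text \<open>Up to small errors, energy plus deficits of the curve stays below
  \<open>2 * lam * K\<close>, while by Fatou its coupling is at least \<open>K\<close>;
  \<open>energy_ge\<close> leaves no room for the deficits.\<close>

lemma minimizers_parallel:
  assumes u: "u \<in> W01p \<Omega> p" and v: "v \<in> W01p \<Omega> p" and a: "a \<in> W01p \<Omega> p" and b: "b \<in> W01p \<Omega> p"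
    and uv: "energy u v = 2 * lam * coupling u v" and ab: "energy a b = 2 * lam * coupling a b" and lam: "0 \<le> lam"
  shows "AE z in (lborel \<Otimes>\<^sub>M lborel). u (fst z) * a (snd z) = u (snd z) * a (fst z)"
    and "AE z in (lborel \<Otimes>\<^sub>M lborel). v (fst z) * b (snd z) = v (snd z) * b (fst z)"
proof -
  let ?M = "lborel_on \<Omega>"
  obtain \<sigma> d where \<sigma>: "\<And>n. \<sigma> n \<in> W01p \<Omega> p" "AE x in lborel. (\<lambda>n. \<sigma> n x) \<longlonglongrightarrow> pair_norm p (u x) (a x)" "\<And>n::nat. 0 \<le> d n"
    "\<And>e. 0 < e \<Longrightarrow> \<forall>\<^sub>F n in sequentially. energy1 \<Omega> p r (\<sigma> n) + d n < (energy1 \<Omega> p r u + energy1 \<Omega> p r a) / 2 + e"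
    "(\<forall>e>0. \<forall>\<^sub>F n in sequentially. d n \<le> e) \<longrightarrow>
      (AE z in (lborel \<Otimes>\<^sub>M lborel). u (fst z) * a (snd z) = u (snd z) * a (fst z))"
    by (rule midpoint_sequence[OF open_domain p r u a]) (rule that)
  obtain \<tau> d' where \<tau>: "\<And>n. \<tau> n \<in> W01p \<Omega> p" "AE x in lborel. (\<lambda>n. \<tau> n x) \<longlonglongrightarrow> pair_norm p (v x) (b x)" "\<And>n::nat. 0 \<le> d' n"
    "\<And>e. 0 < e \<Longrightarrow> \<forall>\<^sub>F n in sequentially. energy1 \<Omega> p s (\<tau> n) + d' n < (energy1 \<Omega> p s v + energy1 \<Omega> p s b) / 2 + e"
    "(\<forall>e>0. \<forall>\<^sub>F n in sequentially. d' n \<le> e) \<longrightarrow>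
      (AE z in (lborel \<Otimes>\<^sub>M lborel). v (fst z) * b (snd z) = v (snd z) * b (fst z))"
    by (rule midpoint_sequence[OF open_domain p s v b]) (rule that)
  define K where "K = (coupling u v + coupling a b) / 2"
  define g where "g x = pair_norm p (u x) (a x) powr \<alpha> * pair_norm p (v x) (b x) powr \<beta>" for x
  have [measurable]: "u \<in> borel_measurable borel" "v \<in> borel_measurable borel"
      "a \<in> borel_measurable borel" "b \<in> borel_measurable borel"
    by (rule W01p_borel_measurable[OF u], rule W01p_borel_measurable[OF v],
        rule W01p_borel_measurable[OF a], rule W01p_borel_measurable[OF b])
  have "g \<in> borel_measurable borel" unfolding g_def[abs_def] pair_norm_def by measurable
  then have gm: "g \<in> borel_measurable ?M" by (rule borel_measurable_lborel_on)
  have "ennreal K = (\<integral>\<^sup>+x. ennreal ((\<bar>u x\<bar> powr \<alpha> * \<bar>v x\<bar> powr \<beta> + \<bar>a x\<bar> powr \<alpha> * \<bar>b x\<bar> powr \<beta>) / 2) \<partial>?M)"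
    unfolding K_def coupling_def
    using product_integrable[OF u v \<alpha> \<beta> sum] product_integrable[OF a b \<alpha> \<beta> sum]
    by (subst nn_integral_eq_integral) (simp_all add: add_nonneg_nonneg)
  also have "\<dots> \<le> (\<integral>\<^sup>+x. ennreal (g x) \<partial>?M)"
    unfolding g_def by (intro nn_integral_mono ennreal_leI pair_norm_product_ge[OF \<alpha> \<beta> sum])
  finally have K: "ennreal K \<le> (\<integral>\<^sup>+x. ennreal (g x) \<partial>?M)" .
  have "AE x in lborel. (\<lambda>n. \<bar>\<sigma> n x\<bar> powr \<alpha> * \<bar>\<tau> n x\<bar> powr \<beta>) \<longlonglongrightarrow> g x"
    using \<sigma>(2) \<tau>(2)
  proof eventually_elim
    case (elim x)
    have "(\<lambda>n. \<bar>\<sigma> n x\<bar> powr \<alpha> * \<bar>\<tau> n x\<bar> powr \<beta>) \<longlonglongrightarrow> \<bar>pair_norm p (u x) (a x)\<bar> powr \<alpha> * \<bar>pair_norm p (v x) (b x)\<bar> powr \<beta>"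
      using elim \<alpha> \<beta> by (intro tendsto_mult tendsto_powr' tendsto_rabs tendsto_const) auto
    then show ?case by (simp add: g_def pair_norm_nonneg)
  qed
  then have lim: "AE x in ?M. (\<lambda>n. \<bar>\<sigma> n x\<bar> powr \<alpha> * \<bar>\<tau> n x\<bar> powr \<beta>) \<longlonglongrightarrow> g x"
    unfolding AE_lborel_on[OF open_domain] by (rule AE_mp) (rule AE_I2, blast)
  have fatou: "\<forall>\<^sub>F n in sequentially. K - e < coupling (\<sigma> n) (\<tau> n)" if "0 < e" for e
    unfolding coupling_def
    by (rule nn_integral_Fatou_eventually[OF product_integrable[OF \<sigma>(1) \<tau>(1) \<alpha> \<beta> sum] _ gm lim K that]) simp
  have small: "\<forall>\<^sub>F n in sequentially. d n + d' n \<le> e" if "0 < e" for e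
  proof -
    \<comment> \<open>Each of the two energy estimates costs \<open>e'\<close> and the coupling
      costs \<open>2 * lam * e'\<close>; the denominator makes these add up to \<open>e\<close> and
      is positive because \<open>lam \<ge> 0\<close>.\<close>
    define e' where "e' = e / (2 + 2 * lam)"
    have "2 * e' + 2 * lam * e' = (2 + 2 * lam) * e'" by (simp add: distrib_right)
    also have "\<dots> = e" using lam unfolding e'_def by simp
    finally have e': "0 < e'" "2 * e' + 2 * lam * e' = e" using that lam unfolding e'_def by simp_all
    show ?thesis using \<sigma>(4)[OF e'(1)] \<tau>(4)[OF e'(1)] fatou[OF e'(1)]
    proof eventually_elim
      case (elim n)
      have "2 * lam * (K - e') \<le> 2 * lam * coupling (\<sigma> n) (\<tau> n)"
        using elim(3) lam by (intro mult_left_mono) auto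
      also have "\<dots> \<le> energy (\<sigma> n) (\<tau> n)" by (rule energy_ge[OF \<sigma>(1) \<tau>(1)])
      finally have 1: "2 * lam * K - 2 * lam * e' \<le> energy (\<sigma> n) (\<tau> n)" by (simp add: algebra_simps)
      have "energy u v + energy a b = 2 * (2 * lam * K)" unfolding uv ab K_def by (simp add: algebra_simps)
      \<comment> \<open>The nonlinear products get names, so that the remaining claim is linear
        arithmetic in independent variables.\<close>
      moreover define X Y where "X = 2 * lam * K" and "Y = 2 * lam * e'"
      ultimately have "energy u v + energy a b = 2 * X" "X - Y \<le> energy (\<sigma> n) (\<tau> n)" "2 * e' + Y = e"
        using 1 e'(2) by simp_all
      moreover have "d1 + d2 \<le> e0" if "u1 + v1 + (a1 + b1) = 2 * X0" "X0 - Y0 \<le> s1 + t1" "2 * e1 + Y0 = e0"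
        "s1 + d1 < (u1 + a1) / 2 + e1" "t1 + d2 < (v1 + b1) / 2 + e1"
        for d1 d2 e0 e1 u1 v1 a1 b1 s1 t1 X0 Y0 :: real
        using that by (simp add: field_simps)
      ultimately show ?case using elim(1,2) unfolding energy_def by blast
    qed
  qed
  have "\<forall>\<^sub>F n in sequentially. d n \<le> e" if "0 < e" for e
    using small[OF that]
  proof eventually_elim
    case (elim n)
    then show ?case using \<tau>(3)[of n] by linarith
  qed
  then show "AE z in (lborel \<Otimes>\<^sub>M lborel). u (fst z) * a (snd z) = u (snd z) * a (fst z)"
    using \<sigma>(5) by blast
  have "\<forall>\<^sub>F n in sequentially. d' n \<le> e" if "0 < e" for e
    using small[OF that]
  proof eventually_elim
    case (elim n)
    then show ?case using \<sigma>(3)[of n] by linarith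
  qed
  then show "AE z in (lborel \<Otimes>\<^sub>M lborel). v (fst z) * b (snd z) = v (snd z) * b (fst z)"
    using \<tau>(5) by blast
qed

text \<open>A vanishing seminorm makes \<open>u\<close> constant almost everywhere; a bounded
  \<Omega> has a complement of positive measure, where \<open>u\<close> is 0, so the constant is 0.
  Positivity allows the energies to be cancelled in the final comparison.\<close>

lemma energy1_pos:
  assumes t: "0 < t" "t < 1" and u: "u \<in> W01p \<Omega> p" and nz: "\<not> (AE x in lborel. u x = 0)"
  shows "0 < energy1 \<Omega> p t u"
proof (rule ccontr)
  let ?G = "gmeasure p t :: ('a \<times> 'a) measure"
  assume "\<not> 0 < energy1 \<Omega> p t u"
  then have "Lp_pow ?G p (gdiff u) = 0"
    using Lp_pow_nonneg[of "lborel_on \<Omega>" p "wgrad \<Omega> u"] Lp_pow_nonneg[of ?G p "gdiff u"]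
    unfolding energy1_def by linarith
  then have "AE z in ?G. norm (gdiff u z) powr p = 0"
    using W01p_Lp_gdiff[OF open_domain p t u] unfolding Lp_def Lp_pow_def
    by (subst (asm) integral_nonneg_eq_0_iff_AE) auto
  then have "AE z in ?G. u (fst z) = u (snd z)"
    by (rule AE_mp) (rule AE_I2, simp add: gdiff_def)
  then have "AE z in (lborel \<Otimes>\<^sub>M lborel). u (fst z) = u (snd z)"
    by (rule AE_gmeasureD) simp
  then have ae: "AE x in lborel. AE y in lborel. u x = u y"
    using lborel_pair.AE_pair[of "\<lambda>z. u (fst z) = u (snd z)"] by simp
  have "\<exists>x. x \<notin> \<Omega> \<and> (AE y in lborel. u x = u y)"
  proof (rule ccontr)
    assume n: "\<not> ?thesis"
    have "AE x in lborel. x \<in> \<Omega>" using ae by (rule AE_mp) (use n in auto)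
    then have "emeasure lborel \<Omega> = emeasure lborel (UNIV :: 'a set)"
      using open_domain by (intro emeasure_eq_AE) auto
    then show False using emeasure_bounded_finite[OF bounded_domain] emeasure_lborel_UNIV[where 'a = 'a] by simp
  qed
  then obtain x where x: "x \<notin> \<Omega>" "AE y in lborel. u x = u y" by blast
  have "AE y in lborel. u y = 0"
    using x(2) by (rule AE_mp) (rule AE_I2, simp add: W01p_zero_outside[OF u x(1)])
  then show False using nz by simp
qed

lemma energy1_scale:
  assumes u: "u \<in> W01p \<Omega> p" and a: "a \<in> W01p \<Omega> p" and eq: "AE x in lborel. a x = k * u x"
    and t: "0 < t" "t < 1"
  shows "energy1 \<Omega> p t a = \<bar>k\<bar> powr p * energy1 \<Omega> p t u"
proof -
  let ?M = "lborel_on \<Omega>" and ?G = "gmeasure p t :: ('a \<times> 'a) measure"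
  note u' = W01p_W1p[OF u] and a' = W01p_W1p[OF a]
  note L = W1p_Lp(2)[OF open_domain u'] W1p_Lp(2)[OF open_domain a']
  note G = W01p_Lp_gdiff[OF open_domain p t u] W01p_Lp_gdiff[OF open_domain p t a]
  \<comment> \<open>The dummy summand \<open>0 * u x\<close> brings the relation into the form of
    \<open>weak_gradient_lincomb\<close>.\<close>
  have "AE x in lborel. x \<in> \<Omega> \<longrightarrow> a x = k * u x + 0 * u x" using eq by (rule AE_mp) (rule AE_I2, simp)
  from weak_gradient_unique[OF open_domain weak_gradient_wgrad[OF a']
      weak_gradient_lincomb[OF weak_gradient_wgrad[OF u'] weak_gradient_wgrad[OF u']] this]
  have "AE x in ?M. wgrad \<Omega> a x = k *\<^sub>R wgrad \<Omega> u x" by (simp add: AE_lborel_on[OF open_domain])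
  then have "Lp_pow ?M p (wgrad \<Omega> a) = Lp_pow ?M p (\<lambda>x. k *\<^sub>R wgrad \<Omega> u x)"
    using L by (intro Lp_pow_cong_AE) (auto simp: Lp_def)
  moreover have "AE z in ?G. gdiff a z = k *\<^sub>R gdiff u z"
    using AE_gmeasure[OF eq, of p t] by (rule AE_mp) (rule AE_I2, simp add: gdiff_def right_diff_distrib)
  then have "Lp_pow ?G p (gdiff a) = Lp_pow ?G p (\<lambda>z. k *\<^sub>R gdiff u z)"
    using G by (intro Lp_pow_cong_AE) (auto simp: Lp_def)
  ultimately show ?thesis unfolding energy1_def Lp_pow_scale by (simp add: distrib_left)
qed

lemma coupling_scale:
  assumes "u \<in> W01p \<Omega> p" "v \<in> W01p \<Omega> p" "a \<in> W01p \<Omega> p" "b \<in> W01p \<Omega> p"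
    and eq: "AE x in lborel. a x = k * u x" "AE x in lborel. b x = m * v x"
  shows "coupling a b = \<bar>k\<bar> powr \<alpha> * \<bar>m\<bar> powr \<beta> * coupling u v"
proof -
  note I = product_integrable[OF assms(3,4) \<alpha> \<beta> sum] product_integrable[OF assms(1,2) \<alpha> \<beta> sum]
  have "AE x in lborel. x \<in> \<Omega> \<longrightarrow> \<bar>a x\<bar> powr \<alpha> * \<bar>b x\<bar> powr \<beta> = (\<bar>k\<bar> powr \<alpha> * \<bar>m\<bar> powr \<beta>) * (\<bar>u x\<bar> powr \<alpha> * \<bar>v x\<bar> powr \<beta>)"
    using eq by eventually_elim (simp add: abs_mult powr_mult mult_ac)
  then have "AE x in lborel_on \<Omega>. \<bar>a x\<bar> powr \<alpha> * \<bar>b x\<bar> powr \<beta> = (\<bar>k\<bar> powr \<alpha> * \<bar>m\<bar> powr \<beta>) * (\<bar>u x\<bar> powr \<alpha> * \<bar>v x\<bar> powr \<beta>)"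
    by (simp add: AE_lborel_on[OF open_domain])
  then have "coupling a b = (LINT x|lborel_on \<Omega>. (\<bar>k\<bar> powr \<alpha> * \<bar>m\<bar> powr \<beta>) * (\<bar>u x\<bar> powr \<alpha> * \<bar>v x\<bar> powr \<beta>))"
    unfolding coupling_def
    by (rule integral_cong_AE[OF borel_measurable_integrable[OF I(1)] borel_measurable_integrable[OF integrable_mult_right[OF I(2)]]])
  then show ?thesis by (simp add: coupling_def)
qed

text \<open>Each equation ties the energy of its component to the coupling. The energies scale by
  \<open>\<bar>k\<bar> powr p\<close> and \<open>\<bar>l\<bar> powr p\<close>, the coupling by one
  common factor, so the moduli agree; the two relative signs are the two alternatives of the
  conclusion.\<close>

lemma eigenvalue_simple:
  assumes m: "min_attained_at \<Omega> p r s \<alpha> \<beta> u v" and e: "eigenpair \<Omega> p r s \<alpha> \<beta> lam a b"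
  obtains k where "k \<noteq> 0" "(AE x in lborel. a x = k * u x \<and> b x = k * v x) \<or> (AE x in lborel. a x = k * u x \<and> b x = k * (- v x))"
proof -
  note M = minimizer_energy[OF m]
  have ws: "weak_solution \<Omega> p r s \<alpha> \<beta> lam u v" "weak_solution \<Omega> p r s \<alpha> \<beta> lam a b"
    using minimizer_eigenpair[OF m] e by (auto simp: eigenpair_def)
  have a: "a \<in> W01p \<Omega> p" and b: "b \<in> W01p \<Omega> p" using ws(2) by (auto simp: weak_solution_def)
  note E = weak_solution_energy[OF ws(1)] and F = weak_solution_energy[OF ws(2)]
  note par = minimizers_parallel[OF M(1,2) a b M(3) F(3) M(5)]
  have nz: "\<not> (AE x in lborel. u x = 0)" "\<not> (AE x in lborel. v x = 0)"
  proof -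
    have adm: "\<not> (AE x in lborel. x \<in> \<Omega> \<longrightarrow> u x * v x = 0)"
      using m by (simp add: min_attained_at_def admissible_def)
    show "\<not> (AE x in lborel. u x = 0)"
    proof
      assume "AE x in lborel. u x = 0"
      then have "AE x in lborel. x \<in> \<Omega> \<longrightarrow> u x * v x = 0" by (rule AE_mp) (rule AE_I2, simp)
      then show False using adm by simp
    qed
    show "\<not> (AE x in lborel. v x = 0)"
    proof
      assume "AE x in lborel. v x = 0"
      then have "AE x in lborel. x \<in> \<Omega> \<longrightarrow> u x * v x = 0" by (rule AE_mp) (rule AE_I2, simp)
      then show False using adm by simp
    qed
  qed
  obtain k where k: "AE x in lborel. a x = k * u x" by (rule AE_proportional[OF par(1) nz(1)]) (rule that)
  obtain l where l: "AE x in lborel. b x = l * v x" by (rule AE_proportional[OF par(2) nz(2)]) (rule that)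
  let ?c = "\<bar>k\<bar> powr \<alpha> * \<bar>l\<bar> powr \<beta>"
  note C = coupling_scale[OF M(1,2) a b k l]
  have "\<bar>k\<bar> powr p * energy1 \<Omega> p r u = ?c * energy1 \<Omega> p r u"
    unfolding energy1_scale[OF M(1) a k r, symmetric] F(1) C unfolding E(1) by simp
  then have 1: "\<bar>k\<bar> powr p = ?c" using energy1_pos[OF r M(1) nz(1)] by simp
  have "\<bar>l\<bar> powr p * energy1 \<Omega> p s v = ?c * energy1 \<Omega> p s v"
    unfolding energy1_scale[OF M(2) b l s, symmetric] F(2) C unfolding E(2) by simp
  then have "\<bar>l\<bar> powr p = ?c" using energy1_pos[OF s M(2) nz(2)] by simp
  then have kp: "\<bar>k\<bar> powr p = \<bar>l\<bar> powr p" using 1 by simp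
  have p0: "0 < p" using p by simp
  have kl: "\<bar>k\<bar> = \<bar>l\<bar>"
    by (rule antisym; rule powr_le_imp_le[OF p0 abs_ge_zero]; simp only: kp order_refl)
  have "k \<noteq> 0"
  proof
    assume "k = 0"
    moreover from this have "l = 0" using kl by simp
    ultimately have "AE x in lborel. x \<in> \<Omega> \<longrightarrow> a x = 0 \<and> b x = 0"
      using k l by (auto elim: eventually_elim2)
    then show False using e by (simp add: eigenpair_def)
  qed
  moreover have "(AE x in lborel. a x = k * u x \<and> b x = k * v x) \<or> (AE x in lborel. a x = k * u x \<and> b x = k * (- v x))"
  proof (cases "l = k")
    case True
    then show ?thesis using k l by simp
  next
    case False
    then have "l = - k" using kl by linarith
    then show ?thesis using k l by simp
  qed
  ultimately show thesis by (rule that)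
qed

end

theorem theorem1p2:
  fixes \<Omega> :: "'a::euclidean_space set" and p r s \<alpha> \<beta> :: real
    and u v :: "'a \<Rightarrow> real"
  assumes "bounded \<Omega>" and "open \<Omega>" and "connected \<Omega>"
    and "1 < p" and "0 < r" and "r < 1" and "0 < s" and "s < 1"
    and "1 \<le> \<alpha>" and "1 \<le> \<beta>" and "\<alpha> + \<beta> = p"
    and "min_attained_at \<Omega> p r s \<alpha> \<beta> u v"
  shows "eigenpair \<Omega> p r s \<alpha> \<beta> (lambda_p \<Omega> p r s \<alpha> \<beta>) u v \<and>
    (\<forall>u' v'. eigenpair \<Omega> p r s \<alpha> \<beta> (lambda_p \<Omega> p r s \<alpha> \<beta>) u' v' \<longrightarrow>
      (\<exists>k. k \<noteq> 0 \<and>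
        ((AE x in lborel. u' x = k * u x \<and> v' x = k * v x) \<or>
         (AE x in lborel. u' x = k * u x \<and> v' x = k * (- v x)))))"
proof -
  interpret coupled_system \<Omega> p r s \<alpha> \<beta>
    by unfold_locales fact+
  show ?thesis
  proof (intro conjI allI impI)
    show "eigenpair \<Omega> p r s \<alpha> \<beta> lam u v" by (rule minimizer_eigenpair[OF assms(12)])
    fix u' v' assume e: "eigenpair \<Omega> p r s \<alpha> \<beta> lam u' v'"
    obtain k where "k \<noteq> 0" "(AE x in lborel. u' x = k * u x \<and> v' x = k * v x) \<or>
        (AE x in lborel. u' x = k * u x \<and> v' x = k * (- v x))"
      by (rule eigenvalue_simple[OF assms(12) e]) (rule that)
    then show "\<exists>k. k \<noteq> 0 \<and> ((AE x in lborel. u' x = k * u x \<and> v' x = k * v x) \<or>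
        (AE x in lborel. u' x = k * u x \<and> v' x = k * (- v x)))" by blast
  qed
qed

end
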